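(* Let $n\geqslant1$, and let $\psi_0\in H^2(\mathbb{R}^n)\cap L^1(\mathbb{R}^n)$ and $\psi_1\in H^1(\mathbb{R}^n)\cap L^1(\mathbb{R}^n)$ be such that $\psi_2=b\nu\Delta\psi_1+\Delta\psi_0$. Let $\psi$ be the solution to the linear Blackstock problem with data $(\psi_0,\psi_1,\psi_2)$, let $\psi^{(0)}$ be the solution to the viscoelastic damped wave equation with data $(\psi_0,\psi_1)$ (both problems are written in the context), and let $u:=\psi-\psi^{(0)}$. Then $$\sup_{t\in[0,\infty)}\left((\mathcal G_1(1+t))^{-1}\|u(t,\cdot)\|_{L^2}\right)\leqslant\sqrt\kappa\,C\left(\|\psi_0\|_{H^2\cap L^1}+\|\psi_1\|_{H^1\cap L^1}\right),$$ where $C$ is a positive constant independent of $\kappa$, and $\mathcal G_1(1+t):=(1+t)^{\frac14}$ if $n=1$, $\mathcal G_1(1+t):=(\ln(\mathrm{e}+t))^{\frac12}$ if $n=2$, $\mathcal G_1(1+t):=1$ if $n\geqslant3$.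
   Context: Parameters: $b>0$, $\nu>0$, $\gamma\in(1,5/3]$, $\delta:=b\nu+(\gamma-1)\kappa$, and $0<\kappa\ll1$, i.e. $\kappa>0$ is sufficiently small with respect to the other parameters. The initial data are independent of $\kappa$; standing assumption: $\psi_0$ and $\psi_1$ are nontrivial, and $\psi_2$ is nontrivial. Linear Blackstock problem ($x\in\mathbb{R}^n$, $t>0$): $$(\partial_t-\kappa\Delta)(\psi_{tt}-\Delta\psi-\delta\Delta\psi_t)+\kappa(\gamma-1)(b\nu-\kappa)\Delta^2\psi_t=0,\quad \psi(0,x)=\psi_0(x),\ \psi_t(0,x)=\psi_1(x),\ \psi_{tt}(0,x)=\psi_2(x).$$ Viscoelastic damped wave equation ($x\in\mathbb{R}^n$, $t>0$): $$\psi^{(0)}_{tt}-\Delta\psi^{(0)}-b\nu\Delta\psi^{(0)}_t=0,\quad \psi^{(0)}(0,x)=\psi_0(x),\ \psi^{(0)}_t(0,x)=\psi_1(x).$$ Solutions are obtained by solving the corresponding linear ODEs in $t$ for the partial Fourier transform with respect to $x$. The constant $C$ does not depend on $t$ or on the data either. The norm of an intersection is the sum of the norms. *)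

theory Defs
  imports "HOL-Analysis.Analysis"
begin

definition partial_deriv :: "'a::euclidean_space \<Rightarrow> ('a \<Rightarrow> complex) \<Rightarrow> 'a \<Rightarrow> complex" where
  "partial_deriv i f = (\<lambda>x. frechet_derivative f (at x) i)"

text \<open>The list \<open>is\<close> of basis vectors plays the role of a multi-index.\<close>

definition schwartz :: "('a::euclidean_space \<Rightarrow> complex) \<Rightarrow> bool" where
  "schwartz \<phi> \<longleftrightarrow> (\<forall>is. set is \<subseteq> Basis \<longrightarrow>
     (\<forall>x. foldr partial_deriv is \<phi> differentiable (at x)) \<and>
     (\<forall>k. bounded (range (\<lambda>x. (norm x ^ k) *\<^sub>R foldr partial_deriv is \<phi> x))))"

definition laplacian :: "('a::euclidean_space \<Rightarrow> complex) \<Rightarrow> 'a \<Rightarrow> complex" where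
  "laplacian \<phi> = (\<lambda>x. \<Sum>i\<in>Basis. partial_deriv i (partial_deriv i \<phi>) x)"

definition fourier :: "('a::euclidean_space \<Rightarrow> complex) \<Rightarrow> 'a \<Rightarrow> complex" where
  "fourier \<phi> \<xi> = (LINT x|lborel. cis (- (x \<bullet> \<xi>)) * \<phi> x)"

text \<open>A distribution is given by its values on test functions. Only the values on Schwartz
  functions are meaningful, so distributions are compared by \<open>dist_eq\<close>.\<close>

type_synonym 'a distrib = "('a \<Rightarrow> complex) \<Rightarrow> complex"

definition dist_eq :: "'a::euclidean_space distrib \<Rightarrow> 'a distrib \<Rightarrow> bool" where
  "dist_eq S T \<longleftrightarrow> (\<forall>\<phi>. schwartz \<phi> \<longrightarrow> S \<phi> = T \<phi>)"

definition dist_of :: "('a::euclidean_space \<Rightarrow> complex) \<Rightarrow> 'a distrib" where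
  "dist_of f = (\<lambda>\<phi>. LINT x|lborel. f x * \<phi> x)"

definition dist_laplacian :: "'a::euclidean_space distrib \<Rightarrow> 'a distrib" where
  "dist_laplacian T = (\<lambda>\<phi>. T (laplacian \<phi>))"

definition has_fourier_transform :: "'a::euclidean_space distrib \<Rightarrow> ('a \<Rightarrow> complex) \<Rightarrow> bool" where
  "has_fourier_transform T g \<longleftrightarrow> g \<in> borel_measurable lborel \<and>
     (\<forall>\<phi>. schwartz \<phi> \<longrightarrow>
        integrable lborel (\<lambda>\<xi>. g \<xi> * \<phi> \<xi>) \<and> T (fourier \<phi>) = (LINT \<xi>|lborel. g \<xi> * \<phi> \<xi>))"

definition fourier_transform :: "'a::euclidean_space distrib \<Rightarrow> 'a \<Rightarrow> complex" where
  "fourier_transform T = (SOME g. has_fourier_transform T g)"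

definition in_L1 :: "('a::euclidean_space \<Rightarrow> complex) \<Rightarrow> bool" where
  "in_L1 f \<longleftrightarrow> integrable lborel f"

definition L1_norm :: "('a::euclidean_space \<Rightarrow> complex) \<Rightarrow> real" where
  "L1_norm f = (LINT x|lborel. norm (f x))"

definition in_L2 :: "('a::euclidean_space \<Rightarrow> complex) \<Rightarrow> bool" where
  "in_L2 f \<longleftrightarrow> f \<in> borel_measurable lborel \<and> integrable lborel (\<lambda>x. (norm (f x))\<^sup>2)"

definition L2_norm :: "('a::euclidean_space \<Rightarrow> complex) \<Rightarrow> real" where
  "L2_norm f = sqrt (LINT x|lborel. (norm (f x))\<^sup>2)"

text \<open>Bessel potential spaces for orders \<open>s \<ge> 0\<close>. As \<open>fourier\<close> is not
  normalised, the factor \<open>(2\<pi>)\<close> to the power \<open>-n/2\<close> makes the norm of order \<open>0\<close> the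
  \<open>L\<^sup>2\<close> norm.\<close>

definition bessel_weighted :: "real \<Rightarrow> ('a::euclidean_space \<Rightarrow> complex) \<Rightarrow> 'a \<Rightarrow> complex" where
  "bessel_weighted s f = (\<lambda>\<xi>. (1 + (norm \<xi>)\<^sup>2) powr (s / 2) *\<^sub>R fourier_transform (dist_of f) \<xi>)"

definition in_H :: "real \<Rightarrow> ('a::euclidean_space \<Rightarrow> complex) \<Rightarrow> bool" where
  "in_H s f \<longleftrightarrow> in_L2 f \<and> in_L2 (bessel_weighted s f)"

definition H_norm :: "real \<Rightarrow> ('a::euclidean_space \<Rightarrow> complex) \<Rightarrow> real" where
  "H_norm s f = (2 * pi) powr (- (real DIM('a) / 2)) * L2_norm (bessel_weighted s f)"

text \<open>In the ordinary differential equations below, \<open>L\<close> is the Fourier symbol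
  \<open>-|\<xi>|\<^sup>2\<close> of the Laplacian, and \<open>w1\<close>, \<open>w2\<close> are the first two time derivatives of \<open>w\<close>.
  All derivatives at time \<open>0\<close> are one-sided.\<close>

text \<open>With \<open>v\<close> standing for \<open>\<psi>\<^sub>t\<^sub>t - \<Delta>\<psi> - \<delta>\<Delta>\<psi>\<^sub>t\<close>, the last conjunct is
  \<open>v\<^sub>t - \<kappa>\<Delta>v + \<kappa>(\<gamma>-1)(b\<nu>-\<kappa>)\<Delta>\<^sup>2\<psi>\<^sub>t = 0\<close> solved for \<open>v\<^sub>t\<close>.\<close>

definition blackstock_ode ::
  "real \<Rightarrow> real \<Rightarrow> real \<Rightarrow> real \<Rightarrow> real \<Rightarrow>
   (real \<Rightarrow> complex) \<Rightarrow> (real \<Rightarrow> complex) \<Rightarrow> (real \<Rightarrow> complex) \<Rightarrow> bool" where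
  "blackstock_ode b \<nu> \<gamma> \<kappa> L w w1 w2 \<longleftrightarrow>
     (let \<delta> = b * \<nu> + (\<gamma> - 1) * \<kappa>;
          v = (\<lambda>t. w2 t - L *\<^sub>R w t - (\<delta> * L) *\<^sub>R w1 t)
      in \<forall>t\<ge>0.
        (w has_vector_derivative w1 t) (at t within {0..}) \<and>
        (w1 has_vector_derivative w2 t) (at t within {0..}) \<and>
        (v has_vector_derivative
           ((\<kappa> * L) *\<^sub>R v t - (\<kappa> * (\<gamma> - 1) * (b * \<nu> - \<kappa>) * L\<^sup>2) *\<^sub>R w1 t)) (at t within {0..}))"

definition viscoelastic_ode ::
  "real \<Rightarrow> real \<Rightarrow> real \<Rightarrow> (real \<Rightarrow> complex) \<Rightarrow> (real \<Rightarrow> complex) \<Rightarrow> bool" where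
  "viscoelastic_ode b \<nu> L w w1 \<longleftrightarrow>
     (\<forall>t\<ge>0.
        (w has_vector_derivative w1 t) (at t within {0..}) \<and>
        (w1 has_vector_derivative (L *\<^sub>R w t + (b * \<nu> * L) *\<^sub>R w1 t)) (at t within {0..}))"

text \<open>The time derivatives \<open>w1\<close>, \<open>w2\<close> are pointwise in the frequency \<open>\<xi>\<close>, for
  a version \<open>w\<close> of the partial Fourier transform. The third datum is a distribution, since
  \<open>b\<nu>\<Delta>\<psi>\<^sub>1 + \<Delta>\<psi>\<^sub>0\<close> is in general only of negative Sobolev order.\<close>

definition blackstock_solution ::
  "real \<Rightarrow> real \<Rightarrow> real \<Rightarrow> real \<Rightarrow> ('a::euclidean_space \<Rightarrow> complex) \<Rightarrow> ('a \<Rightarrow> complex) \<Rightarrow>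
   'a distrib \<Rightarrow> (real \<Rightarrow> 'a \<Rightarrow> complex) \<Rightarrow> bool" where
  "blackstock_solution b \<nu> \<gamma> \<kappa> \<psi>0 \<psi>1 \<psi>2 \<psi> \<longleftrightarrow>
     (\<exists>g0 g1 g2 w w1 w2.
        has_fourier_transform (dist_of \<psi>0) g0 \<and>
        has_fourier_transform (dist_of \<psi>1) g1 \<and>
        has_fourier_transform \<psi>2 g2 \<and>
        (\<forall>t\<ge>0. in_L2 (\<psi> t) \<and> has_fourier_transform (dist_of (\<psi> t)) (\<lambda>\<xi>. w \<xi> t)) \<and>
        (AE \<xi> in lborel.
           blackstock_ode b \<nu> \<gamma> \<kappa> (- (norm \<xi>)\<^sup>2) (w \<xi>) (w1 \<xi>) (w2 \<xi>) \<and>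
           w \<xi> 0 = g0 \<xi> \<and> w1 \<xi> 0 = g1 \<xi> \<and> w2 \<xi> 0 = g2 \<xi>))"

definition viscoelastic_solution ::
  "real \<Rightarrow> real \<Rightarrow> ('a::euclidean_space \<Rightarrow> complex) \<Rightarrow> ('a \<Rightarrow> complex) \<Rightarrow>
   (real \<Rightarrow> 'a \<Rightarrow> complex) \<Rightarrow> bool" where
  "viscoelastic_solution b \<nu> \<psi>0 \<psi>1 \<psi> \<longleftrightarrow>
     (\<exists>g0 g1 w w1.
        has_fourier_transform (dist_of \<psi>0) g0 \<and>
        has_fourier_transform (dist_of \<psi>1) g1 \<and>
        (\<forall>t\<ge>0. in_L2 (\<psi> t) \<and> has_fourier_transform (dist_of (\<psi> t)) (\<lambda>\<xi>. w \<xi> t)) \<and>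
        (AE \<xi> in lborel.
           viscoelastic_ode b \<nu> (- (norm \<xi>)\<^sup>2) (w \<xi>) (w1 \<xi>) \<and>
           w \<xi> 0 = g0 \<xi> \<and> w1 \<xi> 0 = g1 \<xi>))"

text \<open>The argument \<open>\<tau>\<close> is \<open>1 + t\<close>, so that \<open>exp 1 + (\<tau> - 1)\<close> is \<open>e + t\<close>.\<close>

definition growth_G1 :: "nat \<Rightarrow> real \<Rightarrow> real" where
  "growth_G1 n \<tau> =
     (if n = 1 then \<tau> powr (1/4)
      else if n = 2 then (ln (exp 1 + (\<tau> - 1))) powr (1/2)
      else 1)"

end

theory Submission
  imports Defs "HOL-Probability.Characteristic_Functions"
begin

text \<open>
  Write \<open>r = |\<xi>|\<close>, \<open>B = b\<nu>\<close> and let \<open>q = w'' + B r\<^sup>2 w' + r\<^sup>2 w\<close> be the defect of the Blackstock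
  solution in the viscoelastic equation on the Fourier side. The Blackstock equation becomes
  \<open>q' + \<gamma>\<kappa> r\<^sup>2 q = (\<gamma>-1)\<kappa> r\<^sup>4 w\<close>, and the compatibility of the third datum says precisely that
  \<open>q(0) = 0\<close>. An energy for the difference \<open>u\<close> that absorbs the coupling with \<open>q\<close> gives
  \<open>|u|\<^sup>2 \<le> C\<kappa> (min t (1/r\<^sup>2) |g1|\<^sup>2 + (1 + r\<^sup>2) |g0|\<^sup>2)\<close> for every frequency and every \<open>\<kappa> > 0\<close>,
  where \<open>g0\<close>, \<open>g1\<close> are the Fourier transforms of \<open>\<psi>0\<close>, \<open>\<psi>1\<close>.
  At low frequencies \<open>g1\<close> is bounded by the \<open>L\<^sup>1\<close> norm of \<open>\<psi>1\<close> and the multiplier integrates to the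
  square of the growth rate; elsewhere the Sobolev norms suffice. The Plancherel inequality
  carries the bound back to \<open>u\<close>.

  Tempered distributions are tested only against translated or modulated Gaussians,
  possibly times a polynomial, whose Fourier
  transforms are explicit: mollifying with Gaussians identifies a function from such tests.
\<close>

subsection \<open>Energy estimate at a fixed frequency\<close>

text \<open>The roots of the cubic characteristic equation depend on both |\<xi>| and \<kappa> and
  change type, so explicit formulas would call for frequency zones; a quadratic energy treats all
  frequencies at once. The relaxation of q and the forcing it receives carry the same factor
  \<kappa>. Completing a square against the dissipation therefore leaves a source of order \<kappa>
  r^4 |w0|^2, and the damping of the viscoelastic wave makes r^2 |w0|^2 integrable in time. This
  gives |u|^2, and not |u|, the order \<kappa>, hence the factor sqrt \<kappa>. The coefficient
  1/r^2 of |g1|^2 is not integrable at the origin in dimensions 1 and 2; the competing bound t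
  repairs this, and its interplay with 1/r^2 on the unit ball produces the growth rates. On the
  distributional side a transform is determined only almost everywhere, and the two solutions may
  bring different versions for the same datum. They have to be identified before any estimate at a
  fixed frequency applies.\<close>

lemma nonincreasing_on_halfline:
  fixes f f' :: "real \<Rightarrow> real"
  assumes der: "\<And>s. s \<ge> 0 \<Longrightarrow> (f has_real_derivative f' s) (at s within {0..})"
    and le: "\<And>s. s \<ge> 0 \<Longrightarrow> f' s \<le> 0" and t: "t \<ge> 0"
  shows "f t \<le> f 0"
proof (rule DERIV_nonpos_imp_decreasing_open[OF t])
  fix s :: real assume s: "0 < s" "s < t"
  \<comment> \<open>At 0 the derivative is only one-sided; inside the interval it is two-sided, and
    at the endpoints continuity is enough.\<close>
  have "at s within {0..} = at s"
    using s by (intro at_within_interior) (auto simp: interior_Ici[of _ "-1"])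
  with der[of s] le[of s] s show "\<exists>y. (f has_real_derivative y) (at s) \<and> y \<le> 0" by auto
next
  have "continuous_on {0..} f"
    using der by (auto simp: continuous_on_eq_continuous_within dest!: DERIV_continuous)
  then show "continuous_on {0..t} f" by (rule continuous_on_subset) auto
qed

text \<open>Here \<open>q\<close> is the defect of \<open>w = u + w0\<close> in the viscoelastic equation. The energy
  \<open>E\<close> absorbs the coupling of \<open>u\<close> and \<open>q\<close>, so that only \<open>w0\<close> acts as a source, with a factor
  \<open>\<kappa>\<close>; the functional \<open>F\<close> controls the time integral of that source.\<close>

lemma difference_ode_bound:
  fixes u u1 q w0 w01 :: "real \<Rightarrow> real"
  assumes r: "r > 0" and B: "B > 0" and k: "\<kappa> > 0" and g: "\<gamma> > 1"
    and du: "\<And>t. t \<ge> 0 \<Longrightarrow> (u has_real_derivative u1 t) (at t within {0..})"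
    and du1: "\<And>t. t \<ge> 0 \<Longrightarrow> (u1 has_real_derivative q t - B * r\<^sup>2 * u1 t - r\<^sup>2 * u t) (at t within {0..})"
    and dq: "\<And>t. t \<ge> 0 \<Longrightarrow> (q has_real_derivative
               (\<gamma> - 1) * \<kappa> * r^4 * (u t + w0 t) - \<gamma> * \<kappa> * r\<^sup>2 * q t) (at t within {0..})"
    and dw: "\<And>t. t \<ge> 0 \<Longrightarrow> (w0 has_real_derivative w01 t) (at t within {0..})"
    and dw1: "\<And>t. t \<ge> 0 \<Longrightarrow> (w01 has_real_derivative - r\<^sup>2 * w0 t - B * r\<^sup>2 * w01 t) (at t within {0..})"
    and init: "u 0 = 0" "u1 0 = 0" "q 0 = 0"
    and t: "t \<ge> 0"
  shows "(u t)\<^sup>2 \<le> \<gamma> * (\<gamma> - 1) / 2 * \<kappa> * (1 + B + 1 / B) *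
           (min t (1 / r\<^sup>2) * (w01 0)\<^sup>2 + (1 + r\<^sup>2) * (w0 0)\<^sup>2)"
proof -
  define c where "c = \<kappa> * (\<gamma> - 1) / 2"
  \<comment> \<open>Differentiating the first two terms leaves the coupling
    \<open>2 * q s * u1 s\<close>, which \<open>- 2 * q s * u s\<close> cancels. The weight of q^2
    is chosen so that the remaining terms with q' combine to 2 q' \<Theta>, where \<Theta> is the
    quantity defined in the proof of \<open>E'_le\<close>.\<close>
  define E where "E s = (u1 s)\<^sup>2 + r\<^sup>2 * (u s)\<^sup>2 - 2 * q s * u s + \<gamma> / (\<gamma> - 1) * (q s)\<^sup>2 / r\<^sup>2" for s
  define E' where "E' s = 2 * u1 s * (q s - B * r\<^sup>2 * u1 s - r\<^sup>2 * u s) + r\<^sup>2 * (2 * u s * u1 s)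
      - 2 * (((\<gamma> - 1) * \<kappa> * r^4 * (u s + w0 s) - \<gamma> * \<kappa> * r\<^sup>2 * q s) * u s + q s * u1 s)
      + \<gamma> / (\<gamma> - 1) * (2 * q s * ((\<gamma> - 1) * \<kappa> * r^4 * (u s + w0 s) - \<gamma> * \<kappa> * r\<^sup>2 * q s)) / r\<^sup>2" for s
  \<comment> \<open>The first term is \<open>D s / (2 * B * r\<^sup>2)\<close>, with derivative
    -w01^2. The product w01 w0 restores w01^2 and contributes -r^2 w0^2, and the last term removes
    the mixed product that this creates.\<close>
  define F where "F s = ((w01 s)\<^sup>2 + r\<^sup>2 * (w0 s)\<^sup>2) / (2 * B * r\<^sup>2) + w01 s * w0 s + B * r\<^sup>2 / 2 * (w0 s)\<^sup>2" for s
  define D where "D s = (w01 s)\<^sup>2 + r\<^sup>2 * (w0 s)\<^sup>2" for s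
  have c: "c > 0" using k g by (simp add: c_def)
  have dE: "(E has_real_derivative E' s) (at s within {0..})" if "s \<ge> 0" for s
    unfolding E_def E'_def
    by (rule derivative_eq_intros du du1 dq that refl | use r g in force)+
       (use r g in \<open>simp add: field_simps power2_eq_square\<close>)
  have E'_le: "E' s \<le> c * r^4 * (w0 s)\<^sup>2" for s
  proof -
    \<comment> \<open>In terms of \<Theta> the equation for q reads q' = (\<gamma> - 1) \<kappa> r^4
      (w0 - \<Theta>), so 2 q' \<Theta> contains a damping in \<Theta>^2 that absorbs the source w0
      \<Theta>.\<close>
    define \<Theta> where "\<Theta> = \<gamma> * q s / ((\<gamma> - 1) * r\<^sup>2) - u s"
    have q: "\<gamma> * q s = (\<gamma> - 1) * r\<^sup>2 * (\<Theta> + u s)" using r g by (simp add: \<Theta>_def field_simps)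
    have q': "q s = (\<gamma> - 1) * r\<^sup>2 * (\<Theta> + u s) / \<gamma>" using q g by (simp add: field_simps)
    have "E' s = - 2 * B * r\<^sup>2 * (u1 s)\<^sup>2 + 2 * c * r^4 * (2 * w0 s * \<Theta> - 2 * \<Theta>\<^sup>2)"
      unfolding E'_def c_def q' using r g
      by (simp add: divide_simps) (simp add: power2_eq_square power4_eq_xxxx algebra_simps)
    also have "\<dots> \<le> 0 + 2 * c * r^4 * ((w0 s)\<^sup>2 / 2)"
    proof (intro add_mono mult_left_mono)
      have "0 \<le> (w0 s - 2 * \<Theta>)\<^sup>2" by simp
      then show "2 * w0 s * \<Theta> - 2 * \<Theta>\<^sup>2 \<le> (w0 s)\<^sup>2 / 2"
        by (simp add: power2_eq_square algebra_simps)
    qed (use c B in auto)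
    finally show ?thesis by simp
  qed
  have dF: "(F has_real_derivative - r\<^sup>2 * (w0 s)\<^sup>2) (at s within {0..})" if "s \<ge> 0" for s
    unfolding F_def
    by (rule derivative_eq_intros dw dw1 that refl | use r B in force)+
       (use r B in \<open>simp add: divide_simps power2_eq_square; simp add: algebra_simps\<close>)
  have dD: "(D has_real_derivative - 2 * B * r\<^sup>2 * (w01 s)\<^sup>2) (at s within {0..})" if "s \<ge> 0" for s
    unfolding D_def
    by (rule derivative_eq_intros dw dw1 that refl | force)+
       (simp add: power2_eq_square algebra_simps)
  have E0: "E 0 = 0" by (simp add: E_def init)
  have E_lower: "r\<^sup>2 * (u s)\<^sup>2 \<le> \<gamma> * E s" for s
  proof -
    \<comment> \<open>After multiplication by \<gamma> and subtraction, (\<gamma> - 1) r^2 u^2 is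
      left, exactly what completes the square with the mixed term -2 \<gamma> q u.\<close>
    have "\<gamma> * E s - r\<^sup>2 * (u s)\<^sup>2 = \<gamma> * (u1 s)\<^sup>2 + ((\<gamma> - 1) * r\<^sup>2 * u s - \<gamma> * q s)\<^sup>2 / ((\<gamma> - 1) * r\<^sup>2)"
      unfolding E_def using r g
      by (simp add: divide_simps) (simp add: power2_eq_square algebra_simps)
    also have "\<dots> \<ge> 0" using g by (intro add_nonneg_nonneg divide_nonneg_nonneg mult_nonneg_nonneg) auto
    finally show ?thesis by simp
  qed
  have F_nonneg: "F t \<ge> 0"
  proof -
    have "F t = (w0 t)\<^sup>2 / (2 * B) + (w01 t + B * r\<^sup>2 * w0 t)\<^sup>2 / (2 * B * r\<^sup>2)"
      unfolding F_def using r B by (simp add: divide_simps) (simp add: power2_eq_square algebra_simps)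
    then show ?thesis using B by simp
  qed
  have F0: "F 0 \<le> (w01 0)\<^sup>2 / (B * r\<^sup>2) + (1 / (2 * B) + B * r\<^sup>2) * (w0 0)\<^sup>2"
  proof -
    have "(w01 0)\<^sup>2 / (B * r\<^sup>2) + (1 / (2 * B) + B * r\<^sup>2) * (w0 0)\<^sup>2 - F 0
        = (w01 0 - B * r\<^sup>2 * w0 0)\<^sup>2 / (2 * B * r\<^sup>2)"
      unfolding F_def using r B by (simp add: divide_simps) (simp add: power2_eq_square algebra_simps)
    also have "\<dots> \<ge> 0" using B by simp
    finally show ?thesis by simp
  qed
  \<comment> \<open>The bound c r^4 w0^2 on E' is the negative of the derivative of
    \<open>c * r\<^sup>2 * F s\<close>, so the sum cannot increase. The resulting bound is uniform
    in time and serves for t > 1/r^2.\<close>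
  have "E t + c * r\<^sup>2 * F t \<le> E 0 + c * r\<^sup>2 * F 0"
  proof (rule nonincreasing_on_halfline[OF _ _ t])
    fix s :: real assume s: "s \<ge> 0"
    show "((\<lambda>s. E s + c * r\<^sup>2 * F s) has_real_derivative E' s + c * r\<^sup>2 * (- r\<^sup>2 * (w0 s)\<^sup>2)) (at s within {0..})"
      by (intro DERIV_add DERIV_cmult dE dF s)
    show "E' s + c * r\<^sup>2 * (- r\<^sup>2 * (w0 s)\<^sup>2) \<le> 0"
      using E'_le[of s] by (simp add: power2_eq_square power4_eq_xxxx algebra_simps)
  qed
  moreover have "c * r\<^sup>2 * F t \<ge> 0" using c F_nonneg by simp
  ultimately have "E t \<le> c * r\<^sup>2 * F 0" using E0 by linarith
  then have "r\<^sup>2 * (u t)\<^sup>2 \<le> r\<^sup>2 * (\<gamma> * c * F 0)"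
    using order_trans[OF E_lower[of t] mult_left_mono[of "E t" "c * r\<^sup>2 * F 0" \<gamma>]] g
    by (simp add: mult_ac)
  then have "(u t)\<^sup>2 \<le> \<gamma> * c * F 0" using r by simp
  also have "\<dots> \<le> \<gamma> * c * ((w01 0)\<^sup>2 / (B * r\<^sup>2) + (1 / (2 * B) + B * r\<^sup>2) * (w0 0)\<^sup>2)"
    using F0 g c by (intro mult_left_mono) auto
  finally have long: "(u t)\<^sup>2 \<le> \<dots>" .
  have D_le: "r\<^sup>2 * (w0 s)\<^sup>2 \<le> D 0" if "s \<ge> 0" for s
  proof -
    have "D s \<le> D 0" using B that by (intro nonincreasing_on_halfline[OF dD]) auto
    moreover have "r\<^sup>2 * (w0 s)\<^sup>2 \<le> D s" by (simp add: D_def)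
    ultimately show ?thesis by linarith
  qed
  \<comment> \<open>Here the source is bounded through the decreasing energy \<open>D\<close> of w0.
    The price is linear growth in t, but the coefficient of (w01 0)^2 is free of 1/r^2; this serves
    for t \<le> 1/r^2.\<close>
  have "E t - c * r\<^sup>2 * D 0 * t \<le> E 0 - c * r\<^sup>2 * D 0 * 0"
  proof (rule nonincreasing_on_halfline[OF _ _ t])
    fix s :: real assume s: "s \<ge> 0"
    show "((\<lambda>s. E s - c * r\<^sup>2 * D 0 * s) has_real_derivative E' s - c * r\<^sup>2 * D 0 * 1) (at s within {0..})"
      by (intro DERIV_diff DERIV_cmult dE s DERIV_ident)
    have "c * r^4 * (w0 s)\<^sup>2 = c * r\<^sup>2 * (r\<^sup>2 * (w0 s)\<^sup>2)" by (simp add: power2_eq_square power4_eq_xxxx)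
    also have "\<dots> \<le> c * r\<^sup>2 * D 0" using D_le[OF s] c by (intro mult_left_mono) auto
    finally show "E' s - c * r\<^sup>2 * D 0 * 1 \<le> 0" using E'_le[of s] by simp
  qed
  then have "E t \<le> c * r\<^sup>2 * D 0 * t" using E0 by simp
  then have "r\<^sup>2 * (u t)\<^sup>2 \<le> r\<^sup>2 * (\<gamma> * c * (D 0 * t))"
    using order_trans[OF E_lower[of t] mult_left_mono[of "E t" "c * r\<^sup>2 * D 0 * t" \<gamma>]] g
    by (simp add: mult_ac)
  then have short: "(u t)\<^sup>2 \<le> \<gamma> * c * (D 0 * t)" using r by simp
  have "\<gamma> * c * (1 + B + 1 / B) * (min t (1 / r\<^sup>2) * (w01 0)\<^sup>2 + (1 + r\<^sup>2) * (w0 0)\<^sup>2) \<ge> (u t)\<^sup>2"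
  proof (cases "t \<le> 1 / r\<^sup>2")
    case True
    have "D 0 * t \<le> t * (w01 0)\<^sup>2 + 1 * (w0 0)\<^sup>2"
      using True r mult_right_mono[of "t * r\<^sup>2" 1 "(w0 0)\<^sup>2"]
      by (simp add: D_def field_simps)
    also have "\<dots> \<le> 1 * (t * (w01 0)\<^sup>2 + (1 + r\<^sup>2) * (w0 0)\<^sup>2)"
      by (simp add: algebra_simps)
    also have "\<dots> \<le> (1 + B + 1 / B) * (t * (w01 0)\<^sup>2 + (1 + r\<^sup>2) * (w0 0)\<^sup>2)"
      using B t by (intro mult_right_mono) auto
    finally have "\<gamma> * c * (D 0 * t) \<le> \<gamma> * c * \<dots>" using g c by (intro mult_left_mono) auto
    with short True show ?thesis by (simp add: min_def mult.assoc)
  next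
    case False
    define K where "K = 1 + B + 1 / B"
    have "(w01 0)\<^sup>2 / (B * r\<^sup>2) + (1 / (2 * B) + B * r\<^sup>2) * (w0 0)\<^sup>2
       \<le> (1 + B + 1 / B) * (1 / r\<^sup>2 * (w01 0)\<^sup>2) + ((1 + B + 1 / B) * (1 + r\<^sup>2)) * (w0 0)\<^sup>2"
    proof (intro add_mono mult_right_mono)
      have "(w01 0)\<^sup>2 / (B * r\<^sup>2) = (1 / B) * (1 / r\<^sup>2 * (w01 0)\<^sup>2)" using r B by simp
      also have "\<dots> \<le> (1 + B + 1 / B) * (1 / r\<^sup>2 * (w01 0)\<^sup>2)" using B by (intro mult_right_mono) auto
      finally show "(w01 0)\<^sup>2 / (B * r\<^sup>2) \<le> \<dots>" .
      have "(1 + B + 1 / B) * (1 + r\<^sup>2) - (1 / (2 * B) + B * r\<^sup>2) = 1 + B + 1 / (2 * B) + r\<^sup>2 + r\<^sup>2 / B"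
        using B by (simp add: field_simps)
      also have "\<dots> \<ge> 0" using B by simp
      finally show "1 / (2 * B) + B * r\<^sup>2 \<le> (1 + B + 1 / B) * (1 + r\<^sup>2)" by simp
    qed auto
    then have "\<gamma> * c * ((w01 0)\<^sup>2 / (B * r\<^sup>2) + (1 / (2 * B) + B * r\<^sup>2) * (w0 0)\<^sup>2)
       \<le> \<gamma> * c * ((1 + B + 1 / B) * (1 / r\<^sup>2 * (w01 0)\<^sup>2) + ((1 + B + 1 / B) * (1 + r\<^sup>2)) * (w0 0)\<^sup>2)"
      using g c by (intro mult_left_mono) auto
    note this[folded K_def]
    also have "\<gamma> * c * (K * (1 / r\<^sup>2 * (w01 0)\<^sup>2) + K * (1 + r\<^sup>2) * (w0 0)\<^sup>2)
      = \<gamma> * c * K * (min t (1 / r\<^sup>2) * (w01 0)\<^sup>2 + (1 + r\<^sup>2) * (w0 0)\<^sup>2)"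
      using False by (simp only: min_def if_False) (simp only: distrib_left distrib_right mult.assoc)
    finally show ?thesis using long unfolding K_def by linarith
  qed
  then show ?thesis by (simp add: c_def mult_ac)
qed

text \<open>Real and imaginary parts each satisfy the real system of
  \<open>difference_ode_bound\<close>. The bound is linear in the squared moduli, so the two
  estimates add up.\<close>

lemma blackstock_viscoelastic_pointwise:
  fixes w w1 w2 v v1 :: "real \<Rightarrow> complex"
  assumes r: "r > 0" and B: "b * \<nu> > 0" and k: "\<kappa> > 0" and g: "\<gamma> > 1"
    and bs: "blackstock_ode b \<nu> \<gamma> \<kappa> (- r\<^sup>2) w w1 w2"
    and ve: "viscoelastic_ode b \<nu> (- r\<^sup>2) v v1"
    and init: "w 0 = v 0" "w1 0 = v1 0" "w2 0 = - (r\<^sup>2 *\<^sub>R (of_real (b * \<nu>) * v1 0 + v 0))"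
    and t: "t \<ge> 0"
  shows "(norm (w t - v t))\<^sup>2 \<le> \<gamma> * (\<gamma> - 1) / 2 * \<kappa> * (1 + b * \<nu> + 1 / (b * \<nu>)) *
           (min t (1 / r\<^sup>2) * (norm (v1 0))\<^sup>2 + (1 + r\<^sup>2) * (norm (v 0))\<^sup>2)"
    (is "_ \<le> ?K * _")
proof -
  let ?B = "b * \<nu>"
  define q where "q s = w2 s + r\<^sup>2 *\<^sub>R w s + (?B * r\<^sup>2) *\<^sub>R w1 s" for s
  define z where "z s = w2 s - (- r\<^sup>2) *\<^sub>R w s - ((?B + (\<gamma> - 1) * \<kappa>) * - r\<^sup>2) *\<^sub>R w1 s" for s
  note bs' = bs[unfolded blackstock_ode_def Let_def, rule_format]
  note ve' = ve[unfolded viscoelastic_ode_def, rule_format]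
  have key: "(P (w t - v t))\<^sup>2 \<le> ?K * (min t (1 / r\<^sup>2) * (P (v1 0))\<^sup>2 + (1 + r\<^sup>2) * (P (v 0))\<^sup>2)"
    if P: "bounded_linear P" for P :: "complex \<Rightarrow> real"
  proof -
    interpret P: bounded_linear P by (rule P)
    note lin = P.add P.diff P.scaleR P.neg
    have d: "((\<lambda>s. P (f s)) has_real_derivative P f') (at s within {0..})"
      if "(f has_vector_derivative f') (at s within {0..})" for f f' s
      using P.has_vector_derivative[OF that] by (simp add: has_real_derivative_iff_has_vector_derivative)
    have dw: "((\<lambda>s. P (w s)) has_real_derivative P (w1 s)) (at s within {0..})" if "s \<ge> 0" for s
      using bs'[OF that] d by blast
    have dw1: "((\<lambda>s. P (w1 s)) has_real_derivative P (w2 s)) (at s within {0..})" if "s \<ge> 0" for s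
      using bs'[OF that] d by blast
    have dz: "((\<lambda>s. P (z s)) has_real_derivative
         - \<kappa> * r\<^sup>2 * P (z s) - \<kappa> * (\<gamma> - 1) * (?B - \<kappa>) * r^4 * P (w1 s)) (at s within {0..})" if "s \<ge> 0" for s
      using d[OF bs'[OF that, THEN conjunct2, THEN conjunct2]]
      by (simp add: z_def[abs_def] lin power4_eq_xxxx power2_eq_square mult.assoc)
    have dv: "((\<lambda>s. P (v s)) has_real_derivative P (v1 s)) (at s within {0..})" if "s \<ge> 0" for s
      using ve'[OF that] d by blast
    have dv1: "((\<lambda>s. P (v1 s)) has_real_derivative - r\<^sup>2 * P (v s) - ?B * r\<^sup>2 * P (v1 s)) (at s within {0..})" if "s \<ge> 0" for s
      using d[OF ve'[OF that, THEN conjunct2]] by (simp add: lin)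
    have Pz: "P (z s) = P (w2 s) + r\<^sup>2 * P (w s) + (?B + (\<gamma> - 1) * \<kappa>) * r\<^sup>2 * P (w1 s)" for s
      by (simp add: z_def lin)
    have Pq: "P (q s) = P (w2 s) + r\<^sup>2 * P (w s) + ?B * r\<^sup>2 * P (w1 s)" for s
      by (simp add: q_def lin)
    have Pq': "P (q s) = P (z s) - (\<gamma> - 1) * \<kappa> * r\<^sup>2 * P (w1 s)" for s
      by (simp add: Pz Pq algebra_simps)
    \<comment> \<open>The defect q differs from the differentiable quantity z by a multiple of w1.
      In its derivative the \<kappa>^2 terms coming from \<delta> and from b\<nu> - \<kappa> cancel,
      which leaves a forcing by w alone.\<close>
    have dq: "((\<lambda>s. P (q s)) has_real_derivative
               (\<gamma> - 1) * \<kappa> * r^4 * P (w s) - \<gamma> * \<kappa> * r\<^sup>2 * P (q s)) (at s within {0..})" if "s \<ge> 0" for s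
      unfolding Pq'
      by (rule derivative_eq_intros dw1 dz that refl)+
         (simp add: Pz power2_eq_square power4_eq_xxxx algebra_simps)
    have "(P (w t) - P (v t))\<^sup>2 \<le> ?K * (min t (1 / r\<^sup>2) * (P (v1 0))\<^sup>2 + (1 + r\<^sup>2) * (P (v 0))\<^sup>2)"
    proof (rule difference_ode_bound[where u = "\<lambda>s. P (w s) - P (v s)" and ?u1.0 = "\<lambda>s. P (w1 s) - P (v1 s)"
            and q = "\<lambda>s. P (q s)", OF r B k g])
      fix s :: real assume s: "s \<ge> 0"
      show "((\<lambda>s. P (w s) - P (v s)) has_real_derivative P (w1 s) - P (v1 s)) (at s within {0..})"
        by (intro DERIV_diff dw dv s)
      show "((\<lambda>s. P (w1 s) - P (v1 s)) has_real_derivative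
          P (q s) - b * \<nu> * r\<^sup>2 * (P (w1 s) - P (v1 s)) - r\<^sup>2 * (P (w s) - P (v s))) (at s within {0..})"
        by (rule derivative_eq_intros dw1 dv1 s refl)+ (simp add: Pq algebra_simps)
      show "((\<lambda>s. P (q s)) has_real_derivative
          (\<gamma> - 1) * \<kappa> * r^4 * (P (w s) - P (v s) + P (v s)) - \<gamma> * \<kappa> * r\<^sup>2 * P (q s)) (at s within {0..})"
        using dq[OF s] by simp
    next
      have "w2 0 = - (r\<^sup>2 *\<^sub>R (?B *\<^sub>R v1 0 + v 0))"
        using init(3) by (simp add: scaleR_conv_of_real)
      then have "q 0 = 0" by (simp add: q_def init(1,2) scaleR_add_right mult.commute)
      then show "P (q 0) = 0" by (simp add: P.zero)
    qed (use dv dv1 init t in auto)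
    then show ?thesis by (simp add: lin)
  qed
  have sum: "A + A' \<le> K * (m * (x + x') + l * (y + y'))"
    if "A \<le> K * (m * x + l * y)" "A' \<le> K * (m * x' + l * y')" for A A' K m l x x' y y' :: real
    using that by (simp add: algebra_simps)
  show ?thesis unfolding cmod_power2
    by (rule sum[OF key[OF bounded_linear_Re] key[OF bounded_linear_Im]])
qed

subsection \<open>Gaussians and the Fourier transform of integrable functions\<close>

lemma cis_measurable [measurable]: "cis \<in> borel_measurable borel"
  by (intro borel_measurable_continuous_onI continuous_intros)

lemma integral_lborel_affine:
  fixes f :: "'a::euclidean_space \<Rightarrow> 'b::{banach, second_countable_topology}"
  assumes [measurable]: "f \<in> borel_measurable borel" and c: "c \<noteq> 0"
  shows "integrable lborel (\<lambda>x. f (t + c *\<^sub>R x)) \<longleftrightarrow> integrable lborel f"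
    and "(LINT x|lborel. f (t + c *\<^sub>R x)) = (1 / \<bar>c\<bar> ^ DIM('a)) *\<^sub>R (LINT x|lborel. f x)"
proof -
  let ?k = "\<bar>c\<bar> ^ DIM('a)"
  have k: "?k > 0" using c by simp
  have L: "lborel = density (distr lborel borel (\<lambda>x. t + c *\<^sub>R x)) (\<lambda>_. ennreal ?k)"
    using lborel_affine[OF c, of t] by (simp add: ennreal_power)
  have "integrable lborel f \<longleftrightarrow> integrable lborel (\<lambda>x. ?k *\<^sub>R f (t + c *\<^sub>R x))"
    by (subst L, subst integrable_density) (auto simp: integrable_distr_eq)
  also have "\<dots> \<longleftrightarrow> integrable lborel (\<lambda>x. f (t + c *\<^sub>R x))"
  proof
    assume "integrable lborel (\<lambda>x. ?k *\<^sub>R f (t + c *\<^sub>R x))"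
    then have "integrable lborel (\<lambda>x. (1 / ?k) *\<^sub>R ?k *\<^sub>R f (t + c *\<^sub>R x))"
      by (rule integrable_scaleR_right)
    then show "integrable lborel (\<lambda>x. f (t + c *\<^sub>R x))" using k by simp
  qed simp
  finally show "integrable lborel (\<lambda>x. f (t + c *\<^sub>R x)) \<longleftrightarrow> integrable lborel f" ..
  have "(LINT x|lborel. f x) = (LINT x|lborel. ?k *\<^sub>R f (t + c *\<^sub>R x))"
    by (subst L, subst integral_density) (auto simp: integral_distr)
  then show "(LINT x|lborel. f (t + c *\<^sub>R x)) = (1 / ?k) *\<^sub>R (LINT x|lborel. f x)"
    using k by simp
qed

text \<open>\<open>lborel\<close> is the image of the product of one-dimensional measures under the
  coordinate map, so integrals of products over coordinates factor.\<close>

lemma lborel_integral_prod_Basis: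
  fixes f :: "'a::euclidean_space \<Rightarrow> real \<Rightarrow> complex"
  assumes f: "\<And>b. b \<in> Basis \<Longrightarrow> integrable lborel (f b)"
  shows "integrable lborel (\<lambda>x::'a. \<Prod>b\<in>Basis. f b (x \<bullet> b))"
    and "(LINT x|lborel. (\<Prod>b\<in>Basis. f b (x \<bullet> b))) = (\<Prod>b\<in>Basis. (LINT x|lborel. f b x))"
proof -
  interpret product_sigma_finite "\<lambda>_::'a. lborel :: real measure" ..
  have [measurable]: "b \<in> Basis \<Longrightarrow> f b \<in> borel_measurable borel" for b
    using borel_measurable_integrable[OF f] by simp
  have eq: "(\<lambda>x. \<Prod>b\<in>Basis. f b ((\<Sum>c\<in>Basis. x c *\<^sub>R c) \<bullet> b)) = (\<lambda>x. \<Prod>b\<in>Basis. f b (x b))" (is "?l = ?r")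
    by (intro ext prod.cong) (simp_all add: inner_sum_left_Basis)
  have int: "integrable (\<Pi>\<^sub>M b\<in>Basis. lborel) ?r"
    by (intro product_integrable_prod f) auto
  show "integrable lborel (\<lambda>x::'a. \<Prod>b\<in>Basis. f b (x \<bullet> b))"
    by (subst lborel_eq, subst integrable_distr_eq) (use int eq in auto)
  show "(LINT x|lborel. (\<Prod>b\<in>Basis. f b (x \<bullet> b))) = (\<Prod>b\<in>Basis. (LINT x|lborel. f b x))"
    by (subst lborel_eq, subst integral_distr) (use product_integral_prod[OF _ f] eq in auto)
qed

text \<open>A rescaled characteristic function of the standard normal law: with
  \<open>c = sqrt (2 * a)\<close> one has (c x)^2 / 2 = a x^2, and the frequency s / c produces the
  exponent s^2 / (4 a).\<close>

lemma gaussian_fourier_real: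
  fixes a s :: real
  assumes a: "a > 0"
  shows "integrable lborel (\<lambda>x. cis (- (x * s)) * exp (- (a * x\<^sup>2)))"
    and "(LINT x|lborel. cis (- (x * s)) * exp (- (a * x\<^sup>2))) = sqrt (pi / a) * exp (- (s\<^sup>2 / (4 * a)))"
proof -
  define c where "c = sqrt (2 * a)"
  have c: "c > 0" "c\<^sup>2 = 2 * a" using a by (simp_all add: c_def)
  define f where "f x = std_normal_density x *\<^sub>R cis (- (x * (s / c)))" for x
  have [measurable]: "f \<in> borel_measurable borel" unfolding f_def by measurable
  have "integrable lborel f"
    unfolding f_def by (rule Bochner_Integration.integrable_bound[OF integrable_normal_density[of 1 0]]) auto
  then have i: "integrable lborel (\<lambda>x. f (0 + c *\<^sub>R x))"
    by (subst integral_lborel_affine) (use c in auto)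
  have "(LINT x|lborel. f x) = char std_normal_distribution (- (s / c))"
    unfolding char_def f_def
    by (subst integral_density) (auto simp: cis_conv_exp normal_density_nonneg mult_ac)
  also have "\<dots> = exp (- (s\<^sup>2 / (4 * a)))"
    using c by (simp add: char_std_normal_distribution power_divide)
  finally have F: "(LINT x|lborel. f x) = \<dots>" .
  have eq: "f (0 + c *\<^sub>R x) = (1 / sqrt (2 * pi)) *\<^sub>R (cis (- (x * s)) * exp (- (a * x\<^sup>2)))" for x
    using c by (simp add: f_def std_normal_density_def power_mult_distrib scaleR_conv_of_real exp_of_real)
  show "integrable lborel (\<lambda>x. cis (- (x * s)) * exp (- (a * x\<^sup>2)))"
    using integrable_scaleR_right[OF i[unfolded eq], of "sqrt (2 * pi)"] by simp
  have "(1 / sqrt (2 * pi)) *\<^sub>R (LINT x|lborel. cis (- (x * s)) * exp (- (a * x\<^sup>2))) = exp (- (s\<^sup>2 / (4 * a))) / c"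
    using integral_lborel_affine(2)[of f c 0] c F unfolding eq by (simp add: scaleR_conv_of_real)
  then have "(LINT x|lborel. cis (- (x * s)) * exp (- (a * x\<^sup>2))) = (sqrt (2 * pi) / c) * exp (- (s\<^sup>2 / (4 * a)))"
    by (simp add: scaleR_conv_of_real field_simps)
  also have "sqrt (2 * pi) / c = sqrt (pi / a)" using a by (simp add: c_def real_sqrt_divide real_sqrt_mult)
  finally show "(LINT x|lborel. cis (- (x * s)) * exp (- (a * x\<^sup>2))) = sqrt (pi / a) * exp (- (s\<^sup>2 / (4 * a)))" .
qed

text \<open>Real valued and not normalised. The parameter is an inverse squared width: parameters
  add under multiplication, and the Fourier transform replaces a by 1 / (4 a).\<close>

definition gaussian :: "real \<Rightarrow> 'a::euclidean_space \<Rightarrow> real" where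
  "gaussian a x = exp (- (a * (norm x)\<^sup>2))"

lemma gaussian_pos [simp]: "gaussian a x > 0" "gaussian a x \<ge> 0" "gaussian a x \<noteq> 0"
  by (simp_all add: gaussian_def)

lemma gaussian_measurable [measurable]: "gaussian a \<in> borel_measurable borel"
  unfolding gaussian_def by measurable

lemma continuous_on_gaussian [continuous_intros]:
  "continuous_on S f \<Longrightarrow> continuous_on S (\<lambda>x. gaussian a (f x))"
  unfolding gaussian_def by (intro continuous_intros)

lemma gaussian_le_1: "a \<ge> 0 \<Longrightarrow> gaussian a x \<le> 1"
  by (simp add: gaussian_def)

lemma gaussian_minus [simp]: "gaussian a (- x) = gaussian a x"
  by (simp add: gaussian_def)

lemma gaussian_mono: "a \<le> b \<Longrightarrow> gaussian b x \<le> gaussian a x"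
  by (simp add: gaussian_def mult_right_mono)

lemma gaussian_mult: "gaussian a x * gaussian b x = gaussian (a + b) x"
  by (simp add: gaussian_def exp_add[symmetric] algebra_simps)

lemma cis_inner_gaussian_eq_prod:
  "cis (- (x \<bullet> \<xi>)) * gaussian a x = (\<Prod>b\<in>Basis. cis (- ((x \<bullet> b) * (\<xi> \<bullet> b))) * exp (- (a * (x \<bullet> b)\<^sup>2)))"
proof -
  have "cis (- (x \<bullet> \<xi>)) * gaussian a x = exp (\<i> * of_real (- (x \<bullet> \<xi>)) + of_real (- (a * (norm x)\<^sup>2)))"
    by (simp only: gaussian_def cis_conv_exp exp_add exp_of_real)
  also have "\<dots> = exp (\<Sum>b\<in>Basis. \<i> * of_real (- ((x \<bullet> b) * (\<xi> \<bullet> b))) + of_real (- (a * (x \<bullet> b)\<^sup>2)))"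
    unfolding power2_norm_eq_inner
    by (subst (1 2) euclidean_inner)
       (simp add: sum.distrib sum_subtractf sum_negf sum_distrib_left power2_eq_square)
  also have "\<dots> = (\<Prod>b\<in>Basis. exp (\<i> * of_real (- ((x \<bullet> b) * (\<xi> \<bullet> b))) + of_real (- (a * (x \<bullet> b)\<^sup>2))))"
    by (simp add: exp_sum)
  finally show ?thesis by (simp only: cis_conv_exp exp_add exp_of_real)
qed

lemma
  fixes \<xi> :: "'a::euclidean_space"
  assumes a: "a > 0"
  shows integrable_cis_gaussian: "integrable lborel (\<lambda>x. cis (- (x \<bullet> \<xi>)) * gaussian a x)"
    and fourier_gaussian: "fourier (\<lambda>x. gaussian a x) \<xi> = (sqrt (pi / a)) ^ DIM('a) * gaussian (1 / (4 * a)) \<xi>"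
proof -
  show "integrable lborel (\<lambda>x. cis (- (x \<bullet> \<xi>)) * gaussian a x)"
    unfolding cis_inner_gaussian_eq_prod
    by (rule lborel_integral_prod_Basis) (rule gaussian_fourier_real[OF a])
  have "fourier (\<lambda>x. gaussian a x) \<xi> = (\<Prod>b\<in>Basis. complex_of_real (sqrt (pi / a)) * exp (- ((\<xi> \<bullet> b)\<^sup>2 / (4 * a))))"
    unfolding fourier_def cis_inner_gaussian_eq_prod
    by (subst lborel_integral_prod_Basis)
       (simp_all add: gaussian_fourier_real[OF a])
  also have "\<dots> = (sqrt (pi / a)) ^ DIM('a) * exp (\<Sum>b\<in>Basis. - ((\<xi> \<bullet> b)\<^sup>2 / (4 * a)))"
    by (simp add: prod.distrib exp_sum)
  also have "(\<Sum>b\<in>Basis. - ((\<xi> \<bullet> b)\<^sup>2 / (4 * a))) = - (1 / (4 * a) * (norm \<xi>)\<^sup>2)"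
    unfolding power2_norm_eq_inner by (subst euclidean_inner) (simp add: sum_negf sum_divide_distrib power2_eq_square)
  finally show "fourier (\<lambda>x. gaussian a x) \<xi> = (sqrt (pi / a)) ^ DIM('a) * gaussian (1 / (4 * a)) \<xi>"
    by (simp add: gaussian_def)
qed

lemma
  assumes a: "a > 0"
  shows integrable_gaussian: "integrable lborel (gaussian a :: 'a::euclidean_space \<Rightarrow> real)"
    and integral_gaussian: "(LINT x|lborel. gaussian a (x::'a)) = (sqrt (pi / a)) ^ DIM('a)"
proof -
  have "integrable lborel (\<lambda>x::'a. complex_of_real (gaussian a x))"
    using integrable_cis_gaussian[OF a, of "0::'a"] by simp
  then show i: "integrable lborel (gaussian a :: 'a \<Rightarrow> real)"
    using complex_of_real_integrable_eq by blast
  have "complex_of_real (LINT x|lborel. gaussian a (x::'a)) = fourier (\<lambda>x. gaussian a x) (0::'a)"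
    by (simp add: fourier_def)
  also have "\<dots> = complex_of_real ((sqrt (pi / a)) ^ DIM('a))"
    by (subst fourier_gaussian[OF a]) (simp add: gaussian_def)
  finally show "(LINT x|lborel. gaussian a (x::'a)) = (sqrt (pi / a)) ^ DIM('a)"
    using of_real_eq_iff by blast
qed

lemma integrable_gaussian_translate:
  fixes z :: "'a::euclidean_space"
  assumes a: "a > 0"
  shows "integrable lborel (\<lambda>x. gaussian a (x - z))"
    and "(LINT x|lborel. gaussian a (x - z)) = (sqrt (pi / a)) ^ DIM('a)"
  using integral_lborel_affine[of "gaussian a :: 'a \<Rightarrow> real" 1 "- z"]
    integrable_gaussian[OF a, where 'a = 'a] integral_gaussian[OF a, where 'a = 'a] by simp_all

text \<open>Modulation becomes translation. These tests have real Gaussians centred at z as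
  transforms, so pairing a function with those transforms evaluates its mollification at z.\<close>

lemma fourier_gaussian_modulated:
  fixes z \<xi> :: "'a::euclidean_space"
  assumes a: "a > 0"
  shows "fourier (\<lambda>x. cis (z \<bullet> x) * gaussian a x) \<xi> = (sqrt (pi / a)) ^ DIM('a) * gaussian (1 / (4 * a)) (\<xi> - z)"
proof -
  have "fourier (\<lambda>x. cis (z \<bullet> x) * gaussian a x) \<xi> = fourier (\<lambda>x. gaussian a x) (\<xi> - z)"
    unfolding fourier_def
    by (intro Bochner_Integration.integral_cong refl) (simp add: cis_mult inner_diff_right inner_commute flip: mult.assoc)
  then show ?thesis using fourier_gaussian[OF a] by simp
qed

lemma fourier_gaussian_translate:
  fixes z \<xi> :: "'a::euclidean_space"
  assumes a: "a > 0"
  shows "fourier (\<lambda>x. gaussian a (x - z)) \<xi> =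
    cis (- (z \<bullet> \<xi>)) * ((sqrt (pi / a)) ^ DIM('a) * gaussian (1 / (4 * a)) \<xi>)"
proof -
  have "fourier (\<lambda>x. gaussian a (x - z)) \<xi> = (LINT x|lborel. cis (- ((z + x) \<bullet> \<xi>)) * gaussian a x)"
    unfolding fourier_def
    by (subst integral_lborel_affine(2)[of _ 1 "z", symmetric, simplified]) simp_all
  also have "\<dots> = (LINT x|lborel. cis (- (z \<bullet> \<xi>)) * (cis (- (x \<bullet> \<xi>)) * gaussian a x))"
    by (intro Bochner_Integration.integral_cong refl) (simp add: cis_mult inner_add_left flip: mult.assoc)
  also have "\<dots> = cis (- (z \<bullet> \<xi>)) * fourier (\<lambda>x. gaussian a x) \<xi>"
    unfolding fourier_def by simp
  finally show ?thesis using fourier_gaussian[OF a] by simp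
qed

section \<open>The Fourier integral of integrable functions\<close>

lemma integrable_pair_mult:
  fixes f g :: "'a::euclidean_space \<Rightarrow> 'b::{real_normed_field, banach, second_countable_topology}"
  assumes f: "integrable lborel f" and g: "integrable lborel g"
  shows "integrable (lborel \<Otimes>\<^sub>M lborel) (\<lambda>(x, y). f x * g y)"
proof -
  note [measurable] = borel_measurable_integrable[OF f] borel_measurable_integrable[OF g]
  show ?thesis
    by (rule lborel_pair.Fubini_integrable)
       (use f g in \<open>simp_all add: norm_mult\<close>)
qed

lemma integrable_cis_mult:
  fixes f :: "'a::euclidean_space \<Rightarrow> complex"
  assumes f: "integrable lborel f"
  shows "integrable lborel (\<lambda>x. cis (- (x \<bullet> \<xi>)) * f x)"
  using borel_measurable_integrable[OF f]
  by (intro Bochner_Integration.integrable_bound[OF f]) (auto simp: norm_mult)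

lemma norm_fourier_le:
  fixes f :: "'a::euclidean_space \<Rightarrow> complex"
  shows "norm (fourier f \<xi>) \<le> L1_norm f"
  unfolding fourier_def L1_norm_def
  by (rule order_trans[OF integral_norm_bound]) (simp add: norm_mult)

lemma fourier_measurable [measurable]:
  fixes f :: "'a::euclidean_space \<Rightarrow> complex"
  assumes [measurable]: "f \<in> borel_measurable borel"
  shows "fourier f \<in> borel_measurable borel"
  unfolding fourier_def by measurable

text \<open>Fubini for a symmetric kernel of modulus 1. It moves a transform from one factor to the
  other, which is how the explicit transforms of Gaussians enter without an inversion
  formula.\<close>

lemma fourier_multiplication_formula:
  fixes f g :: "'a::euclidean_space \<Rightarrow> complex"
  assumes f: "integrable lborel f" and g: "integrable lborel g"
  shows "integrable lborel (\<lambda>x. fourier f x * g x)" "integrable lborel (\<lambda>x. f x * fourier g x)"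
    and "(LINT x|lborel. fourier f x * g x) = (LINT x|lborel. f x * fourier g x)"
proof -
  have [measurable]: "f \<in> borel_measurable borel" "g \<in> borel_measurable borel"
    using f g by auto
  have bound: "integrable lborel (\<lambda>x. fourier f x * g x)"
    if "integrable lborel f" "integrable lborel g" for f g :: "'a \<Rightarrow> complex"
  proof (rule Bochner_Integration.integrable_bound[where f = "\<lambda>x. L1_norm f * norm (g x)"])
    have [measurable]: "f \<in> borel_measurable borel" "g \<in> borel_measurable borel"
      using that by auto
    show "(\<lambda>x. fourier f x * g x) \<in> borel_measurable lborel" by measurable
    show "AE x in lborel. norm (fourier f x * g x) \<le> norm (L1_norm f * norm (g x))"
      using norm_fourier_le[of f] by (auto simp: norm_mult intro!: mult_right_mono order_trans[OF _ abs_ge_self])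
  qed (use that in auto)
  show "integrable lborel (\<lambda>x. fourier f x * g x)" by (rule bound[OF f g])
  show "integrable lborel (\<lambda>x. f x * fourier g x)" using bound[OF g f] by (simp add: mult.commute)
  have int: "integrable (lborel \<Otimes>\<^sub>M lborel) (\<lambda>(x, y). f x * g y * cis (- (x \<bullet> y)))"
    by (rule Bochner_Integration.integrable_bound[OF integrable_pair_mult[OF f g]]) (auto simp: norm_mult)
  have "(LINT y|lborel. fourier f y * g y) = (LINT y|lborel. (LINT x|lborel. f x * g y * cis (- (x \<bullet> y))))"
    unfolding fourier_def
    by (intro Bochner_Integration.integral_cong refl, subst integral_mult_left_zero[symmetric])
       (simp add: mult_ac)
  also have "\<dots> = (LINT x|lborel. (LINT y|lborel. f x * g y * cis (- (x \<bullet> y))))"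
    by (rule lborel_pair.Fubini_integral) (rule int)
  also have "\<dots> = (LINT x|lborel. f x * fourier g x)"
    unfolding fourier_def
    by (intro Bochner_Integration.integral_cong refl, subst integral_mult_right_zero[symmetric])
       (simp add: mult_ac inner_commute)
  finally show "(LINT x|lborel. fourier f x * g x) = (LINT x|lborel. f x * fourier g x)" .
qed

subsection \<open>Testing against functions with Gaussian decay\<close>

text \<open>Common ground of square integrable functions, transforms of integrable functions and
  every g in \<open>has_fourier_transform\<close>: growth is allowed, yet mollification by Gaussians
  makes sense.\<close>

definition gaussian_integrable :: "('a::euclidean_space \<Rightarrow> complex) \<Rightarrow> bool" where
  "gaussian_integrable f \<longleftrightarrow> f \<in> borel_measurable borel \<and> (\<forall>c>0. integrable lborel (\<lambda>x. f x * gaussian c x))"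

text \<open>Continuity makes mollifications converge pointwise, and the Gaussian majorant makes
  pairings with \<open>gaussian_integrable\<close> functions absolutely convergent. Smoothness is
  not part of it, so continuous functions cut off by a radial projection qualify.\<close>

definition gaussian_decay :: "('a::euclidean_space \<Rightarrow> complex) \<Rightarrow> bool" where
  "gaussian_decay \<eta> \<longleftrightarrow> continuous_on UNIV \<eta> \<and> (\<exists>C\<ge>0. \<exists>c>0. \<forall>x. norm (\<eta> x) \<le> C * gaussian c x)"

lemma gaussian_decay_measurable: "gaussian_decay \<eta> \<Longrightarrow> \<eta> \<in> borel_measurable borel"
  by (auto simp: gaussian_decay_def intro: borel_measurable_continuous_onI)

lemma gaussian_integrable_mult_bounded:
  fixes g :: "'a::euclidean_space \<Rightarrow> complex"
  assumes f: "gaussian_integrable f" and [measurable]: "g \<in> borel_measurable borel"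
    and c: "c > 0" and le: "\<And>x. norm (g x) \<le> C * gaussian c x"
  shows "integrable lborel (\<lambda>x. f x * g x)"
proof (rule Bochner_Integration.integrable_bound)
  have [measurable]: "f \<in> borel_measurable borel" using f by (simp add: gaussian_integrable_def)
  show "integrable lborel (\<lambda>x. C * norm (f x * gaussian c x))"
    using f c by (intro integrable_mult_right integrable_norm) (auto simp: gaussian_integrable_def)
  show "(\<lambda>x. f x * g x) \<in> borel_measurable lborel" by measurable
  have "norm (f x * g x) \<le> norm (C * norm (f x * gaussian c x))" for x
    using mult_left_mono[OF order_trans[OF le[of x] mult_right_mono[OF abs_ge_self]], of "norm (f x)"]
    by (simp add: norm_mult abs_mult mult_ac)
  then show "AE x in lborel. norm (f x * g x) \<le> norm (C * norm (f x * gaussian c x))" by simp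
qed

section \<open>Mollification by Gaussians\<close>

lemma norm_sum_square_le: "(norm (x + y))\<^sup>2 \<le> 2 * (norm x)\<^sup>2 + 2 * (norm (y::'a::real_normed_vector))\<^sup>2"
proof -
  have "(norm (x + y))\<^sup>2 \<le> (norm x + norm y)\<^sup>2" by (intro power_mono norm_triangle_ineq) auto
  also have "\<dots> \<le> 2 * (norm x)\<^sup>2 + 2 * (norm y)\<^sup>2"
    using zero_le_power2[of "norm x - norm y"] by (simp add: power2_eq_square algebra_simps)
  finally show ?thesis .
qed

text \<open>Fubini with an even kernel. The work lies in joint integrability: half of the decay of
  \<open>\<eta>\<close> in z is kept, and the other half is traded, together with the kernel, for
  decay in x.\<close>

lemma mollification_duality:
  fixes f \<eta> :: "'a::euclidean_space \<Rightarrow> complex"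
  assumes f: "gaussian_integrable f" and \<eta>: "gaussian_decay \<eta>" and a: "a > 0"
  shows "(LINT z|lborel. (LINT x|lborel. f x * gaussian a (x - z)) * \<eta> z)
       = (LINT x|lborel. f x * (LINT z|lborel. \<eta> z * gaussian a (z - x)))"
proof -
  have [measurable]: "f \<in> borel_measurable borel" "\<eta> \<in> borel_measurable borel"
    using f gaussian_decay_measurable[OF \<eta>] by (auto simp: gaussian_integrable_def)
  obtain C c where c: "c > 0" and C: "C \<ge> 0" and le: "\<And>x. norm (\<eta> x) \<le> C * gaussian c x"
    using \<eta> by (auto simp: gaussian_decay_def)
  \<comment> \<open>Since |x|^2 \<le> 2 |z|^2 + 2 |x - z|^2, it is enough that 2 m is at most both c
    / 2 and a.\<close>
  define m where "m = min (c / 2) a / 2"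
  have m: "m > 0" using a c by (simp add: m_def)
  have g_le: "gaussian c z * gaussian a (x - z) \<le> gaussian (c / 2) z * gaussian m x" for x z :: 'a
  proof -
    have "m * (norm x)\<^sup>2 \<le> m * (2 * (norm z)\<^sup>2 + 2 * (norm (x - z))\<^sup>2)"
      using norm_sum_square_le[of z "x - z"] m by (intro mult_left_mono) auto
    also have "\<dots> \<le> c / 2 * (norm z)\<^sup>2 + a * (norm (x - z))\<^sup>2"
      unfolding distrib_left mult.assoc[symmetric]
      by (intro add_mono mult_right_mono) (auto simp: m_def)
    finally show ?thesis by (simp add: gaussian_def exp_add[symmetric] field_simps)
  qed
  have int: "integrable (lborel \<Otimes>\<^sub>M lborel) (\<lambda>(x, z). f x * \<eta> z * gaussian a (x - z))"
  proof (rule Bochner_Integration.integrable_bound)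
    show "integrable (lborel \<Otimes>\<^sub>M lborel) (\<lambda>(x, z::'a). norm (f x * gaussian m x) * (C * gaussian (c / 2) z))"
    proof (rule integrable_pair_mult)
      show "integrable lborel (\<lambda>x. norm (f x * gaussian m x))"
        using f m by (intro integrable_norm) (simp add: gaussian_integrable_def)
      show "integrable lborel (\<lambda>z::'a. C * gaussian (c / 2) z)"
        using c by (simp add: integrable_gaussian)
    qed
    show "(\<lambda>(x, z). f x * \<eta> z * gaussian a (x - z)) \<in> borel_measurable (lborel \<Otimes>\<^sub>M lborel)"
      by measurable
    have "norm (f x * \<eta> z * gaussian a (x - z)) \<le> norm (norm (f x * gaussian m x) * (C * gaussian (c / 2) z))" for x z
    proof -
      have "norm (f x * \<eta> z * gaussian a (x - z)) \<le> norm (f x) * (C * gaussian c z) * gaussian a (x - z)"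
        using le[of z] C by (auto simp: norm_mult intro!: mult_right_mono mult_left_mono)
      also have "\<dots> = norm (f x) * C * (gaussian c z * gaussian a (x - z))" by simp
      also have "\<dots> \<le> norm (f x) * C * (gaussian (c / 2) z * gaussian m x)"
        using g_le C by (intro mult_left_mono) auto
      finally show ?thesis using C by (simp add: norm_mult abs_mult mult_ac)
    qed
    then show "AE p in lborel \<Otimes>\<^sub>M lborel. norm (case p of (x, z) \<Rightarrow> f x * \<eta> z * gaussian a (x - z))
        \<le> norm (case p of (x, z) \<Rightarrow> norm (f x * gaussian m x) * (C * gaussian (c / 2) z))"
      by (auto split: prod.split)
  qed
  have "(LINT z|lborel. (LINT x|lborel. f x * gaussian a (x - z)) * \<eta> z)
      = (LINT z|lborel. (LINT x|lborel. f x * \<eta> z * gaussian a (x - z)))"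
    by (intro Bochner_Integration.integral_cong refl, subst integral_mult_left_zero[symmetric])
       (simp add: mult_ac)
  also have "\<dots> = (LINT x|lborel. (LINT z|lborel. f x * \<eta> z * gaussian a (x - z)))"
    by (rule lborel_pair.Fubini_integral) (rule int)
  also have "\<dots> = (LINT x|lborel. f x * (LINT z|lborel. \<eta> z * gaussian a (z - x)))"
    by (intro Bochner_Integration.integral_cong refl, subst integral_mult_right_zero[symmetric])
       (simp add: mult_ac gaussian_def norm_minus_commute)
  finally show ?thesis .
qed

text \<open>The factor \<open>(sqrt pi * h) ^ DIM('a)\<close> is the mass of the kernel, so the
  hypothesis bounds the pairings of normalised mollifications. Duality puts the mollification on
  \<open>\<eta>\<close>, the substitution z = x + h y turns it into h^n times \<open>S h x\<close>,
  and dominated convergence lets h tend to 0.\<close>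

lemma mollification_pairing_bound:
  fixes f \<eta> :: "'a::euclidean_space \<Rightarrow> complex"
  assumes f: "gaussian_integrable f" and \<eta>: "gaussian_decay \<eta>"
    and bound: "\<And>h. h > 0 \<Longrightarrow> norm (LINT z|lborel. (LINT x|lborel. f x * gaussian (1 / h\<^sup>2) (x - z)) * \<eta> z)
                  \<le> (sqrt pi * h) ^ DIM('a) * M"
  shows "norm (LINT x|lborel. f x * \<eta> x) \<le> M"
proof -
  have [measurable]: "f \<in> borel_measurable borel" "\<eta> \<in> borel_measurable borel"
    using f gaussian_decay_measurable[OF \<eta>] by (auto simp: gaussian_integrable_def)
  obtain C c where c: "c > 0" and C: "C \<ge> 0" and le: "\<And>x. norm (\<eta> x) \<le> C * gaussian c x"
    using \<eta> by (auto simp: gaussian_decay_def)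
  have cont: "continuous_on UNIV \<eta>" using \<eta> by (simp add: gaussian_decay_def)
  have le_C: "norm (\<eta> x) \<le> C" for x
    using le[of x] mult_left_mono[OF gaussian_le_1[of c x] C] c by simp
  define S where "S h x = (LINT y|lborel. \<eta> (x + h *\<^sub>R y) * gaussian 1 y)" for h x
  have [measurable]: "S h \<in> borel_measurable borel" for h unfolding S_def by measurable
  have Dpos: "sqrt pi ^ DIM('a) > 0" by simp
  have S_bound: "norm (LINT x|lborel. f x * S h x) \<le> sqrt pi ^ DIM('a) * M" if h: "h > 0" for h
  proof -
    have "(LINT z|lborel. \<eta> z * gaussian (1 / h\<^sup>2) (z - x)) = h ^ DIM('a) *\<^sub>R S h x" for x
      unfolding S_def using h integral_lborel_affine(2)[of "\<lambda>z. \<eta> z * gaussian (1 / h\<^sup>2) (z - x)" h x]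
      by (simp add: gaussian_def power_mult_distrib field_simps)
    then have "(LINT z|lborel. (LINT x|lborel. f x * gaussian (1 / h\<^sup>2) (x - z)) * \<eta> z)
        = h ^ DIM('a) *\<^sub>R (LINT x|lborel. f x * S h x)"
      using h by (subst mollification_duality[OF f \<eta>]) simp_all
    with bound[OF h] h show ?thesis by (simp add: power_mult_distrib mult_ac)
  qed
  \<comment> \<open>A null sequence with c h^2 \<le> 1/2: half of \<open>gaussian 1 y\<close> then
    pays for the shift by h y, and \<open>S (h k)\<close> has a Gaussian majorant independent of
    k.\<close>
  define h where "h k = (1 / sqrt (2 * c)) / real (Suc k)" for k
  have h_pos: "h k > 0" for k using c by (simp add: h_def)
  have h_le: "c * (h k)\<^sup>2 \<le> 1 / 2" for k
  proof -
    have "c * (h k)\<^sup>2 = 1 / 2 * (1 / (real (Suc k))\<^sup>2)"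
      using c by (simp add: h_def power_divide power_mult_distrib del: of_nat_Suc)
    also have "\<dots> \<le> 1 / 2 * 1" by (intro mult_left_mono) (simp_all del: of_nat_Suc)
    finally show ?thesis by simp
  qed
  have h_lim: "h \<longlonglongrightarrow> 0"
    unfolding h_def by (rule tendsto_divide_0[OF tendsto_const]) (rule filterlim_at_top_imp_at_infinity, rule filterlim_compose[OF filterlim_real_sequentially filterlim_Suc])
  define K where "K = C * (LINT y|lborel. gaussian (1 / 2) (y::'a))"
  have S_le: "norm (S (h k) x) \<le> K * gaussian (c / 2) x" for k x
  proof -
    have "norm (\<eta> (x + h k *\<^sub>R y) * gaussian 1 y) \<le> C * gaussian (c / 2) x * gaussian (1 / 2) y" for y
    proof -
      have "(norm x)\<^sup>2 \<le> 2 * (norm (x + h k *\<^sub>R y))\<^sup>2 + 2 * ((h k)\<^sup>2 * (norm y)\<^sup>2)"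
        using norm_sum_square_le[of "x + h k *\<^sub>R y" "- (h k *\<^sub>R y)"] by (simp add: power_mult_distrib)
      then have "c / 2 * (norm x)\<^sup>2 \<le> c / 2 * (2 * (norm (x + h k *\<^sub>R y))\<^sup>2 + 2 * ((h k)\<^sup>2 * (norm y)\<^sup>2))"
        using c by (intro mult_left_mono) auto
      also have "\<dots> = c * (norm (x + h k *\<^sub>R y))\<^sup>2 + c * (h k)\<^sup>2 * (norm y)\<^sup>2" by (simp add: algebra_simps)
      also have "\<dots> \<le> c * (norm (x + h k *\<^sub>R y))\<^sup>2 + 1 / 2 * (norm y)\<^sup>2"
        using h_le[of k] by (intro add_left_mono mult_right_mono) auto
      finally have "gaussian c (x + h k *\<^sub>R y) * gaussian 1 y \<le> gaussian (c / 2) x * gaussian (1 / 2) y"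
        by (simp add: gaussian_def exp_add[symmetric])
      then have "C * (gaussian c (x + h k *\<^sub>R y) * gaussian 1 y) \<le> C * (gaussian (c / 2) x * gaussian (1 / 2) y)"
        using C by (rule mult_left_mono)
      moreover have "norm (\<eta> (x + h k *\<^sub>R y) * gaussian 1 y) \<le> C * gaussian c (x + h k *\<^sub>R y) * gaussian 1 y"
        using le[of "x + h k *\<^sub>R y"] by (simp add: norm_mult mult_right_mono)
      ultimately show ?thesis by (simp add: mult.assoc)
    qed
    then have "norm (S (h k) x) \<le> (LINT y|lborel. C * gaussian (c / 2) x * gaussian (1 / 2) (y::'a))"
      unfolding S_def using C
      by (intro order_trans[OF integral_norm_bound integral_mono'])
        (auto intro!: integrable_gaussian mult_nonneg_nonneg simp del: norm_mult)
    then show ?thesis by (simp add: K_def mult_ac)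
  qed
  have S_lim: "(\<lambda>k. S (h k) x) \<longlonglongrightarrow> sqrt pi ^ DIM('a) *\<^sub>R \<eta> x" for x
  proof -
    have "(\<lambda>k. S (h k) x) \<longlonglongrightarrow> (LINT y|lborel. \<eta> x * gaussian 1 (y::'a))"
      unfolding S_def
    proof (rule integral_dominated_convergence[where w = "\<lambda>y. C * gaussian 1 y"])
      show "integrable lborel (\<lambda>y::'a. C * gaussian 1 y)" by (simp add: integrable_gaussian)
      show "AE y in lborel. (\<lambda>k. \<eta> (x + h k *\<^sub>R y) * gaussian 1 y) \<longlonglongrightarrow> \<eta> x * gaussian 1 y"
      proof (intro AE_I2 tendsto_mult tendsto_const)
        fix y
        have "(\<lambda>k. x + h k *\<^sub>R y) \<longlonglongrightarrow> x + 0 *\<^sub>R y" by (intro tendsto_intros h_lim)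
        then show "(\<lambda>k. \<eta> (x + h k *\<^sub>R y)) \<longlonglongrightarrow> \<eta> x"
          using cont by (intro isCont_tendsto_compose[where g = \<eta>]) (auto simp: continuous_on_eq_continuous_at)
      qed
    qed (auto simp: norm_mult le_C intro!: mult_right_mono)
    also have "(LINT y|lborel. \<eta> x * gaussian 1 (y::'a)) = sqrt pi ^ DIM('a) *\<^sub>R \<eta> x"
      using integral_gaussian[of 1, where 'a = 'a] by (simp add: scaleR_conv_of_real)
    finally show ?thesis .
  qed
  have "(\<lambda>k. LINT x|lborel. f x * S (h k) x) \<longlonglongrightarrow> (LINT x|lborel. f x * (sqrt pi ^ DIM('a) *\<^sub>R \<eta> x))"
  proof (rule integral_dominated_convergence[where w = "\<lambda>x. K * norm (f x * gaussian (c / 2) x)"])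
    show "integrable lborel (\<lambda>x. K * norm (f x * gaussian (c / 2) x))"
      using f c by (intro integrable_mult_right integrable_norm) (auto simp: gaussian_integrable_def)
    show "AE x in lborel. norm (f x * S (h k) x) \<le> K * norm (f x * gaussian (c / 2) x)" for k
    proof (rule AE_I2)
      fix x show "norm (f x * S (h k) x) \<le> K * norm (f x * gaussian (c / 2) x)"
        using mult_left_mono[OF S_le[of k x], of "norm (f x)"] by (simp add: norm_mult mult_ac)
    qed
    show "AE x in lborel. (\<lambda>k. f x * S (h k) x) \<longlonglongrightarrow> f x * (sqrt pi ^ DIM('a) *\<^sub>R \<eta> x)"
      by (intro AE_I2 tendsto_mult tendsto_const S_lim)
  qed auto
  then have "norm (LINT x|lborel. f x * (sqrt pi ^ DIM('a) *\<^sub>R \<eta> x)) \<le> sqrt pi ^ DIM('a) * M"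
    using S_bound[OF h_pos] by (intro tendsto_upperbound[OF tendsto_norm]) auto
  then show ?thesis using Dpos by (simp add: mult_le_cancel_left_pos)
qed

section \<open>Square integrability and vanishing by duality\<close>

lemma cnj_measurable [measurable]: "cnj \<in> borel_measurable borel"
  by (intro borel_measurable_continuous_onI continuous_intros)

text \<open>A measurable function is an almost everywhere limit of continuous ones; projecting these
  radially onto balls of Gaussian radius gives test functions that approximate the conjugate of a
  truncation of \<open>f\<close>.\<close>

lemma L2_norm_le_by_duality:
  fixes f :: "'a::euclidean_space \<Rightarrow> complex"
  assumes f: "gaussian_integrable f" and M: "M \<ge> 0"
    and bound: "\<And>\<eta>. gaussian_decay \<eta> \<Longrightarrow> norm (LINT x|lborel. f x * \<eta> x) \<le> M * L2_norm \<eta>"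
  shows "in_L2 f \<and> L2_norm f \<le> M"
proof -
  have f_meas [measurable]: "f \<in> borel_measurable borel" using f by (simp add: gaussian_integrable_def)
  \<comment> \<open>Equal to \<open>cnj z\<close> inside the disc of radius \<rho> and of modulus
    \<rho> outside. Unlike a cut-off by an indicator it is continuous in z.\<close>
  define proj :: "real \<Rightarrow> complex \<Rightarrow> complex" where "proj \<rho> z = (\<rho> / max \<rho> (norm z)) *\<^sub>R cnj z" for \<rho> z
  have proj_le: "norm (proj \<rho> z) \<le> \<rho>" if "\<rho> > 0" for \<rho> z
    using that by (auto simp: proj_def max_def field_simps)
  have "(\<lambda>x. f x) measurable_on UNIV"
    by (intro lebesgue_measurable_imp_measurable_on) (auto intro: measurable_completion)
  then obtain N g where N: "negligible N" and g_cont: "\<And>n. continuous_on UNIV (g n)"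
    and g_lim: "\<And>x. x \<notin> N \<Longrightarrow> (\<lambda>n. g n x) \<longlonglongrightarrow> f x"
    unfolding measurable_on_def by auto
  have "AE x in lebesgue. x \<notin> N" using N by (auto intro: AE_not_in simp: negligible_iff_null_sets)
  then have AE_N: "AE x in lborel. x \<notin> N" by (simp add: AE_completion_iff)
  \<comment> \<open>For fixed m this has Gaussian decay, but at every point it tends to infinity
    with m, so each value of f is eventually left untouched.\<close>
  define \<rho> :: "nat \<Rightarrow> 'a \<Rightarrow> real" where "\<rho> m x = real (Suc m) * gaussian (1 / real (Suc m)) x" for m x
  have \<rho>_pos: "\<rho> m x > 0" for m x by (simp add: \<rho>_def)
  have \<rho>_cont: "continuous_on UNIV (\<rho> m)" for m unfolding \<rho>_def by (intro continuous_intros)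
  have [measurable]: "\<rho> m \<in> borel_measurable borel" for m
    by (intro borel_measurable_continuous_onI \<rho>_cont)
  define T where "T m x = proj (\<rho> m x) (f x)" for m x
  have [measurable]: "T m \<in> borel_measurable borel" for m
    unfolding T_def proj_def by measurable
  have \<rho>2: "integrable lborel (\<lambda>x. (\<rho> m x)\<^sup>2)" for m
  proof -
    have "(\<lambda>x. (\<rho> m x)\<^sup>2) = (\<lambda>x. (real (Suc m))\<^sup>2 * gaussian (2 / real (Suc m)) x)"
      by (auto simp: \<rho>_def power_mult_distrib power2_eq_square gaussian_mult)
    then show ?thesis by (simp add: integrable_gaussian)
  qed
  have T_le: "norm (T m x) \<le> \<rho> m x" for m x unfolding T_def by (intro proj_le \<rho>_pos)
  have T_bound: "(LINT x|lborel. (norm (T m x))\<^sup>2) \<le> M\<^sup>2" for m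
  proof -
    define \<eta> where "\<eta> k x = proj (\<rho> m x) (g k x)" for k x
    have \<eta>_le: "norm (\<eta> k x) \<le> \<rho> m x" for k x unfolding \<eta>_def by (intro proj_le \<rho>_pos)
    have \<eta>_cont: "continuous_on UNIV (\<eta> k)" for k
      unfolding \<eta>_def proj_def using \<rho>_pos
      by (intro continuous_intros g_cont \<rho>_cont) (metis less_irrefl less_max_iff_disj)
    have \<eta>: "gaussian_decay (\<eta> k)" for k
    proof -
      have "\<forall>x. norm (\<eta> k x) \<le> real (Suc m) * gaussian (1 / real (Suc m)) x"
        using \<eta>_le[of k] by (simp only: \<rho>_def) blast
      moreover have "real (Suc m) \<ge> 0" "1 / real (Suc m) > 0" by auto
      ultimately show ?thesis unfolding gaussian_decay_def using \<eta>_cont by blast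
    qed
    note [measurable] = gaussian_decay_measurable[OF \<eta>]
    have lim: "AE x in lborel. (\<lambda>k. \<eta> k x) \<longlonglongrightarrow> T m x"
      using AE_N
    proof eventually_elim
      case (elim x)
      then show ?case unfolding \<eta>_def T_def proj_def using \<rho>_pos[of m x]
        by (intro tendsto_intros g_lim) (auto simp: max_def)
    qed
    have lim1: "(\<lambda>k. LINT x|lborel. f x * \<eta> k x) \<longlonglongrightarrow> (LINT x|lborel. f x * T m x)"
    proof (rule integral_dominated_convergence[where w = "\<lambda>x. real (Suc m) * norm (f x * gaussian (1 / real (Suc m)) x)"])
      show "integrable lborel (\<lambda>x. real (Suc m) * norm (f x * gaussian (1 / real (Suc m)) x))"
        using f by (intro integrable_mult_right integrable_norm) (auto simp: gaussian_integrable_def)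
      show "AE x in lborel. (\<lambda>k. f x * \<eta> k x) \<longlonglongrightarrow> f x * T m x"
        using lim by eventually_elim (intro tendsto_intros)
      show "AE x in lborel. norm (f x * \<eta> k x) \<le> real (Suc m) * norm (f x * gaussian (1 / real (Suc m)) x)" for k
      proof (rule AE_I2)
        fix x show "norm (f x * \<eta> k x) \<le> real (Suc m) * norm (f x * gaussian (1 / real (Suc m)) x)"
          using mult_left_mono[OF \<eta>_le[of k x], of "norm (f x)"] by (simp add: norm_mult \<rho>_def mult_ac)
      qed
    qed auto
    have lim2: "(\<lambda>k. LINT x|lborel. (norm (\<eta> k x))\<^sup>2) \<longlonglongrightarrow> (LINT x|lborel. (norm (T m x))\<^sup>2)"
    proof (rule integral_dominated_convergence[where w = "\<lambda>x. (\<rho> m x)\<^sup>2"])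
      show "AE x in lborel. (\<lambda>k. (norm (\<eta> k x))\<^sup>2) \<longlonglongrightarrow> (norm (T m x))\<^sup>2"
        using lim by eventually_elim (intro tendsto_intros)
      show "AE x in lborel. norm ((norm (\<eta> k x))\<^sup>2) \<le> (\<rho> m x)\<^sup>2" for k
        using \<eta>_le by (auto intro!: power_mono)
    qed (use \<rho>2 in auto)
    have "norm (LINT x|lborel. f x * T m x) \<le> M * L2_norm (T m)"
      unfolding L2_norm_def
    proof (rule tendsto_le[OF _ _ tendsto_norm[OF lim1]])
      show "(\<lambda>k. M * sqrt (LINT x|lborel. (norm (\<eta> k x))\<^sup>2)) \<longlonglongrightarrow> M * sqrt (LINT x|lborel. (norm (T m x))\<^sup>2)"
        by (intro tendsto_intros lim2)
      show "\<forall>\<^sub>F k in sequentially. norm (LINT x|lborel. f x * \<eta> k x) \<le> M * sqrt (LINT x|lborel. (norm (\<eta> k x))\<^sup>2)"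
        using bound[OF \<eta>] unfolding L2_norm_def by simp
    qed simp
    \<comment> \<open>With ?q = \<rho> / max \<rho> |f| \<le> 1, the product f T equals ?q |f|^2 and
      |T|^2 equals ?q^2 |f|^2; hence |T|^2 \<le> f T, which is real.\<close>
    moreover have "(LINT x|lborel. (norm (T m x))\<^sup>2) \<le> norm (LINT x|lborel. f x * T m x)"
    proof -
      have fT: "f x * T m x = complex_of_real (\<rho> m x / max (\<rho> m x) (norm (f x)) * (norm (f x))\<^sup>2)" for x
        using complex_norm_square[of "f x"] by (simp add: T_def proj_def scaleR_conv_of_real)
      have int_T: "integrable lborel (\<lambda>x. (norm (T m x))\<^sup>2)"
        by (rule Bochner_Integration.integrable_bound[OF \<rho>2[of m]]) (use T_le in \<open>auto intro!: power_mono\<close>)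
      have int_fT: "integrable lborel (\<lambda>x. f x * T m x)"
        by (rule gaussian_integrable_mult_bounded[OF f, of _ "1 / real (Suc m)" "real (Suc m)"])
           (use T_le in \<open>auto simp: \<rho>_def\<close>)
      have "(LINT x|lborel. (norm (T m x))\<^sup>2) \<le> (LINT x|lborel. Re (f x * T m x))"
      proof (rule integral_mono[OF int_T])
        show "integrable lborel (\<lambda>x. Re (f x * T m x))" using int_fT by (rule integrable_Re)
        fix x
        let ?q = "\<rho> m x / max (\<rho> m x) (norm (f x))"
        have "max (\<rho> m x) (norm (f x)) > 0" using \<rho>_pos[of m x] by (simp add: less_max_iff_disj)
        then have q: "0 \<le> ?q" "?q \<le> 1"
          using \<rho>_pos[of m x] by (auto simp: divide_le_eq_1 intro!: divide_nonneg_pos)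
        have "(norm (T m x))\<^sup>2 = ?q * (?q * (norm (f x))\<^sup>2)"
          using q by (simp add: T_def proj_def power_mult_distrib power2_eq_square abs_mult)
        also have "\<dots> \<le> 1 * (?q * (norm (f x))\<^sup>2)"
          using q by (intro mult_right_mono mult_nonneg_nonneg) auto
        finally show "(norm (T m x))\<^sup>2 \<le> Re (f x * T m x)" unfolding fT Re_complex_of_real by simp
      qed
      also have "\<dots> = Re (LINT x|lborel. f x * T m x)" using int_fT by (rule integral_Re)
      also have "\<dots> \<le> norm (LINT x|lborel. f x * T m x)" by (rule complex_Re_le_cmod)
      finally show ?thesis .
    qed
    ultimately have le: "(LINT x|lborel. (norm (T m x))\<^sup>2) \<le> M * L2_norm (T m)" by linarith
    define s where "s = L2_norm (T m)"
    have s: "s \<ge> 0" "s\<^sup>2 = (LINT x|lborel. (norm (T m x))\<^sup>2)" by (simp_all add: s_def L2_norm_def)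
    \<comment> \<open>The truncation has finite norm, so s^2 \<le> M s may be divided by s; arguing
      by contradiction covers s = 0.\<close>
    have "s \<le> M"
    proof (rule ccontr)
      assume "\<not> s \<le> M"
      then have "M * s < s * s" using M s by (intro mult_strict_right_mono) auto
      with le s show False by (simp add: s_def power2_eq_square)
    qed
    then show ?thesis using power_mono[of s M 2] s by simp
  qed
  have T_eventually: "\<forall>\<^sub>F m in sequentially. norm (T m x) = norm (f x)" for x
  proof -
    have "filterlim (\<lambda>m. \<rho> m x) at_top sequentially"
    proof (rule filterlim_at_top_mono)
      show "filterlim (\<lambda>m. gaussian 1 x * real (Suc m)) at_top sequentially"
        by (rule filterlim_tendsto_pos_mult_at_top[OF tendsto_const _
              filterlim_compose[OF filterlim_real_sequentially filterlim_Suc]]) simp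
      show "\<forall>\<^sub>F m in sequentially. gaussian 1 x * real (Suc m) \<le> \<rho> m x"
      proof (intro always_eventually allI)
        fix m show "gaussian 1 x * real (Suc m) \<le> \<rho> m x"
          using mult_right_mono[OF gaussian_mono[of "1 / real (Suc m)" 1 x], of "real (Suc m)"]
          by (simp add: \<rho>_def mult.commute del: of_nat_Suc)
      qed
    qed
    then have "\<forall>\<^sub>F m in sequentially. \<rho> m x \<ge> norm (f x)" by (simp add: filterlim_at_top)
    then show ?thesis
      by eventually_elim (use \<rho>_pos in \<open>auto simp: T_def proj_def max_def less_imp_neq[symmetric]\<close>)
  qed
  have int_T: "integrable lborel (\<lambda>x. (norm (T m x))\<^sup>2)" for m
    by (rule Bochner_Integration.integrable_bound[OF \<rho>2[of m]])
       (use T_le in \<open>auto intro!: power_mono\<close>)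
  \<comment> \<open>Fatou's lemma over the truncations: at each point the integrands are eventually
    constant in m, so the lower limit is the full square.\<close>
  have "(\<integral>\<^sup>+x. ennreal ((norm (f x))\<^sup>2) \<partial>lborel) = (\<integral>\<^sup>+x. liminf (\<lambda>m. ennreal ((norm (T m x))\<^sup>2)) \<partial>lborel)"
  proof (intro nn_integral_cong)
    fix x
    have "(\<lambda>m. ennreal ((norm (T m x))\<^sup>2)) \<longlonglongrightarrow> ennreal ((norm (f x))\<^sup>2)"
      by (rule tendsto_eventually) (use T_eventually[of x] in \<open>eventually_elim, simp\<close>)
    then show "ennreal ((norm (f x))\<^sup>2) = liminf (\<lambda>m. ennreal ((norm (T m x))\<^sup>2))"
      using lim_imp_Liminf[OF trivial_limit_sequentially] by metis
  qed
  also have "\<dots> \<le> liminf (\<lambda>m. \<integral>\<^sup>+x. ennreal ((norm (T m x))\<^sup>2) \<partial>lborel)"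
    by (rule nn_integral_liminf) measurable
  also have "\<dots> \<le> liminf (\<lambda>m::nat. ennreal (M\<^sup>2))"
    using T_bound by (intro Liminf_mono always_eventually allI)
      (simp add: nn_integral_eq_integral[OF int_T] ennreal_leI)
  also have "\<dots> = ennreal (M\<^sup>2)" by (simp add: Liminf_const)
  finally have fin: "(\<integral>\<^sup>+x. ennreal ((norm (f x))\<^sup>2) \<partial>lborel) \<le> ennreal (M\<^sup>2)" .
  then have int: "integrable lborel (\<lambda>x. (norm (f x))\<^sup>2)"
    by (intro integrableI_bounded) (auto simp: less_top[symmetric] top_unique)
  moreover have "(LINT x|lborel. (norm (f x))\<^sup>2) \<le> M\<^sup>2"
    using fin by (simp add: nn_integral_eq_integral[OF int])
  then have "L2_norm f \<le> M" unfolding L2_norm_def using M by (simp add: real_le_lsqrt real_sqrt_le_iff')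
  ultimately show ?thesis by (simp add: in_L2_def)
qed

text \<open>The case M = 0 of \<open>L2_norm_le_by_duality\<close>; it also supplies the square
  integrability that turns a vanishing norm into a vanishing function.\<close>

lemma AE_eq_0_by_duality:
  fixes f :: "'a::euclidean_space \<Rightarrow> complex"
  assumes f: "gaussian_integrable f"
    and "\<And>\<eta>. gaussian_decay \<eta> \<Longrightarrow> (LINT x|lborel. f x * \<eta> x) = 0"
  shows "AE x in lborel. f x = 0"
proof -
  have L2: "in_L2 f" "L2_norm f \<le> 0"
    using L2_norm_le_by_duality[OF f, of 0] assms(2) by auto
  then have "(LINT x|lborel. (norm (f x))\<^sup>2) = 0"
    by (simp add: L2_norm_def antisym)
  then show ?thesis
    using L2 by (subst (asm) integral_nonneg_eq_0_iff_AE) (auto simp: in_L2_def)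
qed

subsection \<open>Gaussian test functions\<close>

lemma partial_deriv_eq:
  assumes "\<And>x. (f has_derivative f' x) (at x)"
  shows "partial_deriv i f = (\<lambda>x. f' x i)"
  using frechet_derivative_at[OF assms] by (simp add: partial_deriv_def)

text \<open>The amplitudes that can stand before a Gaussian: the algebra generated by polynomials
  and characters is closed under \<open>partial_deriv\<close> and has polynomial growth. The
  inductive form replaces multi-index formulas by one induction for each property.\<close>

inductive tempered :: "('a::euclidean_space \<Rightarrow> complex) \<Rightarrow> bool" where
  const: "tempered (\<lambda>x. c)"
| inner: "tempered (\<lambda>x. of_real (x \<bullet> v))"
| cis: "tempered (\<lambda>x. cis (z \<bullet> x))"
| add: "tempered P \<Longrightarrow> tempered Q \<Longrightarrow> tempered (\<lambda>x. P x + Q x)"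
| mult: "tempered P \<Longrightarrow> tempered Q \<Longrightarrow> tempered (\<lambda>x. P x * Q x)"

lemma tempered_derivative:
  assumes "tempered P"
  shows "(\<forall>x. P differentiable (at x)) \<and> (\<forall>i. tempered (partial_deriv i P))"
  using assms
proof induction
  case (const c)
  have d: "((\<lambda>x::'a. c) has_derivative (\<lambda>h. 0)) (at x)" for x by simp
  show ?case using partial_deriv_eq[OF d] by (auto intro: tempered.const)
next
  case (inner v)
  have d: "((\<lambda>x::'a. of_real (x \<bullet> v)) has_derivative (\<lambda>h. complex_of_real (h \<bullet> v))) (at x)" for x
    by (auto intro!: derivative_eq_intros)
  show ?case using partial_deriv_eq[OF d] d by (auto simp: differentiable_def intro: tempered.const)
next
  case (cis z)
  have d: "((\<lambda>x::'a. cis (z \<bullet> x)) has_derivative (\<lambda>h. \<i> * of_real (z \<bullet> h) * cis (z \<bullet> x))) (at x)" for x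
    by (rule has_derivative_eq_rhs[OF has_derivative_cis[OF has_derivative_inner_right[OF has_derivative_ident]]])
       (simp add: fun_eq_iff scaleR_conv_of_real)
  show ?case using partial_deriv_eq[OF d] d
    by (auto simp: differentiable_def intro!: tempered.intros)
next
  case (add P Q)
  then have "((\<lambda>x. P x + Q x) has_derivative
     (\<lambda>h. frechet_derivative P (at x) h + frechet_derivative Q (at x) h)) (at x)" for x
    by (auto intro!: derivative_eq_intros simp: frechet_derivative_works)
  note d = this
  show ?case using partial_deriv_eq[OF d] d add
    by (auto simp: differentiable_def partial_deriv_def intro!: tempered.add)
next
  case (mult P Q)
  then have "((\<lambda>x. P x * Q x) has_derivative
     (\<lambda>h. P x * frechet_derivative Q (at x) h + frechet_derivative P (at x) h * Q x)) (at x)" for x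
    by (intro has_derivative_mult) (auto simp: frechet_derivative_works)
  note d = this
  show ?case using partial_deriv_eq[OF d] d mult
    by (auto simp: differentiable_def partial_deriv_def intro!: tempered.add tempered.mult)
qed

lemma tempered_measurable: "tempered P \<Longrightarrow> P \<in> borel_measurable borel"
  using tempered_derivative[of P]
  by (intro borel_measurable_continuous_onI differentiable_imp_continuous_on)
     (auto simp: differentiable_on_def intro: differentiable_at_withinI)

lemma tempered_bound:
  assumes "tempered P"
  shows "\<exists>C\<ge>0. \<exists>k. \<forall>x. norm (P x) \<le> C * (1 + norm x) ^ k"
  using assms
proof induction
  case (const c)
  show ?case by (intro exI[of _ "norm c"] conjI exI[of _ 0]) auto
next
  case (inner v)
  have "norm (complex_of_real (x \<bullet> v)) \<le> norm v * (1 + norm x) ^ 1" for x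
    using Cauchy_Schwarz_ineq2[of x v] by (simp add: distrib_left mult.commute add_increasing)
  then show ?case using norm_ge_zero by blast
next
  case (cis z)
  have "norm (cis (z \<bullet> x)) \<le> 1 * (1 + norm x) ^ 0" for x by simp
  then show ?case using zero_le_one by blast
next
  case (add P Q)
  then obtain C C' k k' where *: "C \<ge> 0" "C' \<ge> 0" "\<And>x. norm (P x) \<le> C * (1 + norm x) ^ k"
    "\<And>x. norm (Q x) \<le> C' * (1 + norm x) ^ k'" by auto
  \<comment> \<open>The sum of the two exponents is a common exponent because 1 + |x| \<ge>
    1.\<close>
  have "norm (P x + Q x) \<le> (C + C') * (1 + norm x) ^ (k + k')" for x
  proof -
    have "norm (P x + Q x) \<le> C * (1 + norm x) ^ k + C' * (1 + norm x) ^ k'"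
      using *(3)[of x] *(4)[of x] norm_triangle_ineq[of "P x" "Q x"] by linarith
    also have "\<dots> \<le> C * (1 + norm x) ^ (k + k') + C' * (1 + norm x) ^ (k + k')"
      using * by (intro add_mono mult_left_mono power_increasing) auto
    finally show ?thesis by (simp add: algebra_simps)
  qed
  then show ?case using * by (metis add_nonneg_nonneg)
next
  case (mult P Q)
  then obtain C C' k k' where *: "C \<ge> 0" "C' \<ge> 0" "\<And>x. norm (P x) \<le> C * (1 + norm x) ^ k"
    "\<And>x. norm (Q x) \<le> C' * (1 + norm x) ^ k'" by auto
  have "norm (P x * Q x) \<le> (C * C') * (1 + norm x) ^ (k + k')" for x
    using mult_mono[OF *(3)[of x] *(4)[of x]] * by (simp add: norm_mult power_add mult_ac)
  then show ?case using * by (metis mult_nonneg_nonneg)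
qed

text \<open>Half of the Gaussian pays for the power. With s = |x - y| and b = a / 2: 1 + |x| \<le>
  (1 + |y|) (1 + s), then 1 + s \<le> exp s, and k s - b s^2 \<le> k^2 / (4 b) by completing the
  square.\<close>

lemma power_times_gaussian_le:
  fixes y :: "'a::euclidean_space"
  assumes a: "a > 0"
  shows "\<exists>K\<ge>0. \<forall>x. (1 + norm x) ^ k * gaussian a (x - y) \<le> K * gaussian (a / 2) (x - y)"
proof (intro exI conjI allI)
  fix x :: 'a
  let ?s = "norm (x - y)" and ?b = "a / 2"
  have "norm x \<le> norm y + ?s" using norm_triangle_ineq[of y "x - y"] by simp
  also have "1 + (norm y + ?s) \<le> (1 + norm y) * (1 + ?s)" by (simp add: algebra_simps)
  finally have "(1 + norm x) ^ k \<le> ((1 + norm y) * (1 + ?s)) ^ k" by (intro power_mono) auto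
  also have "\<dots> \<le> (1 + norm y) ^ k * exp ?s ^ k"
    unfolding power_mult_distrib by (intro mult_left_mono power_mono) auto
  finally have "(1 + norm x) ^ k \<le> (1 + norm y) ^ k * exp (real k * ?s)"
    by (simp add: exp_of_nat_mult)
  then have "(1 + norm x) ^ k * gaussian a (x - y) \<le> (1 + norm y) ^ k * exp (real k * ?s) * gaussian a (x - y)"
    by (intro mult_right_mono) auto
  also have "\<dots> = (1 + norm y) ^ k * (exp (real k * ?s - ?b * ?s\<^sup>2) * gaussian ?b (x - y))"
    by (simp add: gaussian_def exp_add[symmetric] algebra_simps)
  also have "\<dots> \<le> (1 + norm y) ^ k * (exp ((real k)\<^sup>2 / (4 * ?b)) * gaussian ?b (x - y))"
  proof -
    have "0 \<le> (2 * ?b * ?s - real k)\<^sup>2 / (4 * ?b)" using a by simp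
    then have "real k * ?s - ?b * ?s\<^sup>2 \<le> (real k)\<^sup>2 / (4 * ?b)"
      using a by (simp add: power2_eq_square field_simps)
    then show ?thesis by (intro mult_left_mono mult_right_mono) auto
  qed
  finally show "(1 + norm x) ^ k * gaussian a (x - y) \<le>
      ((1 + norm y) ^ k * exp ((real k)\<^sup>2 / (4 * ?b))) * gaussian ?b (x - y)" by (simp only: mult.assoc)
qed simp

lemma tempered_gaussian_bound:
  fixes y :: "'a::euclidean_space"
  assumes P: "tempered P" and a: "a > 0"
  shows "\<exists>K\<ge>0. \<forall>x. norm x ^ k * norm (P x * gaussian a (x - y)) \<le> K * gaussian (a / 2) (x - y)"
proof -
  obtain C j where C: "C \<ge> 0" "\<And>x. norm (P x) \<le> C * (1 + norm x) ^ j" using tempered_bound[OF P] by auto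
  obtain K where K: "K \<ge> 0" "\<And>x. (1 + norm x) ^ (k + j) * gaussian a (x - y) \<le> K * gaussian (a / 2) (x - y)"
    using power_times_gaussian_le[OF a, of "k + j" y] by auto
  have "norm x ^ k * norm (P x * gaussian a (x - y)) \<le> (C * K) * gaussian (a / 2) (x - y)" for x
  proof -
    have "norm x ^ k * norm (P x * gaussian a (x - y))
        \<le> (1 + norm x) ^ k * (C * (1 + norm x) ^ j * gaussian a (x - y))"
      unfolding norm_mult using C(1) C(2)[of x] by (intro mult_mono power_mono) (auto simp: mult_right_mono)
    also have "\<dots> = C * ((1 + norm x) ^ (k + j) * gaussian a (x - y))" by (simp add: power_add)
    also have "\<dots> \<le> C * (K * gaussian (a / 2) (x - y))" using K C by (intro mult_left_mono) auto
    finally show ?thesis by simp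
  qed
  then show ?thesis using C K by (metis mult_nonneg_nonneg)
qed

lemma integrable_tempered_gaussian:
  fixes y :: "'a::euclidean_space"
  assumes P: "tempered P" and a: "a > 0"
  shows "integrable lborel (\<lambda>x. norm x ^ k *\<^sub>R (P x * gaussian a (x - y)))"
proof -
  obtain K where K: "K \<ge> 0" "\<And>x. norm x ^ k * norm (P x * gaussian a (x - y)) \<le> K * gaussian (a / 2) (x - y)"
    using tempered_gaussian_bound[OF P a] by blast
  note [measurable] = tempered_measurable[OF P]
  show ?thesis
  proof (rule Bochner_Integration.integrable_bound)
    show "integrable lborel (\<lambda>x. K * gaussian (a / 2) (x - y))"
      using a by (simp add: integrable_gaussian_translate)
    show "AE x in lborel. norm (norm x ^ k *\<^sub>R (P x * gaussian a (x - y))) \<le> norm (K * gaussian (a / 2) (x - y))"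
      using K by (intro AE_I2) (simp add: abs_mult norm_mult)
  qed measurable
qed

text \<open>Every iterated derivative is again a tempered amplitude times the same Gaussian, so all
  seminorms reduce to \<open>tempered_gaussian_bound\<close>.\<close>

lemma schwartz_tempered_gaussian:
  fixes y :: "'a::euclidean_space"
  assumes P: "tempered P" and a: "a > 0"
  shows "schwartz (\<lambda>x. P x * gaussian a (x - y))"
proof -
  have d: "((\<lambda>x. P x * gaussian a (x - y)) has_derivative
      (\<lambda>h. P x * (- 2 * a * ((x - y) \<bullet> h) * gaussian a (x - y)) + frechet_derivative P (at x) h * gaussian a (x - y))) (at x)"
    if "tempered P" for P and x
  proof -
    have "((\<lambda>x. complex_of_real (gaussian a (x - y))) has_derivative
        (\<lambda>h. of_real (- 2 * a * ((x - y) \<bullet> h) * gaussian a (x - y)))) (at x)"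
      unfolding gaussian_def power2_norm_eq_inner
      by (auto intro!: derivative_eq_intros simp: inner_commute algebra_simps)
    moreover have "(P has_derivative frechet_derivative P (at x)) (at x)"
      using tempered_derivative[OF that] frechet_derivative_works by blast
    ultimately show ?thesis using has_derivative_mult by fastforce
  qed
  have step: "\<exists>Q. tempered Q \<and> partial_deriv i (\<lambda>x. P x * gaussian a (x - y)) = (\<lambda>x. Q x * gaussian a (x - y))"
    if "tempered P" for P i
  proof (intro exI conjI)
    \<comment> \<open>The factor -2 a (x - y) . i is spelled out with constants and a linear form so
      that the constructors of \<open>tempered\<close> match it.\<close>
    have t: "tempered (\<lambda>x. P x * (of_real (- 2 * a) * (of_real (x \<bullet> i) + of_real (- (y \<bullet> i)))) + partial_deriv i P x)"
      using tempered_derivative[OF that] that by (intro tempered.intros) auto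
    then show "tempered (\<lambda>x. P x * (of_real (- 2 * a) * (of_real (x \<bullet> i) + of_real (- (y \<bullet> i)))) + partial_deriv i P x)" .
    show "partial_deriv i (\<lambda>x. P x * gaussian a (x - y)) =
      (\<lambda>x. (P x * (of_real (- 2 * a) * (of_real (x \<bullet> i) + of_real (- (y \<bullet> i)))) + partial_deriv i P x) * gaussian a (x - y))"
      unfolding partial_deriv_eq[OF d[OF that]]
      by (auto simp: partial_deriv_def inner_diff_left algebra_simps)
  qed
  have ex: "\<exists>Q. tempered Q \<and> foldr partial_deriv is (\<lambda>x. P x * gaussian a (x - y)) = (\<lambda>x. Q x * gaussian a (x - y))" for "is"
  proof (induction "is")
    case Nil then show ?case using P by auto
  next
    case (Cons i "is")
    then obtain Q where "tempered Q" "foldr partial_deriv is (\<lambda>x. P x * gaussian a (x - y)) = (\<lambda>x. Q x * gaussian a (x - y))"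
      by blast
    then show ?case using step[of Q i] by simp
  qed
  show ?thesis unfolding schwartz_def
  proof (intro allI impI conjI)
    fix "is" :: "'a list" and x and k :: nat
    obtain Q where Q: "tempered Q" "foldr partial_deriv is (\<lambda>x. P x * gaussian a (x - y)) = (\<lambda>x. Q x * gaussian a (x - y))"
      using ex by blast
    show "foldr partial_deriv is (\<lambda>x. P x * gaussian a (x - y)) differentiable (at x)"
      unfolding Q(2) using d[OF Q(1)] by (auto simp: differentiable_def)
    obtain K where K: "K \<ge> 0" "\<And>x. norm x ^ k * norm (Q x * gaussian a (x - y)) \<le> K * gaussian (a / 2) (x - y)"
      using tempered_gaussian_bound[OF Q(1) a] by blast
    have "norm x ^ k * norm (Q x * gaussian a (x - y)) \<le> K" for x
      using order_trans[OF K(2)[of x] mult_left_mono[OF gaussian_le_1 K(1)]] a by simp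
    then show "bounded (range (\<lambda>x. norm x ^ k *\<^sub>R foldr partial_deriv is (\<lambda>x. P x * gaussian a (x - y)) x))"
      unfolding Q(2) bounded_iff by (intro exI[of _ K]) (simp add: norm_mult)
  qed
qed

lemma schwartz_gaussian: "a > 0 \<Longrightarrow> schwartz (\<lambda>x. complex_of_real (gaussian a (x - y)))"
  using schwartz_tempered_gaussian[OF tempered.const[of 1]] by simp

lemma schwartz_gaussian_modulated: "a > 0 \<Longrightarrow> schwartz (\<lambda>x. cis (z \<bullet> x) * gaussian a x)"
  using schwartz_tempered_gaussian[OF tempered.cis[of z], where y = 0] by simp

lemma tempered_norm_square: "tempered (\<lambda>x::'a::euclidean_space. - complex_of_real ((norm x)\<^sup>2))"
proof -
  have s: "tempered (\<lambda>x::'a. \<Sum>b\<in>A. of_real (x \<bullet> b) * of_real (x \<bullet> b))" if "finite A" for A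
    using that
  proof (induction A rule: finite_induct)
    case empty
    show ?case using tempered.const[of 0] by simp
  next
    case (insert b A)
    then show ?case
      using tempered.add[OF tempered.mult[OF tempered.inner[of b] tempered.inner[of b]]] by simp
  qed
  have "(\<lambda>x::'a. - complex_of_real ((norm x)\<^sup>2)) = (\<lambda>x. of_real (- 1) * (\<Sum>b\<in>Basis. of_real (x \<bullet> b) * of_real (x \<bullet> b)))"
    unfolding power2_norm_eq_inner by (subst euclidean_inner) simp
  then show ?thesis by (simp only: tempered.mult[OF tempered.const s[OF finite_Basis]])
qed

text \<open>\<open>has_fourier_transform\<close> evaluates a distribution at transforms of tests,
  while \<open>dist_eq\<close> gives information only at Schwartz functions; both can be used
  together once the transformed tests are known to be Schwartz.\<close>

lemma schwartz_fourier_gaussian: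
  fixes y :: "'a::euclidean_space"
  assumes a: "a > 0"
  shows "schwartz (fourier (\<lambda>x. gaussian a (x - y)))"
proof -
  have "fourier (\<lambda>x. gaussian a (x - y)) =
      (\<lambda>\<xi>. (of_real (sqrt (pi / a) ^ DIM('a)) * cis ((- y) \<bullet> \<xi>)) * gaussian (1 / (4 * a)) (\<xi> - 0))"
    by (rule ext, subst fourier_gaussian_translate[OF a]) simp
  moreover have "schwartz \<dots>"
    using a by (intro schwartz_tempered_gaussian tempered.intros) auto
  ultimately show ?thesis by simp
qed

subsection \<open>Derivatives of the Fourier transform\<close>

text \<open>Not sharp near 0, but a bound linear in s provides a majorant that costs only one moment
  of the integrand.\<close>

lemma norm_cis_minus_linear_le: "norm (cis s - 1 - \<i> * s) \<le> 2 * \<bar>s\<bar>"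
proof -
  have "norm (cis s - 1) \<le> \<bar>s\<bar>"
    using iexp_approx1[of s 0] by (simp add: cis_conv_exp)
  then show ?thesis
    using norm_triangle_ineq4[of "cis s - 1" "\<i> * s"] by (simp add: norm_mult)
qed

text \<open>Differentiation under the integral: the remainder divided by |h| tends to 0 at each x
  and is dominated by 2 |x| |\<phi> x|. The limit is taken along sequences because dominated
  convergence is sequential.\<close>

lemma fourier_has_derivative:
  fixes \<phi> :: "'a::euclidean_space \<Rightarrow> complex"
  assumes \<phi>: "integrable lborel \<phi>" and \<phi>1: "integrable lborel (\<lambda>x. norm x *\<^sub>R \<phi> x)"
  shows "(fourier \<phi> has_derivative (\<lambda>h. fourier (\<lambda>x. - \<i> * of_real (x \<bullet> h) * \<phi> x) \<xi>)) (at \<xi>)"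
proof -
  have [measurable]: "\<phi> \<in> borel_measurable borel" using \<phi> by auto
  have int: "integrable lborel (\<lambda>x. - \<i> * of_real (x \<bullet> h) * \<phi> x)" for h
  proof (rule Bochner_Integration.integrable_bound)
    show "integrable lborel (\<lambda>x. norm h * norm (norm x *\<^sub>R \<phi> x))"
      by (intro integrable_mult_right integrable_norm \<phi>1)
    show "AE x in lborel. norm (- \<i> * of_real (x \<bullet> h) * \<phi> x) \<le> norm (norm h * norm (norm x *\<^sub>R \<phi> x))"
    proof (rule AE_I2)
      fix x show "norm (- \<i> * of_real (x \<bullet> h) * \<phi> x) \<le> norm (norm h * norm (norm x *\<^sub>R \<phi> x))"
        using mult_right_mono[OF Cauchy_Schwarz_ineq2[of x h], of "norm (\<phi> x)"]
        by (simp add: norm_mult abs_mult mult_ac)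
    qed
  qed measurable
  note int' = integrable_cis_mult[OF int]
  have lin: "bounded_linear (\<lambda>h. fourier (\<lambda>x. - \<i> * of_real (x \<bullet> h) * \<phi> x) \<xi>)"
  proof (rule linear_conv_bounded_linear[THEN iffD1], rule linearI)
    fix h k :: 'a and r :: real
    have "fourier (\<lambda>x. - \<i> * of_real (x \<bullet> (h + k)) * \<phi> x) \<xi> =
      (LINT x|lborel. cis (- (x \<bullet> \<xi>)) * (- \<i> * of_real (x \<bullet> h) * \<phi> x) + cis (- (x \<bullet> \<xi>)) * (- \<i> * of_real (x \<bullet> k) * \<phi> x))"
      unfolding fourier_def by (intro Bochner_Integration.integral_cong refl) (simp add: inner_add_right algebra_simps)
    then show "fourier (\<lambda>x. - \<i> * of_real (x \<bullet> (h + k)) * \<phi> x) \<xi> =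
        fourier (\<lambda>x. - \<i> * of_real (x \<bullet> h) * \<phi> x) \<xi> + fourier (\<lambda>x. - \<i> * of_real (x \<bullet> k) * \<phi> x) \<xi>"
      unfolding fourier_def by (subst (asm) Bochner_Integration.integral_add[OF int' int'])
    show "fourier (\<lambda>x. - \<i> * of_real (x \<bullet> (r *\<^sub>R h)) * \<phi> x) \<xi> = r *\<^sub>R fourier (\<lambda>x. - \<i> * of_real (x \<bullet> h) * \<phi> x) \<xi>"
      unfolding fourier_def by (subst integral_scaleR_right[symmetric])
        (intro Bochner_Integration.integral_cong refl, simp add: scaleR_conv_of_real mult_ac)
  qed
  show ?thesis unfolding has_derivative_at
  proof (intro conjI lin)
    define R where "R h x = cis (- (x \<bullet> (\<xi> + h))) * \<phi> x - cis (- (x \<bullet> \<xi>)) * \<phi> x - cis (- (x \<bullet> \<xi>)) * (- \<i> * of_real (x \<bullet> h) * \<phi> x)" for h x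
    have R_eq: "R h x = cis (- (x \<bullet> \<xi>)) * \<phi> x * (cis (- (x \<bullet> h)) - 1 - \<i> * of_real (- (x \<bullet> h)))" for h x
    proof -
      have "cis (- (x \<bullet> (\<xi> + h))) = cis (- (x \<bullet> \<xi>)) * cis (- (x \<bullet> h))"
        by (simp add: cis_mult inner_add_right)
      then show ?thesis by (simp add: R_def algebra_simps)
    qed
    have R_int: "fourier \<phi> (\<xi> + h) - fourier \<phi> \<xi> - fourier (\<lambda>x. - \<i> * of_real (x \<bullet> h) * \<phi> x) \<xi> = (LINT x|lborel. R h x)" for h
      unfolding fourier_def R_def
      using Bochner_Integration.integral_diff[OF Bochner_Integration.integrable_diff[OF
          integrable_cis_mult[OF \<phi>, of "\<xi> + h"] integrable_cis_mult[OF \<phi>, of \<xi>]] int'[of \<xi> h]]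
        Bochner_Integration.integral_diff[OF integrable_cis_mult[OF \<phi>, of "\<xi> + h"] integrable_cis_mult[OF \<phi>, of \<xi>]]
      by (simp only:)
    have [measurable]: "R h \<in> borel_measurable borel" for h unfolding R_def by measurable
    have "((\<lambda>h. (LINT x|lborel. (1 / norm h) *\<^sub>R R h x)) \<longlongrightarrow> 0) (at 0)"
      unfolding tendsto_at_iff_sequentially comp_def
    proof (intro allI impI)
      fix h :: "nat \<Rightarrow> 'a" assume h: "\<forall>i. h i \<in> UNIV - {0}" and h0: "h \<longlonglongrightarrow> 0"
      have "(\<lambda>i. (LINT x|lborel. (1 / norm (h i)) *\<^sub>R R (h i) x)) \<longlonglongrightarrow> (LINT x|(lborel :: 'a measure). (0::complex))"
      proof (rule integral_dominated_convergence[where w = "\<lambda>x::'a. 2 * norm (norm x *\<^sub>R \<phi> x)"])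
        show "integrable lborel (\<lambda>x::'a. 2 * norm (norm x *\<^sub>R \<phi> x))"
          by (intro integrable_mult_right integrable_norm \<phi>1)
        show "AE x in lborel. norm ((1 / norm (h i)) *\<^sub>R R (h i) x) \<le> 2 * norm (norm x *\<^sub>R \<phi> x)" for i
        proof (rule AE_I2)
          fix x :: 'a
          have "norm (R (h i) x) \<le> norm (\<phi> x) * (2 * \<bar>- (x \<bullet> h i)\<bar>)"
            unfolding R_eq norm_mult norm_cis mult_1
            by (intro mult_left_mono norm_cis_minus_linear_le norm_ge_zero)
          also have "\<dots> \<le> norm (\<phi> x) * (2 * (norm x * norm (h i)))"
            using Cauchy_Schwarz_ineq2[of x "h i"] by (intro mult_left_mono) auto
          finally show "norm ((1 / norm (h i)) *\<^sub>R R (h i) x) \<le> 2 * norm (norm x *\<^sub>R \<phi> x)"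
            using h by (auto simp: divide_simps mult_ac)
        qed
        show "AE x in lborel. (\<lambda>i. (1 / norm (h i)) *\<^sub>R R (h i) x) \<longlonglongrightarrow> 0"
        proof (rule AE_I2)
          fix x :: 'a
          have "((\<lambda>h. cis (- (x \<bullet> h))) has_derivative (\<lambda>h. \<i> * of_real (- (x \<bullet> h)))) (at 0)"
            by (rule has_derivative_eq_rhs[OF has_derivative_cis[OF has_derivative_minus[OF
                  has_derivative_inner_right[OF has_derivative_ident]]]])
               (simp add: fun_eq_iff scaleR_conv_of_real)
          then have "((\<lambda>h. norm (cis (- (x \<bullet> h)) - 1 - \<i> * of_real (- (x \<bullet> h))) / norm h) \<longlongrightarrow> 0) (at 0)"
            unfolding has_derivative_at by simp
          then have "(\<lambda>i. norm (cis (- (x \<bullet> h i)) - 1 - \<i> * of_real (- (x \<bullet> h i))) / norm (h i)) \<longlonglongrightarrow> 0"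
            using h h0 unfolding tendsto_at_iff_sequentially comp_def by blast
          then have "(\<lambda>i. norm (\<phi> x) * (norm (cis (- (x \<bullet> h i)) - 1 - \<i> * of_real (- (x \<bullet> h i))) / norm (h i))) \<longlonglongrightarrow> norm (\<phi> x) * 0"
            by (intro tendsto_intros)
          then have "(\<lambda>i. norm ((1 / norm (h i)) *\<^sub>R R (h i) x)) \<longlonglongrightarrow> 0"
            unfolding R_eq by (simp add: norm_mult)
          then show "(\<lambda>i. (1 / norm (h i)) *\<^sub>R R (h i) x) \<longlonglongrightarrow> 0" by (rule tendsto_norm_zero_cancel)
        qed
      qed auto
      then show "(\<lambda>i. (LINT x|lborel. (1 / norm (h i)) *\<^sub>R R (h i) x)) \<longlonglongrightarrow> 0" by simp
    qed
    then have "((\<lambda>h. norm (LINT x|lborel. R h x) / norm h) \<longlongrightarrow> 0) (at 0)"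
      by (subst (asm) tendsto_norm_zero_iff[symmetric]) simp
    then show "((\<lambda>h. norm (fourier \<phi> (\<xi> + h) - fourier \<phi> \<xi> - fourier (\<lambda>x. - \<i> * of_real (x \<bullet> h) * \<phi> x) \<xi>) / norm h) \<longlongrightarrow> 0) (at 0)"
      unfolding R_int .
  qed
qed

text \<open>Each derivative of the transform multiplies the amplitude by -i times a coordinate. The
  amplitude stays \<open>tempered\<close>, which provides the moments needed for the second
  derivative.\<close>

lemma laplacian_fourier_gaussian:
  fixes y :: "'a::euclidean_space"
  assumes a: "a > 0"
  shows "laplacian (fourier (\<lambda>x. gaussian a (x - y))) = fourier (\<lambda>x. - complex_of_real ((norm x)\<^sup>2) * gaussian a (x - y))"
proof -
  have pd: "partial_deriv i (fourier (\<lambda>x. P x * gaussian a (x - y))) = fourier (\<lambda>x. (- \<i> * of_real (x \<bullet> i) * P x) * gaussian a (x - y))"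
    if P: "tempered P" for P i
    using partial_deriv_eq[OF fourier_has_derivative[OF integrable_tempered_gaussian[OF P a, of 0, simplified]
        integrable_tempered_gaussian[OF P a, of 1, simplified]]]
    by (simp add: mult.assoc)
  \<comment> \<open>The trailing \<open>1\<close> is the amplitude of the bare Gaussian, kept so
    that \<open>pd\<close> applies twice in the same shape.\<close>
  have t: "tempered (\<lambda>x::'a. - \<i> * of_real (x \<bullet> i) * 1)" for i by (intro tempered.intros)
  have t2: "tempered (\<lambda>x::'a. - \<i> * of_real (x \<bullet> i) * (- \<i> * of_real (x \<bullet> i) * 1))" for i by (intro tempered.intros)
  have "laplacian (fourier (\<lambda>x. gaussian a (x - y))) \<xi> =
     (\<Sum>i\<in>Basis. fourier (\<lambda>x. (- \<i> * of_real (x \<bullet> i) * (- \<i> * of_real (x \<bullet> i) * 1)) * gaussian a (x - y)) \<xi>)" for \<xi>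
    unfolding laplacian_def
    using pd[OF tempered.const[of 1]] pd[OF t] by simp
  also have "\<dots> \<xi> = (LINT x|lborel. (\<Sum>i\<in>Basis. cis (- (x \<bullet> \<xi>)) * ((- \<i> * of_real (x \<bullet> i) * (- \<i> * of_real (x \<bullet> i) * 1)) * gaussian a (x - y))))" for \<xi>
    unfolding fourier_def
    by (rule Bochner_Integration.integral_sum[symmetric])
       (rule integrable_cis_mult, use integrable_tempered_gaussian[OF t2 a, of 0] in simp)
  also have "\<dots> \<xi> = fourier (\<lambda>x. - complex_of_real ((norm x)\<^sup>2) * gaussian a (x - y)) \<xi>" for \<xi>
    unfolding fourier_def
  proof (intro Bochner_Integration.integral_cong refl)
    fix x :: 'a
    have "complex_of_real ((norm x)\<^sup>2) = (\<Sum>i\<in>Basis. of_real (x \<bullet> i) * of_real (x \<bullet> i))"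
      unfolding power2_norm_eq_inner by (subst euclidean_inner) simp
    then show "(\<Sum>i\<in>Basis. cis (- (x \<bullet> \<xi>)) * ((- \<i> * of_real (x \<bullet> i) * (- \<i> * of_real (x \<bullet> i) * 1)) * gaussian a (x - y)))
       = cis (- (x \<bullet> \<xi>)) * (- complex_of_real ((norm x)\<^sup>2) * gaussian a (x - y))"
      by (simp add: sum_distrib_left sum_distrib_right sum_negf mult_ac)
  qed
  finally show ?thesis by (rule ext)
qed

subsection \<open>Square integrable functions\<close>

lemma L2_norm_nonneg [simp]: "L2_norm f \<ge> 0"
  by (simp add: L2_norm_def)

lemma L2_norm_square: "(L2_norm f)\<^sup>2 = (LINT x|lborel. (norm (f x))\<^sup>2)"
  by (simp add: L2_norm_def)

lemma in_L2_diff: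
  assumes "in_L2 f" "in_L2 g"
  shows "in_L2 (\<lambda>x. f x - g x)"
proof -
  have [measurable]: "f \<in> borel_measurable borel" "g \<in> borel_measurable borel"
    using assms by (simp_all add: in_L2_def)
  have "integrable lborel (\<lambda>x. (norm (f x - g x))\<^sup>2)"
  proof (rule Bochner_Integration.integrable_bound)
    show "integrable lborel (\<lambda>x. 2 * (norm (f x))\<^sup>2 + 2 * (norm (g x))\<^sup>2)"
      using assms by (simp add: in_L2_def)
    show "AE x in lborel. norm ((norm (f x - g x))\<^sup>2) \<le> norm (2 * (norm (f x))\<^sup>2 + 2 * (norm (g x))\<^sup>2)"
      using norm_sum_square_le[of "f _" "- g _"] by (intro AE_I2) simp
  qed measurable
  then show ?thesis by (simp add: in_L2_def)
qed

lemma integrable_L2_mult: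
  assumes "in_L2 f" "in_L2 g"
  shows "integrable lborel (\<lambda>x. f x * g x)"
proof (rule Bochner_Integration.integrable_bound)
  have [measurable]: "f \<in> borel_measurable borel" "g \<in> borel_measurable borel"
    using assms by (simp_all add: in_L2_def)
  show "integrable lborel (\<lambda>x. (norm (f x))\<^sup>2 + (norm (g x))\<^sup>2)"
    using assms by (simp add: in_L2_def)
  show "AE x in lborel. norm (f x * g x) \<le> norm ((norm (f x))\<^sup>2 + (norm (g x))\<^sup>2)"
  proof (rule AE_I2)
    fix x
    have "2 * (norm (f x) * norm (g x)) \<le> (norm (f x))\<^sup>2 + (norm (g x))\<^sup>2"
      using sum_squares_bound[of "norm (f x)" "norm (g x)"] by simp
    then show "norm (f x * g x) \<le> norm ((norm (f x))\<^sup>2 + (norm (g x))\<^sup>2)"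
      using mult_nonneg_nonneg[OF norm_ge_zero norm_ge_zero, of "f x" "g x"]
      unfolding norm_mult real_norm_def by linarith
  qed
  show "(\<lambda>x. f x * g x) \<in> borel_measurable lborel" by measurable
qed

text \<open>Read off from the quadratic inequality \<open>quad\<close>, valid for all s. The choice
  s = B / A balances its right-hand side; when A or B vanishes, a different s forces I \<le>
  0.\<close>

lemma L2_Cauchy_Schwarz:
  assumes f: "in_L2 f" and g: "in_L2 g"
  shows "norm (LINT x|lborel. f x * g x) \<le> L2_norm f * L2_norm g"
proof -
  define A B I where "A = L2_norm f" and "B = L2_norm g" and "I = (LINT x|lborel. norm (f x * g x))"
  have AB: "A \<ge> 0" "B \<ge> 0" by (simp_all add: A_def B_def)
  have quad: "2 * s * I \<le> s\<^sup>2 * A\<^sup>2 + B\<^sup>2" for s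
  proof -
    have "2 * s * I = (LINT x|lborel. 2 * s * norm (f x * g x))" by (simp add: I_def)
    also have "\<dots> \<le> (LINT x|lborel. s\<^sup>2 * (norm (f x))\<^sup>2 + (norm (g x))\<^sup>2)"
    proof (rule integral_mono)
      show "integrable lborel (\<lambda>x. 2 * s * norm (f x * g x))"
        by (intro integrable_mult_right integrable_norm integrable_L2_mult f g)
      show "integrable lborel (\<lambda>x. s\<^sup>2 * (norm (f x))\<^sup>2 + (norm (g x))\<^sup>2)"
        using f g by (simp add: in_L2_def)
      fix x show "2 * s * norm (f x * g x) \<le> s\<^sup>2 * (norm (f x))\<^sup>2 + (norm (g x))\<^sup>2"
        using sum_squares_bound[of "s * norm (f x)" "norm (g x)"] by (simp add: norm_mult power_mult_distrib mult.assoc)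
    qed
    also have "\<dots> = s\<^sup>2 * A\<^sup>2 + B\<^sup>2"
      using f g unfolding A_def B_def L2_norm_square by (simp add: in_L2_def)
    finally show ?thesis .
  qed
  have "I \<le> A * B"
  proof (cases "A = 0")
    case True
    have "I \<le> 0"
    proof (rule ccontr)
      assume "\<not> I \<le> 0"
      \<comment> \<open>For A = 0 this choice of s turns \<open>quad\<close> into B^2 + 1 \<le>
        B^2.\<close>
      with quad[of "(B\<^sup>2 + 1) / (2 * I)"] True show False by simp
    qed
    then show ?thesis using True by simp
  next
    case False
    then have A: "A > 0" using AB by simp
    have "2 * (B / A) * I \<le> 2 * B\<^sup>2" using quad[of "B / A"] A by (simp add: power_divide)
    then have *: "B * I \<le> B * (A * B)" using A by (simp add: field_simps power2_eq_square)
    show ?thesis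
    proof (cases "B = 0")
      case True
      have "I \<le> 0"
      proof (rule ccontr)
        assume I: "\<not> I \<le> 0"
        have "2 * (I / A\<^sup>2) * I \<le> (I / A\<^sup>2)\<^sup>2 * A\<^sup>2" using quad[of "I / A\<^sup>2"] True by simp
        then show False using A I by (simp add: power2_eq_square field_simps)
      qed
      then show ?thesis using True by simp
    next
      case False
      then show ?thesis using * AB by (simp add: mult_le_cancel_left_pos)
    qed
  qed
  then show ?thesis using integral_norm_bound[of lborel "\<lambda>x. f x * g x"] unfolding A_def B_def I_def by linarith
qed

lemma integrable_gaussian_decay: "gaussian_decay \<eta> \<Longrightarrow> integrable lborel \<eta>"
  and in_L2_gaussian_decay: "gaussian_decay \<eta> \<Longrightarrow> in_L2 \<eta>"
  for \<eta> :: "'a::euclidean_space \<Rightarrow> complex"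
proof -
  assume \<eta>: "gaussian_decay \<eta>"
  then obtain C c where c: "c > 0" "C \<ge> 0" and le: "\<And>x. norm (\<eta> x) \<le> C * gaussian c x"
    by (auto simp: gaussian_decay_def)
  note [measurable] = gaussian_decay_measurable[OF \<eta>]
  show "integrable lborel \<eta>"
    by (rule Bochner_Integration.integrable_bound[where f = "\<lambda>x. C * gaussian c x"])
       (use c le in \<open>auto simp: integrable_gaussian\<close>)
  have sq: "(norm (\<eta> x))\<^sup>2 \<le> C\<^sup>2 * gaussian (2 * c) x" for x
    using power_mono[OF le[of x], of 2] by (simp add: power2_eq_square gaussian_mult mult_ac flip: mult_2)
  have "integrable lborel (\<lambda>x. (norm (\<eta> x))\<^sup>2)"
  proof (rule Bochner_Integration.integrable_bound)
    show "integrable lborel (\<lambda>x::'a. C\<^sup>2 * gaussian (2 * c) x)" using c by (simp add: integrable_gaussian)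
    show "AE x in lborel. norm ((norm (\<eta> x))\<^sup>2) \<le> norm (C\<^sup>2 * gaussian (2 * c) x)"
      using sq by (intro AE_I2) simp
  qed measurable
  then show "in_L2 \<eta>" by (simp add: in_L2_def)
qed

lemma gaussian_decay_gaussian:
  assumes "c > 0"
  shows "gaussian_decay (\<lambda>x. complex_of_real (gaussian c x))"
proof -
  have "continuous_on UNIV (\<lambda>x. complex_of_real (gaussian c x))" by (intro continuous_intros)
  moreover have "\<forall>x. norm (complex_of_real (gaussian c x)) \<le> 1 * gaussian c x" by simp
  ultimately show ?thesis unfolding gaussian_decay_def using assms zero_le_one by blast
qed

lemma gaussian_integrable_L2:
  assumes "in_L2 f"
  shows "gaussian_integrable f"
  unfolding gaussian_integrable_def
proof (intro conjI allI impI)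
  show "f \<in> borel_measurable borel" using assms by (simp add: in_L2_def)
  fix c :: real assume "c > 0"
  then show "integrable lborel (\<lambda>x. f x * gaussian c x)"
    by (intro integrable_L2_mult assms in_L2_gaussian_decay gaussian_decay_gaussian)
qed

text \<open>Moving the centre costs a constant and half of the exponent: -a |x - y|^2 \<le> a |y|^2
  - (a / 2) |x|^2.\<close>

lemma gaussian_integrable_translate:
  fixes f :: "'a::euclidean_space \<Rightarrow> complex"
  assumes f: "gaussian_integrable f" and a: "a > 0"
  shows "integrable lborel (\<lambda>x. f x * gaussian a (x - y))"
proof (rule gaussian_integrable_mult_bounded[OF f])
  show "norm (complex_of_real (gaussian a (x - y))) \<le> exp (a * (norm y)\<^sup>2) * gaussian (a / 2) x" for x
  proof -
    have "a / 2 * (norm x)\<^sup>2 \<le> a / 2 * (2 * (norm (x - y))\<^sup>2 + 2 * (norm y)\<^sup>2)"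
      using norm_sum_square_le[of "x - y" y] a by (intro mult_left_mono) auto
    then show ?thesis by (simp add: gaussian_def exp_add[symmetric] algebra_simps)
  qed
qed (use a in auto)

lemma gaussian_integrable_diff:
  "gaussian_integrable f \<Longrightarrow> gaussian_integrable g \<Longrightarrow> gaussian_integrable (\<lambda>x. f x - g x)"
  unfolding gaussian_integrable_def left_diff_distrib
  by (intro conjI allI impI borel_measurable_diff Bochner_Integration.integrable_diff) blast+

subsection \<open>Uniqueness of Fourier transforms and the Plancherel inequality\<close>

lemma gaussian_integrable_fourier_transform:
  fixes g :: "'a::euclidean_space \<Rightarrow> complex"
  assumes "has_fourier_transform T g"
  shows "gaussian_integrable g"
  unfolding gaussian_integrable_def
proof (intro conjI allI impI)
  show "g \<in> borel_measurable borel" using assms by (simp add: has_fourier_transform_def)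
  fix c :: real assume "c > 0"
  then have "schwartz (\<lambda>x::'a. complex_of_real (gaussian c x))"
    using schwartz_gaussian[of c 0] by simp
  then show "integrable lborel (\<lambda>x. g x * gaussian c x)"
    using assms unfolding has_fourier_transform_def by blast
qed

text \<open>All mollifications of the difference vanish, so
  \<open>mollification_pairing_bound\<close> with M = 0 makes its pairing with every
  \<open>gaussian_decay\<close> function vanish.\<close>

lemma AE_eq_by_gaussian_pairing:
  fixes f g :: "'a::euclidean_space \<Rightarrow> complex"
  assumes f: "gaussian_integrable f" and g: "gaussian_integrable g"
    and eq: "\<And>a y. a > 0 \<Longrightarrow> (LINT x|lborel. f x * gaussian a (x - y)) = (LINT x|lborel. g x * gaussian a (x - y))"
  shows "AE x in lborel. f x = g x"
proof -
  have "AE x in lborel. f x - g x = 0"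
  proof (rule AE_eq_0_by_duality[OF gaussian_integrable_diff[OF f g]])
    fix \<eta> :: "'a \<Rightarrow> complex" assume \<eta>: "gaussian_decay \<eta>"
    have 0: "(LINT x|lborel. (f x - g x) * gaussian a (x - z)) = 0" if "a > 0" for a z
      unfolding left_diff_distrib
      by (subst Bochner_Integration.integral_diff[OF gaussian_integrable_translate[OF f that] gaussian_integrable_translate[OF g that]])
         (simp add: eq[OF that])
    have "norm (LINT x|lborel. (f x - g x) * \<eta> x) \<le> 0"
      by (rule mollification_pairing_bound[OF gaussian_integrable_diff[OF f g] \<eta>]) (simp add: 0)
    then show "(LINT x|lborel. (f x - g x) * \<eta> x) = 0" by simp
  qed
  then show ?thesis by eventually_elim simp
qed

text \<open>Translated Gaussians determine a transform, and both they and their own transforms are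
  Schwartz, which is why \<open>eq\<close> can be restricted to such tests. With T = S it identifies
  two versions of one transform.\<close>

lemma has_fourier_transform_unique:
  fixes g h :: "'a::euclidean_space \<Rightarrow> complex"
  assumes g: "has_fourier_transform T g" and h: "has_fourier_transform S h"
    and eq: "\<And>\<phi>. schwartz \<phi> \<Longrightarrow> schwartz (fourier \<phi>) \<Longrightarrow> T (fourier \<phi>) = S (fourier \<phi>)"
  shows "AE \<xi> in lborel. g \<xi> = h \<xi>"
proof (rule AE_eq_by_gaussian_pairing[OF gaussian_integrable_fourier_transform[OF g] gaussian_integrable_fourier_transform[OF h]])
  fix a :: real and y :: 'a assume a: "a > 0"
  have s: "schwartz (\<lambda>x. gaussian a (x - y))" by (rule schwartz_gaussian[OF a])
  from eq[OF s schwartz_fourier_gaussian[OF a]] g h s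
  show "(LINT x|lborel. g x * gaussian a (x - y)) = (LINT x|lborel. h x * gaussian a (x - y))"
    by (auto simp: has_fourier_transform_def)
qed

text \<open>By the multiplication formula the integral \<open>fourier f\<close> passes the same
  Gaussian tests as g, so the two agree almost everywhere and g inherits the uniform bound of the
  integral.\<close>

lemma fourier_transform_L1:
  fixes f g :: "'a::euclidean_space \<Rightarrow> complex"
  assumes f: "integrable lborel f" and g: "has_fourier_transform (dist_of f) g"
  shows "AE \<xi> in lborel. norm (g \<xi>) \<le> L1_norm f"
proof -
  have [measurable]: "f \<in> borel_measurable borel" using f by auto
  have gi: "gaussian_integrable (fourier f)"
    unfolding gaussian_integrable_def
  proof (intro conjI allI impI)
    fix c :: real assume "c > 0"
    then show "integrable lborel (\<lambda>x. fourier f x * gaussian c x)"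
      by (intro fourier_multiplication_formula(1)[OF f] integrable_of_real integrable_gaussian)
  qed measurable
  have "AE \<xi> in lborel. g \<xi> = fourier f \<xi>"
  proof (rule AE_eq_by_gaussian_pairing[OF gaussian_integrable_fourier_transform[OF g] gi])
    fix a :: real and y :: 'a assume a: "a > 0"
    have "(LINT x|lborel. g x * gaussian a (x - y)) = (LINT x|lborel. f x * fourier (\<lambda>x. gaussian a (x - y)) x)"
      using g schwartz_gaussian[OF a, of y] by (auto simp: has_fourier_transform_def dist_of_def)
    also have "\<dots> = (LINT x|lborel. fourier f x * gaussian a (x - y))"
      by (rule fourier_multiplication_formula(3)[OF f, symmetric])
         (intro integrable_of_real integrable_gaussian_translate a)
    finally show "(LINT x|lborel. g x * gaussian a (x - y)) = (LINT x|lborel. fourier f x * gaussian a (x - y))" .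
  qed
  then show ?thesis by eventually_elim (simp add: norm_fourier_le)
qed

text \<open>Schur's test: the product of moduli is at most half the sum of their squares, and in
  each half the kernel integrates to its mass. Nonnegative integrals keep the exchange of order free
  of integrability conditions.\<close>

lemma gaussian_double_integral_le:
  fixes \<eta> :: "'a::euclidean_space \<Rightarrow> complex"
  assumes [measurable]: "\<eta> \<in> borel_measurable borel" and a: "a > 0"
  shows "(\<integral>\<^sup>+x. \<integral>\<^sup>+y. ennreal (norm (\<eta> x) * norm (\<eta> y) * gaussian a (x - y)) \<partial>lborel \<partial>lborel)
       \<le> ennreal (sqrt (pi / a) ^ DIM('a)) * (\<integral>\<^sup>+x. ennreal ((norm (\<eta> x))\<^sup>2) \<partial>lborel)"
proof -
  let ?G = "ennreal (sqrt (pi / a) ^ DIM('a))" and ?I = "(\<integral>\<^sup>+x. ennreal ((norm (\<eta> x))\<^sup>2) \<partial>lborel)"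
  have G: "(\<integral>\<^sup>+y. ennreal (gaussian a (y - x)) \<partial>lborel) = ?G" for x :: 'a
    using a by (subst nn_integral_eq_integral) (auto simp: integrable_gaussian_translate)
  have sym: "gaussian a (x - y) = gaussian a (y - x)" for x y :: 'a
    by (simp add: gaussian_def norm_minus_commute)
  have "(\<integral>\<^sup>+x. \<integral>\<^sup>+y. ennreal (norm (\<eta> x) * norm (\<eta> y) * gaussian a (x - y)) \<partial>lborel \<partial>lborel)
     \<le> (\<integral>\<^sup>+x. \<integral>\<^sup>+y. ennreal ((norm (\<eta> x))\<^sup>2 / 2) * ennreal (gaussian a (y - x))
          + ennreal ((norm (\<eta> y))\<^sup>2 / 2) * ennreal (gaussian a (x - y)) \<partial>lborel \<partial>lborel)"
  proof (intro nn_integral_mono)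
    fix x y :: 'a
    have "norm (\<eta> x) * norm (\<eta> y) * gaussian a (x - y) \<le> ((norm (\<eta> x))\<^sup>2 / 2 + (norm (\<eta> y))\<^sup>2 / 2) * gaussian a (x - y)"
      using sum_squares_bound[of "norm (\<eta> x)" "norm (\<eta> y)"] by (intro mult_right_mono) auto
    then show "ennreal (norm (\<eta> x) * norm (\<eta> y) * gaussian a (x - y)) \<le>
        ennreal ((norm (\<eta> x))\<^sup>2 / 2) * ennreal (gaussian a (y - x)) + ennreal ((norm (\<eta> y))\<^sup>2 / 2) * ennreal (gaussian a (x - y))"
      by (simp add: sym[of y x] ennreal_mult[symmetric] ennreal_plus[symmetric] ennreal_leI distrib_right del: ennreal_plus)
  qed
  also have "\<dots> = (\<integral>\<^sup>+x. \<integral>\<^sup>+y. ennreal ((norm (\<eta> x))\<^sup>2 / 2) * ennreal (gaussian a (y - x)) \<partial>lborel \<partial>lborel)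
      + (\<integral>\<^sup>+x. \<integral>\<^sup>+y. ennreal ((norm (\<eta> y))\<^sup>2 / 2) * ennreal (gaussian a (x - y)) \<partial>lborel \<partial>lborel)"
    by (simp add: nn_integral_add)
  also have "(\<integral>\<^sup>+x. \<integral>\<^sup>+y. ennreal ((norm (\<eta> y))\<^sup>2 / 2) * ennreal (gaussian a (x - y)) \<partial>lborel \<partial>lborel)
      = (\<integral>\<^sup>+y. \<integral>\<^sup>+x. ennreal ((norm (\<eta> y))\<^sup>2 / 2) * ennreal (gaussian a (x - y)) \<partial>lborel \<partial>lborel)"
    by (rule lborel_pair.Fubini') measurable
  also have "(\<integral>\<^sup>+x. \<integral>\<^sup>+y. ennreal ((norm (\<eta> x))\<^sup>2 / 2) * ennreal (gaussian a (y - x)) \<partial>lborel \<partial>lborel) + \<dots>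
      = (\<integral>\<^sup>+x. ennreal ((norm (\<eta> x))\<^sup>2 / 2) * ?G \<partial>lborel) + (\<integral>\<^sup>+x. ennreal ((norm (\<eta> x))\<^sup>2 / 2) * ?G \<partial>lborel)"
    by (simp add: nn_integral_cmult G)
  also have "\<dots> = (\<integral>\<^sup>+x. ennreal ((norm (\<eta> x))\<^sup>2 / 2) * ?G + ennreal ((norm (\<eta> x))\<^sup>2 / 2) * ?G \<partial>lborel)"
    by (simp add: nn_integral_add)
  also have "\<dots> = (\<integral>\<^sup>+x. ?G * ennreal ((norm (\<eta> x))\<^sup>2) \<partial>lborel)"
  proof (intro nn_integral_cong)
    fix x
    have "ennreal ((norm (\<eta> x))\<^sup>2 / 2) + ennreal ((norm (\<eta> x))\<^sup>2 / 2) = ennreal ((norm (\<eta> x))\<^sup>2)"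
      by (subst ennreal_plus[symmetric]) auto
    with distrib_right[of "ennreal ((norm (\<eta> x))\<^sup>2 / 2)" "ennreal ((norm (\<eta> x))\<^sup>2 / 2)" ?G, symmetric]
    show "ennreal ((norm (\<eta> x))\<^sup>2 / 2) * ?G + ennreal ((norm (\<eta> x))\<^sup>2 / 2) * ?G = ?G * ennreal ((norm (\<eta> x))\<^sup>2)"
      by (metis mult.commute)
  qed
  also have "\<dots> = ?G * ?I" by (simp add: nn_integral_cmult)
  finally show ?thesis .
qed

text \<open>Damping the squared transform by a Gaussian of parameter \<epsilon> makes the
  multiplication formula applicable. The bound obtained does not depend on \<epsilon>, and Fatou's
  lemma removes the damping.\<close>

lemma Plancherel_inequality:
  fixes \<eta> :: "'a::euclidean_space \<Rightarrow> complex"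
  assumes \<eta>: "gaussian_decay \<eta>"
  shows "in_L2 (fourier \<eta>)" and "L2_norm (fourier \<eta>) \<le> sqrt (2 * pi) ^ DIM('a) * L2_norm \<eta>"
proof -
  note [measurable] = gaussian_decay_measurable[OF \<eta>]
  note int = integrable_gaussian_decay[OF \<eta>]
  let ?N = "sqrt (2 * pi) ^ DIM('a) * L2_norm \<eta>"
  have damped: "(\<integral>\<^sup>+\<xi>. ennreal ((norm (fourier \<eta> \<xi>))\<^sup>2 * gaussian \<epsilon> \<xi>) \<partial>lborel) \<le> ennreal (?N\<^sup>2)"
    if \<epsilon>: "\<epsilon> > 0" for \<epsilon>
  proof -
    let ?K = "sqrt (pi / \<epsilon>) ^ DIM('a)" and ?G = "gaussian (1 / (4 * \<epsilon>)) :: 'a \<Rightarrow> real"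
    \<comment> \<open>Chosen so that \<open>fourier \<eta> \<xi> * k \<xi>\<close> is the damped
      square. The multiplication formula then pairs \<open>\<eta>\<close> with the transform of k,
      which is bounded by a Gaussian average of |\<eta>|.\<close>
    define k where "k \<xi> = cnj (fourier \<eta> \<xi>) * gaussian \<epsilon> \<xi>" for \<xi>
    \<comment> \<open>Reflection and conjugation make the conjugate of the transform a transform
      itself, so the multiplication formula applies to it once more.\<close>
    define \<eta>' where "\<eta>' y = cnj (\<eta> (- y))" for y
    have [measurable]: "\<eta>' \<in> borel_measurable borel" unfolding \<eta>'_def by measurable
    have "integrable lborel (\<lambda>y. cnj (\<eta> (0 + (- 1) *\<^sub>R y)))"
      by (subst integral_lborel_affine) (use int in auto)
    then have int': "integrable lborel \<eta>'" by (simp add: \<eta>'_def[abs_def])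
    have F': "cnj (fourier \<eta> \<xi>) = fourier \<eta>' \<xi>" for \<xi>
    proof -
      have "cnj (fourier \<eta> \<xi>) = (LINT y|lborel. cis (y \<bullet> \<xi>) * cnj (\<eta> y))"
        unfolding fourier_def
        by (subst Bochner_Integration.integral_cnj[symmetric]) (simp add: cis_cnj)
      also have "\<dots> = (LINT y|lborel. cis ((0 + (- 1) *\<^sub>R y) \<bullet> \<xi>) * cnj (\<eta> (0 + (- 1) *\<^sub>R y)))"
        by (subst integral_lborel_affine(2)[of "\<lambda>y. cis (y \<bullet> \<xi>) * cnj (\<eta> y)" "- 1" 0]) simp_all
      finally show ?thesis by (simp add: fourier_def \<eta>'_def)
    qed
    have int_m: "integrable lborel (\<lambda>\<xi>::'a. cis ((- x) \<bullet> \<xi>) * gaussian \<epsilon> \<xi>)" for x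
      using integrable_cis_gaussian[OF \<epsilon>, of x] by (simp add: inner_commute)
    have int_k: "integrable lborel k"
      unfolding k_def F'
      by (intro fourier_multiplication_formula(1)[OF int'] integrable_of_real integrable_gaussian \<epsilon>)
    have k_le: "ennreal (norm (fourier k x)) \<le> ennreal ?K * (\<integral>\<^sup>+y. ennreal (norm (\<eta> y) * ?G (x - y)) \<partial>lborel)" for x
    proof -
      have "fourier k x = (LINT \<xi>|lborel. fourier \<eta>' \<xi> * (cis ((- x) \<bullet> \<xi>) * gaussian \<epsilon> \<xi>))"
        unfolding fourier_def[of k] k_def F' by (intro Bochner_Integration.integral_cong refl) (simp add: inner_commute mult_ac)
      also have "\<dots> = (LINT y|lborel. \<eta>' y * fourier (\<lambda>\<xi>. cis ((- x) \<bullet> \<xi>) * gaussian \<epsilon> \<xi>) y)"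
        by (rule fourier_multiplication_formula(3)[OF int' int_m])
      also have "\<dots> = (LINT y|lborel. \<eta>' y * (?K * ?G (y + x)))"
        by (subst fourier_gaussian_modulated[OF \<epsilon>]) simp
      finally have "fourier k x = \<dots>" .
      moreover have "integrable lborel (\<lambda>y. \<eta>' y * (?K * ?G (y + x)))"
        using fourier_multiplication_formula(2)[OF int' int_m[of x]]
        by (subst (asm) fourier_gaussian_modulated[OF \<epsilon>]) simp
      ultimately have "ennreal (norm (fourier k x)) \<le> (\<integral>\<^sup>+y. ennreal (norm (\<eta>' y * (?K * ?G (y + x)))) \<partial>lborel)"
        using integral_norm_bound_ennreal by metis
      also have "\<dots> = (\<integral>\<^sup>+y. ennreal ?K * ennreal (norm (\<eta> (- y)) * ?G (x - (- y))) \<partial>lborel)"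
        using \<epsilon> by (intro nn_integral_cong) (simp add: \<eta>'_def norm_mult norm_power ennreal_mult[symmetric] add.commute mult_ac)
      also have "\<dots> = ennreal ?K * (\<integral>\<^sup>+y. ennreal (norm (\<eta> (- y)) * ?G (x - (- y))) \<partial>lborel)"
        by (rule nn_integral_cmult) measurable
      also have "(\<integral>\<^sup>+y. ennreal (norm (\<eta> (- y)) * ?G (x - (- y))) \<partial>lborel) = (\<integral>\<^sup>+y. ennreal (norm (\<eta> y) * ?G (x - y)) \<partial>lborel)"
      proof -
        have "(lborel :: 'a measure) = distr lborel borel (\<lambda>x. - x)"
          using lborel_affine[of "- 1" "0::'a"] by (simp add: density_1)
        then have "(\<integral>\<^sup>+y. ennreal (norm (\<eta> y) * ?G (x - y)) \<partial>lborel) = (\<integral>\<^sup>+y. ennreal (norm (\<eta> y) * ?G (x - y)) \<partial>distr lborel borel (\<lambda>x::'a. - x))"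
          by simp
        then show ?thesis by (subst (asm) nn_integral_distr) auto
      qed
      finally show ?thesis .
    qed
    have eq: "fourier \<eta> \<xi> * k \<xi> = complex_of_real ((norm (fourier \<eta> \<xi>))\<^sup>2 * gaussian \<epsilon> \<xi>)" for \<xi>
      unfolding k_def using complex_norm_square[of "fourier \<eta> \<xi>"] by simp
    have "(\<integral>\<^sup>+\<xi>. ennreal ((norm (fourier \<eta> \<xi>))\<^sup>2 * gaussian \<epsilon> \<xi>) \<partial>lborel) = ennreal (LINT \<xi>|lborel. (norm (fourier \<eta> \<xi>))\<^sup>2 * gaussian \<epsilon> \<xi>)"
      using fourier_multiplication_formula(1)[OF int int_k] unfolding eq complex_of_real_integrable_eq
      by (intro nn_integral_eq_integral) auto
    also have "\<dots> \<le> ennreal (norm (LINT \<xi>|lborel. fourier \<eta> \<xi> * k \<xi>))"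
      unfolding eq integral_complex_of_real by (intro ennreal_leI) simp
    also have "\<dots> = ennreal (norm (LINT x|lborel. \<eta> x * fourier k x))"
      using fourier_multiplication_formula(3)[OF int int_k] by simp
    also have "\<dots> \<le> (\<integral>\<^sup>+x. ennreal (norm (\<eta> x * fourier k x)) \<partial>lborel)"
      by (rule integral_norm_bound_ennreal[OF fourier_multiplication_formula(2)[OF int int_k]])
    also have "\<dots> \<le> (\<integral>\<^sup>+x. ennreal ?K * (\<integral>\<^sup>+y. ennreal (norm (\<eta> x) * norm (\<eta> y) * ?G (x - y)) \<partial>lborel) \<partial>lborel)"
    proof (rule nn_integral_mono)
      fix x
      have "ennreal (norm (\<eta> x * fourier k x)) \<le> ennreal (norm (\<eta> x)) * (ennreal ?K * (\<integral>\<^sup>+y. ennreal (norm (\<eta> y) * ?G (x - y)) \<partial>lborel))"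
        using mult_left_mono[OF k_le[of x], of "ennreal (norm (\<eta> x))"] by (simp add: norm_mult ennreal_mult)
      also have "\<dots> = ennreal ?K * (ennreal (norm (\<eta> x)) * (\<integral>\<^sup>+y. ennreal (norm (\<eta> y) * ?G (x - y)) \<partial>lborel))"
        by (rule mult.left_commute)
      also have "ennreal (norm (\<eta> x)) * (\<integral>\<^sup>+y. ennreal (norm (\<eta> y) * ?G (x - y)) \<partial>lborel)
          = (\<integral>\<^sup>+y. ennreal (norm (\<eta> x)) * ennreal (norm (\<eta> y) * ?G (x - y)) \<partial>lborel)"
        by (rule nn_integral_cmult[symmetric]) measurable
      finally show "ennreal (norm (\<eta> x * fourier k x)) \<le> ennreal ?K * (\<integral>\<^sup>+y. ennreal (norm (\<eta> x) * norm (\<eta> y) * ?G (x - y)) \<partial>lborel)"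
        by (simp add: ennreal_mult[symmetric] mult.assoc)
    qed
    also have "\<dots> = ennreal ?K * (\<integral>\<^sup>+x. (\<integral>\<^sup>+y. ennreal (norm (\<eta> x) * norm (\<eta> y) * ?G (x - y)) \<partial>lborel) \<partial>lborel)"
      by (rule nn_integral_cmult) measurable
    also have "\<dots> \<le> ennreal ?K * (ennreal (sqrt (pi / (1 / (4 * \<epsilon>))) ^ DIM('a)) * (\<integral>\<^sup>+x. ennreal ((norm (\<eta> x))\<^sup>2) \<partial>lborel))"
      using \<epsilon> by (intro mult_left_mono gaussian_double_integral_le) auto
    also have "(\<integral>\<^sup>+x. ennreal ((norm (\<eta> x))\<^sup>2) \<partial>lborel) = ennreal ((L2_norm \<eta>)\<^sup>2)"
      using in_L2_gaussian_decay[OF \<eta>] unfolding L2_norm_square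
      by (intro nn_integral_eq_integral) (auto simp: in_L2_def)
    also have "ennreal ?K * (ennreal (sqrt (pi / (1 / (4 * \<epsilon>))) ^ DIM('a)) * ennreal ((L2_norm \<eta>)\<^sup>2)) =
        ennreal (?K * sqrt (pi / (1 / (4 * \<epsilon>))) ^ DIM('a) * (L2_norm \<eta>)\<^sup>2)"
      using \<epsilon> by (simp add: ennreal_mult[symmetric] mult.assoc)
    \<comment> \<open>The masses (pi / \<epsilon>)^(n/2) and (4 pi \<epsilon>)^(n/2) multiply to (2
      pi)^n; here \<epsilon> drops out.\<close>
    also have "?K * sqrt (pi / (1 / (4 * \<epsilon>))) ^ DIM('a) * (L2_norm \<eta>)\<^sup>2 = ?N\<^sup>2"
    proof -
      have "sqrt (pi / \<epsilon>) * sqrt (pi / (1 / (4 * \<epsilon>))) = (sqrt (2 * pi))\<^sup>2"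
        using \<epsilon> by (simp add: real_sqrt_mult[symmetric] real_sqrt_unique power2_eq_square)
      then have "?K * sqrt (pi / (1 / (4 * \<epsilon>))) ^ DIM('a) = ((sqrt (2 * pi))\<^sup>2) ^ DIM('a)"
        by (simp only: power_mult_distrib[symmetric])
      also have "\<dots> = (sqrt (2 * pi) ^ DIM('a))\<^sup>2" by (metis power_mult mult.commute)
      finally show ?thesis by (simp only: power_mult_distrib)
    qed
    finally show ?thesis .
  qed
  define \<epsilon> where "\<epsilon> m = 1 / real (Suc m)" for m
  have "(\<integral>\<^sup>+\<xi>. ennreal ((norm (fourier \<eta> \<xi>))\<^sup>2) \<partial>lborel) = (\<integral>\<^sup>+\<xi>. liminf (\<lambda>m. ennreal ((norm (fourier \<eta> \<xi>))\<^sup>2 * gaussian (\<epsilon> m) \<xi>)) \<partial>lborel)"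
  proof (intro nn_integral_cong)
    fix \<xi> :: 'a
    have "(\<lambda>m. (norm (fourier \<eta> \<xi>))\<^sup>2 * gaussian (\<epsilon> m) \<xi>) \<longlonglongrightarrow> (norm (fourier \<eta> \<xi>))\<^sup>2 * exp (- (0 * (norm \<xi>)\<^sup>2))"
      unfolding gaussian_def \<epsilon>_def using LIMSEQ_inverse_real_of_nat by (intro tendsto_intros) (simp add: inverse_eq_divide)
    then have "(\<lambda>m. ennreal ((norm (fourier \<eta> \<xi>))\<^sup>2 * gaussian (\<epsilon> m) \<xi>)) \<longlonglongrightarrow> ennreal ((norm (fourier \<eta> \<xi>))\<^sup>2)"
      by (intro tendsto_ennrealI) simp
    then show "ennreal ((norm (fourier \<eta> \<xi>))\<^sup>2) = liminf (\<lambda>m. ennreal ((norm (fourier \<eta> \<xi>))\<^sup>2 * gaussian (\<epsilon> m) \<xi>))"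
      using lim_imp_Liminf[OF trivial_limit_sequentially] by metis
  qed
  also have "\<dots> \<le> liminf (\<lambda>m. \<integral>\<^sup>+\<xi>. ennreal ((norm (fourier \<eta> \<xi>))\<^sup>2 * gaussian (\<epsilon> m) \<xi>) \<partial>lborel)"
    by (rule nn_integral_liminf) measurable
  also have "\<dots> \<le> liminf (\<lambda>m::nat. ennreal (?N\<^sup>2))"
    by (intro Liminf_mono always_eventually allI damped) (simp add: \<epsilon>_def)
  also have "\<dots> = ennreal (?N\<^sup>2)" by (simp add: Liminf_const)
  finally have fin: "(\<integral>\<^sup>+\<xi>. ennreal ((norm (fourier \<eta> \<xi>))\<^sup>2) \<partial>lborel) \<le> ennreal (?N\<^sup>2)" .
  then have i: "integrable lborel (\<lambda>\<xi>. (norm (fourier \<eta> \<xi>))\<^sup>2)"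
    by (intro integrableI_bounded) (auto simp: less_top[symmetric] top_unique)
  then show "in_L2 (fourier \<eta>)" by (simp add: in_L2_def)
  have "(LINT \<xi>|lborel. (norm (fourier \<eta> \<xi>))\<^sup>2) \<le> ?N\<^sup>2"
    using fin by (simp add: nn_integral_eq_integral[OF i])
  then show "L2_norm (fourier \<eta>) \<le> ?N"
    unfolding L2_norm_def[of "fourier \<eta>"] by (intro real_le_lsqrt) auto
qed

text \<open>Dual to \<open>Plancherel_inequality\<close>: up to a constant, a mollification of f is
  the transform of g times a Gaussian. Paired with a test function, that transform moves to the test
  function, where Cauchy-Schwarz and the inequality already proved apply.\<close>

lemma L2_norm_le_fourier_transform:
  fixes f g :: "'a::euclidean_space \<Rightarrow> complex"
  assumes f: "in_L2 f" and g2: "in_L2 g"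
    and g: "\<And>a z. a > 0 \<Longrightarrow> dist_of f (fourier (\<lambda>\<xi>. cis (z \<bullet> \<xi>) * gaussian a \<xi>)) =
      (LINT \<xi>|lborel. g \<xi> * (cis (z \<bullet> \<xi>) * gaussian a \<xi>))"
  shows "L2_norm f \<le> L2_norm g / sqrt (2 * pi) ^ DIM('a)"
proof -
  let ?M = "L2_norm g / sqrt (2 * pi) ^ DIM('a)"
  have [measurable]: "f \<in> borel_measurable borel" "g \<in> borel_measurable borel"
    using f g2 by (simp_all add: in_L2_def)
  note gf = gaussian_integrable_L2[OF f]
  have "in_L2 f \<and> L2_norm f \<le> ?M"
  proof (rule L2_norm_le_by_duality[OF gf], simp)
    fix \<eta> :: "'a \<Rightarrow> complex" assume \<eta>: "gaussian_decay \<eta>"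
    note [measurable] = gaussian_decay_measurable[OF \<eta>]
    \<comment> \<open>The mollification at z is a transform evaluated at -z; the reflection
      compensates for this sign.\<close>
    define \<eta>' where "\<eta>' z = \<eta> (- z)" for z
    have \<eta>': "gaussian_decay \<eta>'"
    proof -
      have "continuous_on UNIV (\<lambda>z. \<eta> (- z))"
        using \<eta> unfolding gaussian_decay_def
        by (intro continuous_on_compose2[of UNIV \<eta> UNIV uminus] continuous_intros) auto
      moreover obtain C c where "C \<ge> 0" "c > 0" "\<And>x. norm (\<eta> x) \<le> C * gaussian c x"
        using \<eta> by (auto simp: gaussian_decay_def)
      then have "\<exists>C\<ge>0. \<exists>c>0. \<forall>x. norm (\<eta> (- x)) \<le> C * gaussian c x"
        by (metis gaussian_minus)
      ultimately show ?thesis by (simp add: gaussian_decay_def \<eta>'_def[abs_def])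
    qed
    show "norm (LINT x|lborel. f x * \<eta> x) \<le> ?M * L2_norm \<eta>"
    proof (rule mollification_pairing_bound[OF gf \<eta>])
      fix h :: real assume h: "h > 0"
      \<comment> \<open>Then 1 / (4 a) = 1 / h^2, so the transform of the modulated Gaussian is the
        mollifier of width h.\<close>
      define a where "a = h\<^sup>2 / 4"
      have a: "a > 0" using h by (simp add: a_def)
      define g' where "g' \<xi> = g \<xi> * gaussian a \<xi>" for \<xi>
      have g': "integrable lborel g'"
        using gaussian_integrable_L2[OF g2] a by (simp add: gaussian_integrable_def g'_def[abs_def])
      define K where "K = sqrt (pi / a) ^ DIM('a)"
      have K: "K > 0" using a by (simp add: K_def)
      have inner: "of_real K * (LINT x|lborel. f x * gaussian (1 / h\<^sup>2) (x - z)) = fourier g' (- z)" for z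
      proof -
        have "of_real K * (LINT x|lborel. f x * gaussian (1 / h\<^sup>2) (x - z)) = (LINT x|lborel. of_real K * (f x * gaussian (1 / h\<^sup>2) (x - z)))"
          by simp
        also have "\<dots> = dist_of f (fourier (\<lambda>\<xi>. cis (z \<bullet> \<xi>) * gaussian a \<xi>))"
          unfolding dist_of_def
          by (intro Bochner_Integration.integral_cong refl, subst fourier_gaussian_modulated[OF a])
             (simp add: K_def a_def mult_ac)
        also have "\<dots> = (LINT \<xi>|lborel. g \<xi> * (cis (z \<bullet> \<xi>) * gaussian a \<xi>))"
          by (rule g[OF a])
        also have "\<dots> = fourier g' (- z)"
          unfolding fourier_def g'_def
          by (intro Bochner_Integration.integral_cong refl) (simp add: inner_commute mult_ac)
        finally show ?thesis .
      qed
      have "K * norm (LINT z|lborel. (LINT x|lborel. f x * gaussian (1 / h\<^sup>2) (x - z)) * \<eta> z)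
          = norm (of_real K * (LINT z|lborel. (LINT x|lborel. f x * gaussian (1 / h\<^sup>2) (x - z)) * \<eta> z))"
        using K by (simp add: norm_mult)
      also have "of_real K * (LINT z|lborel. (LINT x|lborel. f x * gaussian (1 / h\<^sup>2) (x - z)) * \<eta> z)
          = (LINT z|lborel. fourier g' (- z) * \<eta> z)"
        by (subst integral_mult_right_zero[symmetric]) (simp add: inner[symmetric] mult.assoc)
      also have "\<dots> = (LINT z|lborel. fourier g' (0 + (- 1) *\<^sub>R z) * \<eta>' (0 + (- 1) *\<^sub>R z))"
        by (simp add: \<eta>'_def)
      also have "\<dots> = (LINT z|lborel. fourier g' z * \<eta>' z)"
        by (subst integral_lborel_affine(2)[of "\<lambda>z. fourier g' z * \<eta>' z"])
           (use gaussian_decay_measurable[OF \<eta>'] g' in auto)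
      also have "\<dots> = (LINT \<xi>|lborel. g' \<xi> * fourier \<eta>' \<xi>)"
        by (rule fourier_multiplication_formula(3)[OF g' integrable_gaussian_decay[OF \<eta>']])
      also have "norm \<dots> \<le> L2_norm g' * L2_norm (fourier \<eta>')"
      proof (rule L2_Cauchy_Schwarz[OF _ Plancherel_inequality(1)[OF \<eta>']])
        show "in_L2 g'" unfolding in_L2_def
        proof
          show "integrable lborel (\<lambda>x. (norm (g' x))\<^sup>2)"
            by (rule Bochner_Integration.integrable_bound[where f = "\<lambda>x. (norm (g x))\<^sup>2"])
               (use g2 a in \<open>auto simp: in_L2_def g'_def norm_mult intro!: AE_I2 mult_left_le gaussian_le_1\<close>)
        qed (use g' in auto)
      qed
      also have "\<dots> \<le> L2_norm g * (sqrt (2 * pi) ^ DIM('a) * L2_norm \<eta>)"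
      proof (intro mult_mono)
        show "L2_norm g' \<le> L2_norm g" unfolding L2_norm_def
          by (intro real_sqrt_le_mono integral_mono')
             (use g2 a in \<open>auto simp: in_L2_def g'_def norm_mult intro!: power_mono mult_left_le gaussian_le_1\<close>)
        have "L2_norm \<eta>' = L2_norm \<eta>"
          using integral_lborel_affine(2)[of "\<lambda>x. (norm (\<eta> x))\<^sup>2" "- 1" 0]
          by (simp add: L2_norm_def \<eta>'_def)
        then show "L2_norm (fourier \<eta>') \<le> sqrt (2 * pi) ^ DIM('a) * L2_norm \<eta>"
          using Plancherel_inequality(2)[OF \<eta>'] by simp
      qed auto
      also have "\<dots> = K * ((sqrt pi * h) ^ DIM('a) * (?M * L2_norm \<eta>))"
      proof -
        \<comment> \<open>Both sides equal 2 pi, since sqrt (pi / a) = 2 sqrt pi / h.\<close>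
        have "sqrt (2 * pi) * sqrt (2 * pi) = sqrt (pi / a) * (sqrt pi * h)"
          using h by (simp add: a_def real_sqrt_divide real_sqrt_mult)
        then have "sqrt (2 * pi) ^ DIM('a) * sqrt (2 * pi) ^ DIM('a) = K * (sqrt pi * h) ^ DIM('a)"
          by (simp only: K_def power_mult_distrib[symmetric])
        then show ?thesis by (simp add: field_simps)
      qed
      finally show "norm (LINT z|lborel. (LINT x|lborel. f x * gaussian (1 / h\<^sup>2) (x - z)) * \<eta> z)
          \<le> (sqrt pi * h) ^ DIM('a) * (?M * L2_norm \<eta>)"
        using K by (simp only: mult_le_cancel_left_pos)
    qed
  qed
  then show ?thesis by simp
qed

subsection \<open>Low frequencies\<close>

lemma ln_exp_1_add_ge_1:
  fixes t :: real
  assumes "t \<ge> 0"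
  shows "ln (exp 1 + t) \<ge> 1"
proof -
  have "ln (exp 1) \<le> ln (exp 1 + t)"
    using assms by (subst ln_le_cancel_iff) (auto intro: add_pos_nonneg)
  then show ?thesis by simp
qed

text \<open>Allows the contributions that are bounded in time to be absorbed into the growth
  factor.\<close>

lemma growth_G1_ge_1: "t \<ge> 0 \<Longrightarrow> growth_G1 n (1 + t) \<ge> 1"
  using ln_exp_1_add_ge_1[of t] by (auto simp: growth_G1_def intro!: ge_one_powr_ge_zero)

lemma growth_G1_square:
  assumes "t \<ge> 0"
  shows "(growth_G1 n (1 + t))\<^sup>2 = (if n = 1 then sqrt (1 + t) else if n = 2 then ln (exp 1 + t) else 1)"
proof -
  have "ln (exp 1 + t) \<ge> 0" using ln_exp_1_add_ge_1[OF assms] by linarith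
  then show ?thesis using assms
    by (auto simp: growth_G1_def powr_half_sqrt powr_power power2_eq_square powr_add[symmetric])
qed

text \<open>Origin of the three rates: the antiderivatives are 2 sqrt (1 + s), ln (1 + s) and, for n
  = 3, -2 / sqrt (1 + s), while larger n is dominated by n = 3. The factor 2 stems from the first
  and the last of these.\<close>

lemma decay_integral_le_growth_G1:
  assumes n: "n \<ge> 1" and t: "t \<ge> 0"
  shows "(\<integral>\<^sup>+s. ennreal ((1 / sqrt (1 + s)) ^ n) * indicator {0..t} s \<partial>lborel)
       \<le> ennreal (2 * (growth_G1 n (1 + t))\<^sup>2)"
proof -
  consider "n = 1" | "n = 2" | "n \<ge> 3" using n by linarith
  then show ?thesis
  proof cases
    case 1
    have "(\<integral>\<^sup>+s. ennreal (1 / sqrt (1 + s)) * indicator {0..t} s \<partial>lborel) = ennreal (2 * sqrt (1 + t) - 2 * sqrt (1 + 0))"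
      by (rule nn_integral_FTC_Icc)
         (use t in \<open>auto intro!: derivative_eq_intros simp: field_simps\<close>)
    also have "\<dots> \<le> ennreal (2 * sqrt (1 + t))" by (intro ennreal_leI) simp
    finally show ?thesis using 1 growth_G1_square[OF t, of n] by simp
  next
    case 2
    have "(\<integral>\<^sup>+s. ennreal ((1 / sqrt (1 + s)) ^ 2) * indicator {0..t} s \<partial>lborel)
        = (\<integral>\<^sup>+s. ennreal (1 / (1 + s)) * indicator {0..t} s \<partial>lborel)"
      by (intro nn_integral_cong) (auto simp: power_divide split: split_indicator)
    also have "\<dots> = ennreal (ln (1 + t) - ln (1 + 0))"
      by (rule nn_integral_FTC_Icc)
         (use t in \<open>auto intro!: derivative_eq_intros\<close>)
    also have "\<dots> \<le> ennreal (2 * ln (exp 1 + t))"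
    proof (rule ennreal_leI)
      have "ln (1 + t) \<le> ln (exp 1 + t)" using t one_le_exp_iff[of 1] by (subst ln_le_cancel_iff) linarith+
      moreover have "0 \<le> ln (exp 1 + t)" using ln_exp_1_add_ge_1[OF t] by linarith
      ultimately show "ln (1 + t) - ln (1 + 0) \<le> 2 * ln (exp 1 + t)" by simp
    qed
    finally show ?thesis using 2 growth_G1_square[OF t, of n] by simp
  next
    case 3
    have "(\<integral>\<^sup>+s. ennreal ((1 / sqrt (1 + s)) ^ n) * indicator {0..t} s \<partial>lborel)
        \<le> (\<integral>\<^sup>+s. ennreal ((1 / sqrt (1 + s)) ^ 3) * indicator {0..t} s \<partial>lborel)"
      using 3 by (intro nn_integral_mono) (auto intro!: ennreal_leI power_decreasing split: split_indicator)
    also have "\<dots> = ennreal (- 2 / sqrt (1 + t) - (- 2 / sqrt (1 + 0)))"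
      by (rule nn_integral_FTC_Icc)
         (use t in \<open>auto intro!: derivative_eq_intros simp: field_simps power3_eq_cube\<close>)
    also have "\<dots> \<le> ennreal 2" using t by (intro ennreal_leI) simp
    finally show ?thesis using 3 growth_G1_square[OF t, of n] by simp
  qed
qed

text \<open>With \<open>r = |\<xi>|\<close>, the multiplier \<open>min t (1/r\<^sup>2)\<close> is comparable to the integral of
  \<open>exp (-r\<^sup>2 s)\<close> over \<open>0 \<le> s \<le> t\<close>. Integrating the Gaussian in \<open>\<xi>\<close> first leaves
  the integral of \<open>(1+s)\<close> to the power \<open>-n/2\<close>.\<close>

lemma low_frequency_multiplier_le:
  assumes r: "r > 0" and t: "t \<ge> 0"
  shows "ennreal (min t (1 / r\<^sup>2)) \<le> 2 * (\<integral>\<^sup>+s. ennreal (exp (- (r\<^sup>2 * s))) * indicator {0..t} s \<partial>lborel)"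
proof -
  have "(\<integral>\<^sup>+s. ennreal (exp (- (r\<^sup>2 * s))) * indicator {0..t} s \<partial>lborel)
      = ennreal (- exp (- (r\<^sup>2 * t)) / r\<^sup>2 - (- exp (- (r\<^sup>2 * 0)) / r\<^sup>2))"
    by (rule nn_integral_FTC_Icc)
       (use r t in \<open>auto intro!: derivative_eq_intros simp: power2_eq_square power4_eq_xxxx\<close>)
  also have "- exp (- (r\<^sup>2 * t)) / r\<^sup>2 - (- exp (- (r\<^sup>2 * 0)) / r\<^sup>2) = (1 - exp (- (r\<^sup>2 * t))) / r\<^sup>2"
    by (simp add: diff_divide_distrib)
  finally have I: "(\<integral>\<^sup>+s. ennreal (exp (- (r\<^sup>2 * s))) * indicator {0..t} s \<partial>lborel) = ennreal \<dots>" .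
  \<comment> \<open>In this variable min x 1 / 2 \<le> x / (1 + x) \<le> 1 - exp (-x), which is
    where the factor 2 of the claim comes from.\<close>
  define x where "x = r\<^sup>2 * t"
  have x: "x \<ge> 0" using t by (simp add: x_def)
  have "exp (- x) \<le> 1 / (1 + x)"
    using exp_ge_add_one_self[of x] x by (simp add: exp_minus inverse_eq_divide frac_le)
  then have le1: "x / (1 + x) \<le> 1 - exp (- x)" using x by (simp add: field_simps)
  have le2: "min x 1 \<le> 2 * (x / (1 + x))"
    using x mult_left_le[of x x] by (cases "x \<le> 1") (auto simp: min_def field_simps)
  have "min x 1 \<le> 2 * (1 - exp (- x))" using order_trans[OF le2 mult_left_mono[OF le1]] by simp
  moreover have "min t (1 / r\<^sup>2) = min x 1 / r\<^sup>2" using r by (auto simp: min_def x_def field_simps)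
  ultimately have "min t (1 / r\<^sup>2) \<le> 2 * ((1 - exp (- (r\<^sup>2 * t))) / r\<^sup>2)"
    using r by (simp add: x_def divide_right_mono)
  then have "ennreal (min t (1 / r\<^sup>2)) \<le> ennreal (2 * ((1 - exp (- (r\<^sup>2 * t))) / r\<^sup>2))"
    by (rule ennreal_leI)
  also have "\<dots> = ennreal 2 * ennreal ((1 - exp (- (r\<^sup>2 * t))) / r\<^sup>2)"
    using t by (intro ennreal_mult) auto
  finally show ?thesis unfolding I by simp
qed

text \<open>On the unit ball exp (-r^2 s) \<le> e exp (-(1 + s) r^2). The shift by 1 keeps the
  Gaussian integrable over the whole space down to s = 0. The constant collects 2 from the
  multiplier, e from the shift and 2 from the time integral.\<close>

lemma low_frequency_integral_le:
  assumes t: "t \<ge> 0"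
  shows "(\<integral>\<^sup>+\<xi>. ennreal (min t (1 / (norm \<xi>)\<^sup>2)) * indicator (cball 0 1) (\<xi> :: 'a::euclidean_space) \<partial>lborel)
       \<le> ennreal (4 * exp 1 * sqrt pi ^ DIM('a) * (growth_G1 DIM('a) (1 + t))\<^sup>2)"
proof -
  let ?f = "\<lambda>\<xi>::'a. \<lambda>s. ennreal (gaussian (1 + s) \<xi>) * indicator {0..t} s"
  have [measurable]: "(\<lambda>(\<xi>, s). ?f \<xi> s) \<in> borel_measurable (lborel \<Otimes>\<^sub>M lborel)"
    unfolding gaussian_def by measurable
  have "(\<integral>\<^sup>+\<xi>. ennreal (min t (1 / (norm \<xi>)\<^sup>2)) * indicator (cball 0 1) (\<xi> :: 'a) \<partial>lborel)
      \<le> (\<integral>\<^sup>+\<xi>. ennreal (2 * exp 1) * (\<integral>\<^sup>+s. ?f \<xi> s \<partial>lborel) \<partial>lborel)"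
  proof (rule nn_integral_mono_AE)
    show "AE \<xi> in lborel. ennreal (min t (1 / (norm \<xi>)\<^sup>2)) * indicator (cball 0 1) (\<xi> :: 'a)
        \<le> ennreal (2 * exp 1) * (\<integral>\<^sup>+s. ?f \<xi> s \<partial>lborel)"
      using AE_lborel_singleton[of 0]
    proof eventually_elim
      case (elim \<xi>)
      show ?case
      proof (cases "\<xi> \<in> cball 0 1")
        case True
        then have n1: "(norm \<xi>)\<^sup>2 \<le> 1" by (simp add: power_le_one)
        have "ennreal (min t (1 / (norm \<xi>)\<^sup>2)) \<le> 2 * (\<integral>\<^sup>+s. ennreal (exp (- ((norm \<xi>)\<^sup>2 * s))) * indicator {0..t} s \<partial>lborel)"
          using elim t by (intro low_frequency_multiplier_le) auto
        also have "\<dots> \<le> 2 * (\<integral>\<^sup>+s. ennreal (exp 1) * ?f \<xi> s \<partial>lborel)"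
        proof (intro mult_left_mono nn_integral_mono)
          fix s
          have "exp (- ((norm \<xi>)\<^sup>2 * s)) \<le> exp 1 * gaussian (1 + s) \<xi>"
            using n1 by (simp add: gaussian_def exp_add[symmetric] algebra_simps)
          then show "ennreal (exp (- ((norm \<xi>)\<^sup>2 * s))) * indicator {0..t} s \<le> ennreal (exp 1) * ?f \<xi> s"
            by (auto simp: ennreal_mult[symmetric] intro!: ennreal_leI split: split_indicator)
        qed simp
        also have "\<dots> = 2 * (ennreal (exp 1) * (\<integral>\<^sup>+s. ?f \<xi> s \<partial>lborel))"
          by (subst nn_integral_cmult) (simp_all add: gaussian_def)
        finally show ?thesis using True by (simp add: ennreal_mult mult.assoc)
      qed simp
    qed
  qed
  also have "\<dots> = ennreal (2 * exp 1) * (\<integral>\<^sup>+\<xi>. (\<integral>\<^sup>+s. ?f \<xi> s \<partial>lborel) \<partial>lborel)"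
    by (rule nn_integral_cmult) measurable
  also have "(\<integral>\<^sup>+\<xi>. (\<integral>\<^sup>+s. ?f \<xi> s \<partial>lborel) \<partial>lborel) = (\<integral>\<^sup>+s. (\<integral>\<^sup>+\<xi>. ?f \<xi> s \<partial>lborel) \<partial>lborel)"
    by (rule lborel_pair.Fubini'[symmetric]) measurable
  also have "\<dots> = (\<integral>\<^sup>+s. ennreal (sqrt pi ^ DIM('a)) * (ennreal ((1 / sqrt (1 + s)) ^ DIM('a)) * indicator {0..t} s) \<partial>lborel)"
  proof (rule nn_integral_cong)
    fix s :: real
    show "(\<integral>\<^sup>+\<xi>. ?f \<xi> s \<partial>lborel) = ennreal (sqrt pi ^ DIM('a)) * (ennreal ((1 / sqrt (1 + s)) ^ DIM('a)) * indicator {0..t} s)"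
    proof (cases "s \<in> {0..t}")
      case True
      then have "(\<integral>\<^sup>+\<xi>. ?f \<xi> s \<partial>lborel) = ennreal (LINT \<xi>|lborel. gaussian (1 + s) (\<xi>::'a))"
        by (subst nn_integral_eq_integral[symmetric]) (auto intro!: integrable_gaussian)
      also have "\<dots> = ennreal (sqrt pi ^ DIM('a) * (1 / sqrt (1 + s)) ^ DIM('a))"
        using True by (subst integral_gaussian) (auto simp: real_sqrt_divide power_divide)
      finally show ?thesis using True by (simp add: ennreal_mult)
    qed simp
  qed
  also have "\<dots> = ennreal (sqrt pi ^ DIM('a)) * (\<integral>\<^sup>+s. ennreal ((1 / sqrt (1 + s)) ^ DIM('a)) * indicator {0..t} s \<partial>lborel)"
    by (rule nn_integral_cmult) measurable
  also have "ennreal (2 * exp 1) * \<dots> \<le> ennreal (2 * exp 1) * (ennreal (sqrt pi ^ DIM('a)) * ennreal (2 * (growth_G1 DIM('a) (1 + t))\<^sup>2))"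
    by (intro mult_left_mono decay_integral_le_growth_G1 t) (auto simp: Suc_le_eq)
  also have "\<dots> = ennreal (4 * exp 1 * sqrt pi ^ DIM('a) * (growth_G1 DIM('a) (1 + t))\<^sup>2)"
    by (simp add: ennreal_mult[symmetric] mult_ac)
  finally show ?thesis .
qed

subsection \<open>The two evolution problems\<close>

text \<open>The Laplacian falls on the transformed Gaussian, where it is the transform of the
  Gaussian times -|\<xi>|^2. That product is again Schwartz, so the transforms of
  \<open>\<psi>0\<close> and \<open>\<psi>1\<close> can be tested against it.\<close>

lemma fourier_transform_third_datum:
  fixes \<psi>0 \<psi>1 :: "'a::euclidean_space \<Rightarrow> complex" and B :: real
  assumes g0: "has_fourier_transform (dist_of \<psi>0) g0"
    and g1: "has_fourier_transform (dist_of \<psi>1) g1"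
    and g2: "has_fourier_transform \<psi>2 g2"
    and eq: "dist_eq \<psi>2 (\<lambda>\<phi>. of_real B * dist_laplacian (dist_of \<psi>1) \<phi> + dist_laplacian (dist_of \<psi>0) \<phi>)"
  shows "AE \<xi> in lborel. g2 \<xi> = - ((norm \<xi>)\<^sup>2 *\<^sub>R (of_real B * g1 \<xi> + g0 \<xi>))"
proof -
  let ?m = "\<lambda>\<xi>::'a. - complex_of_real ((norm \<xi>)\<^sup>2)"
  let ?h = "\<lambda>\<xi>. of_real B * (g1 \<xi> * ?m \<xi>) + g0 \<xi> * ?m \<xi>"
  have [measurable]: "g0 \<in> borel_measurable borel" "g1 \<in> borel_measurable borel"
    using g0 g1 by (simp_all add: has_fourier_transform_def)
  have s: "schwartz (\<lambda>x. ?m x * gaussian a (x - y))" if "a > 0" for a y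
    by (rule schwartz_tempered_gaussian[OF tempered_norm_square that])
  have int: "integrable lborel (\<lambda>x. g x * (?m x * gaussian a (x - y)))"
    and val: "T (fourier (\<lambda>x. ?m x * gaussian a (x - y))) = (LINT x|lborel. g x * (?m x * gaussian a (x - y)))"
    if "a > 0" "has_fourier_transform T g" for a y T and g :: "'a \<Rightarrow> complex"
    using that(2) s[OF that(1), of y] unfolding has_fourier_transform_def by blast+
  have "AE \<xi> in lborel. g2 \<xi> = ?h \<xi>"
  proof (rule AE_eq_by_gaussian_pairing[OF gaussian_integrable_fourier_transform[OF g2]])
    show "gaussian_integrable ?h" unfolding gaussian_integrable_def
    proof (intro conjI allI impI)
      fix c :: real assume c: "c > 0"
      have "integrable lborel (\<lambda>x. of_real B * (g1 x * (?m x * gaussian c x)) + g0 x * (?m x * gaussian c x))"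
        using int[OF c g1, of 0] int[OF c g0, of 0]
        by (intro Bochner_Integration.integrable_add integrable_mult_right) simp_all
      then show "integrable lborel (\<lambda>x. ?h x * gaussian c x)" by (simp add: algebra_simps)
    qed measurable
    fix a :: real and y :: 'a assume a: "a > 0"
    let ?\<phi> = "\<lambda>x. complex_of_real (gaussian a (x - y))"
    have "(LINT x|lborel. g2 x * ?\<phi> x) = \<psi>2 (fourier ?\<phi>)"
      using g2 schwartz_gaussian[OF a, of y] unfolding has_fourier_transform_def by simp
    also have "\<dots> = of_real B * dist_of \<psi>1 (laplacian (fourier ?\<phi>)) + dist_of \<psi>0 (laplacian (fourier ?\<phi>))"
      using eq schwartz_fourier_gaussian[OF a, of y] unfolding dist_eq_def dist_laplacian_def by simp
    also have "\<dots> = of_real B * (LINT x|lborel. g1 x * (?m x * gaussian a (x - y))) + (LINT x|lborel. g0 x * (?m x * gaussian a (x - y)))"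
      unfolding laplacian_fourier_gaussian[OF a] val[OF a g1] val[OF a g0] ..
    also have "\<dots> = (LINT x|lborel. of_real B * (g1 x * (?m x * gaussian a (x - y))) + g0 x * (?m x * gaussian a (x - y)))"
      by (subst Bochner_Integration.integral_add[OF integrable_mult_right[OF int[OF a g1]] int[OF a g0]]) simp
    also have "\<dots> = (LINT x|lborel. ?h x * ?\<phi> x)"
      by (intro Bochner_Integration.integral_cong refl) (simp add: algebra_simps)
    finally show "(LINT x|lborel. g2 x * ?\<phi> x) = (LINT x|lborel. ?h x * ?\<phi> x)" .
  qed
  then show ?thesis by eventually_elim (simp add: scaleR_conv_of_real algebra_simps)
qed

text \<open>\<open>H_norm\<close> rests on a chosen transform, which uniqueness replaces by the
  version g at hand. The power of 2 pi undoes the normalisation in \<open>H_norm\<close>.\<close>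

lemma bessel_weighted_L2:
  fixes f g :: "'a::euclidean_space \<Rightarrow> complex"
  assumes g: "has_fourier_transform (dist_of f) g" and f: "in_H s f"
  shows "(\<integral>\<^sup>+\<xi>. ennreal ((1 + (norm \<xi>)\<^sup>2) powr s * (norm (g \<xi>))\<^sup>2) \<partial>lborel)
    = ennreal ((2 * pi) ^ DIM('a) * (H_norm s f)\<^sup>2)"
proof -
  have ft: "has_fourier_transform (dist_of f) (fourier_transform (dist_of f))"
    unfolding fourier_transform_def using someI[of "has_fourier_transform (dist_of f)", OF g] .
  have ae: "AE \<xi> in lborel. g \<xi> = fourier_transform (dist_of f) \<xi>"
    by (rule has_fourier_transform_unique[OF g ft]) simp
  have "(\<integral>\<^sup>+\<xi>. ennreal ((1 + (norm \<xi>)\<^sup>2) powr s * (norm (g \<xi>))\<^sup>2) \<partial>lborel)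
      = (\<integral>\<^sup>+\<xi>. ennreal ((norm (bessel_weighted s f \<xi>))\<^sup>2) \<partial>lborel)"
  proof (rule nn_integral_cong_AE)
    show "AE \<xi> in lborel. ennreal ((1 + (norm \<xi>)\<^sup>2) powr s * (norm (g \<xi>))\<^sup>2) = ennreal ((norm (bessel_weighted s f \<xi>))\<^sup>2)"
      using ae
    proof eventually_elim
      case (elim \<xi>)
      have "((1 + (norm \<xi>)\<^sup>2) powr (s / 2))\<^sup>2 = (1 + (norm \<xi>)\<^sup>2) powr s"
        by (simp add: power2_eq_square powr_add[symmetric])
      then show ?case using elim by (simp add: bessel_weighted_def power_mult_distrib)
    qed
  qed
  also have "\<dots> = ennreal ((L2_norm (bessel_weighted s f))\<^sup>2)"
    using f unfolding L2_norm_square by (intro nn_integral_eq_integral) (auto simp: in_H_def in_L2_def)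
  also have "(L2_norm (bessel_weighted s f))\<^sup>2 = (2 * pi) ^ DIM('a) * (H_norm s f)\<^sup>2"
  proof -
    have "((2 * pi) powr (- (real DIM('a) / 2)))\<^sup>2 = 1 / (2 * pi) ^ DIM('a)"
      by (simp add: power2_eq_square powr_add[symmetric] powr_minus_divide powr_realpow)
    then show ?thesis by (simp add: H_norm_def power_mult_distrib)
  qed
  finally show ?thesis .
qed

text \<open>Each notion of solution quantifies over its own transforms of the data, so g0, h0 and
  g1, h1 are identified almost everywhere. The frequency 0, which the estimate at fixed r > 0 leaves
  out, is a null set.\<close>

lemma solution_difference_pointwise:
  fixes w w1 w2 v v1 :: "'a::euclidean_space \<Rightarrow> real \<Rightarrow> complex"
  assumes B: "b * \<nu> > 0" and k: "\<kappa> > 0" and g: "\<gamma> > 1"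
    and g0: "has_fourier_transform (dist_of \<psi>0) g0"
    and g1: "has_fourier_transform (dist_of \<psi>1) g1"
    and g2: "has_fourier_transform \<psi>2 g2"
    and h0: "has_fourier_transform (dist_of \<psi>0) h0"
    and h1: "has_fourier_transform (dist_of \<psi>1) h1"
    and eq: "dist_eq \<psi>2 (\<lambda>\<phi>. of_real (b * \<nu>) * dist_laplacian (dist_of \<psi>1) \<phi> + dist_laplacian (dist_of \<psi>0) \<phi>)"
    and bs: "AE \<xi> in lborel. blackstock_ode b \<nu> \<gamma> \<kappa> (- (norm \<xi>)\<^sup>2) (w \<xi>) (w1 \<xi>) (w2 \<xi>) \<and>
           w \<xi> 0 = g0 \<xi> \<and> w1 \<xi> 0 = g1 \<xi> \<and> w2 \<xi> 0 = g2 \<xi>"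
    and ve: "AE \<xi> in lborel. viscoelastic_ode b \<nu> (- (norm \<xi>)\<^sup>2) (v \<xi>) (v1 \<xi>) \<and>
           v \<xi> 0 = h0 \<xi> \<and> v1 \<xi> 0 = h1 \<xi>"
    and t: "t \<ge> 0"
  shows "AE \<xi> in lborel. (norm (w \<xi> t - v \<xi> t))\<^sup>2 \<le> \<gamma> * (\<gamma> - 1) / 2 * \<kappa> * (1 + b * \<nu> + 1 / (b * \<nu>)) *
           (min t (1 / (norm \<xi>)\<^sup>2) * (norm (g1 \<xi>))\<^sup>2 + (1 + (norm \<xi>)\<^sup>2) * (norm (g0 \<xi>))\<^sup>2)"
proof -
  have e0: "AE \<xi> in lborel. g0 \<xi> = h0 \<xi>" by (rule has_fourier_transform_unique[OF g0 h0]) simp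
  have e1: "AE \<xi> in lborel. g1 \<xi> = h1 \<xi>" by (rule has_fourier_transform_unique[OF g1 h1]) simp
  from bs ve e0 e1 fourier_transform_third_datum[OF g0 g1 g2 eq] AE_lborel_singleton[of 0]
  show ?thesis
  proof eventually_elim
    case (elim \<xi>)
    then show ?case
      using blackstock_viscoelastic_pointwise[of "norm \<xi>" b \<nu> \<kappa> \<gamma> "w \<xi>" "w1 \<xi>" "w2 \<xi>" "v \<xi>" "v1 \<xi>" t]
        B k g t by auto
  qed
qed

lemma solution_difference_bound:
  fixes \<psi>0 \<psi>1 :: "'a::euclidean_space \<Rightarrow> complex"
  defines "M \<equiv> 4 * exp 1 * sqrt pi ^ DIM('a) + (2 * pi) ^ DIM('a)"
  assumes B: "b * \<nu> > 0" and k: "\<kappa> > 0" and g: "\<gamma> > 1"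
    and H0: "in_H 2 \<psi>0" and L1: "in_L1 \<psi>1" and H1: "in_H 1 \<psi>1"
    and eq: "dist_eq \<psi>2 (\<lambda>\<phi>. of_real (b * \<nu>) * dist_laplacian (dist_of \<psi>1) \<phi> + dist_laplacian (dist_of \<psi>0) \<phi>)"
    and bs: "blackstock_solution b \<nu> \<gamma> \<kappa> \<psi>0 \<psi>1 \<psi>2 \<psi>"
    and ve: "viscoelastic_solution b \<nu> \<psi>0 \<psi>1 \<psi>v"
    and t: "t \<ge> 0"
  shows "in_L2 (\<lambda>x. \<psi> t x - \<psi>v t x)"
    and "L2_norm (\<lambda>x. \<psi> t x - \<psi>v t x) \<le>
      sqrt \<kappa> * sqrt (\<gamma> * (\<gamma> - 1) / 2 * (1 + b * \<nu> + 1 / (b * \<nu>)) * M) * growth_G1 DIM('a) (1 + t) *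
      (H_norm 2 \<psi>0 + H_norm 1 \<psi>1 + L1_norm \<psi>1)"
proof -
  obtain g0 g1 g2 w w1 w2 where
    g0: "has_fourier_transform (dist_of \<psi>0) g0" and g1: "has_fourier_transform (dist_of \<psi>1) g1"
    and g2: "has_fourier_transform \<psi>2 g2"
    and w: "\<And>t. t \<ge> 0 \<Longrightarrow> in_L2 (\<psi> t) \<and> has_fourier_transform (dist_of (\<psi> t)) (\<lambda>\<xi>. w \<xi> t)"
    and bs': "AE \<xi> in lborel. blackstock_ode b \<nu> \<gamma> \<kappa> (- (norm \<xi>)\<^sup>2) (w \<xi>) (w1 \<xi>) (w2 \<xi>) \<and>
           w \<xi> 0 = g0 \<xi> \<and> w1 \<xi> 0 = g1 \<xi> \<and> w2 \<xi> 0 = g2 \<xi>"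
    using bs unfolding blackstock_solution_def by blast
  obtain h0 h1 v v1 where
    h0: "has_fourier_transform (dist_of \<psi>0) h0" and h1: "has_fourier_transform (dist_of \<psi>1) h1"
    and v: "\<And>t. t \<ge> 0 \<Longrightarrow> in_L2 (\<psi>v t) \<and> has_fourier_transform (dist_of (\<psi>v t)) (\<lambda>\<xi>. v \<xi> t)"
    and ve': "AE \<xi> in lborel. viscoelastic_ode b \<nu> (- (norm \<xi>)\<^sup>2) (v \<xi>) (v1 \<xi>) \<and>
           v \<xi> 0 = h0 \<xi> \<and> v1 \<xi> 0 = h1 \<xi>"
    using ve unfolding viscoelastic_solution_def by blast
  have [measurable]: "g0 \<in> borel_measurable borel" "g1 \<in> borel_measurable borel"
      "(\<lambda>\<xi>. w \<xi> t) \<in> borel_measurable borel" "(\<lambda>\<xi>. v \<xi> t) \<in> borel_measurable borel"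
    using g0 g1 w[OF t] v[OF t] by (simp_all add: has_fourier_transform_def)
  show in_L2: "in_L2 (\<lambda>x. \<psi> t x - \<psi>v t x)" using w[OF t] v[OF t] by (intro in_L2_diff) auto
  define P where "P = \<gamma> * (\<gamma> - 1) / 2 * (1 + b * \<nu> + 1 / (b * \<nu>))"
  define G where "G = growth_G1 DIM('a) (1 + t)"
  define S where "S = H_norm 2 \<psi>0 + H_norm 1 \<psi>1 + L1_norm \<psi>1"
  have P: "P \<ge> 0" using g B by (simp add: P_def)
  have G: "G \<ge> 1" using growth_G1_ge_1[OF t] by (simp add: G_def)
  have nn: "H_norm 2 \<psi>0 \<ge> 0" "H_norm 1 \<psi>1 \<ge> 0" "L1_norm \<psi>1 \<ge> 0"
    by (simp_all add: H_norm_def L1_norm_def)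
  then have S: "S \<ge> 0" by (simp add: S_def)
  let ?A = "4 * exp 1 * sqrt pi ^ DIM('a)" and ?D = "(2 * pi) ^ DIM('a)"
  define y where "y \<xi> = w \<xi> t - v \<xi> t" for \<xi>
  have [measurable]: "y \<in> borel_measurable borel" unfolding y_def by measurable
  have "(\<integral>\<^sup>+\<xi>. ennreal ((norm (y \<xi>))\<^sup>2) \<partial>lborel) \<le>
     (\<integral>\<^sup>+\<xi>. ennreal (P * \<kappa>) * (ennreal ((L1_norm \<psi>1)\<^sup>2) * (ennreal (min t (1 / (norm \<xi>)\<^sup>2)) * indicator (cball 0 1) \<xi>)
        + ennreal ((1 + (norm \<xi>)\<^sup>2) powr 1 * (norm (g1 \<xi>))\<^sup>2) + ennreal ((1 + (norm \<xi>)\<^sup>2) powr 2 * (norm (g0 \<xi>))\<^sup>2)) \<partial>lborel)"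
  proof (rule nn_integral_mono_AE)
    show "AE \<xi> in lborel. ennreal ((norm (y \<xi>))\<^sup>2) \<le>
        ennreal (P * \<kappa>) * (ennreal ((L1_norm \<psi>1)\<^sup>2) * (ennreal (min t (1 / (norm \<xi>)\<^sup>2)) * indicator (cball 0 1) \<xi>)
        + ennreal ((1 + (norm \<xi>)\<^sup>2) powr 1 * (norm (g1 \<xi>))\<^sup>2) + ennreal ((1 + (norm \<xi>)\<^sup>2) powr 2 * (norm (g0 \<xi>))\<^sup>2))"
      using solution_difference_pointwise[OF B k g g0 g1 g2 h0 h1 eq bs' ve' t]
        fourier_transform_L1[OF L1[unfolded in_L1_def] g1]
    proof eventually_elim
      case (elim \<xi>)
      let ?r = "(norm \<xi>)\<^sup>2" and ?i = "indicator (cball 0 1) \<xi> :: real"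
      \<comment> \<open>Adding the two bounds avoids splitting the integral: the indicator confines
        the first term to the unit ball, while the second may be integrated everywhere.\<close>
      have "min t (1 / ?r) * (norm (g1 \<xi>))\<^sup>2 \<le> (L1_norm \<psi>1)\<^sup>2 * (min t (1 / ?r) * ?i) + (1 + ?r) powr 1 * (norm (g1 \<xi>))\<^sup>2"
      proof (cases "\<xi> \<in> cball 0 1")
        case True
        have "min t (1 / ?r) * (norm (g1 \<xi>))\<^sup>2 \<le> min t (1 / ?r) * (L1_norm \<psi>1)\<^sup>2"
          using elim(2) t by (intro mult_left_mono power_mono) auto
        then show ?thesis using True by (simp add: mult.commute add_increasing2)
      next
        case False
        then have "1 \<le> norm \<xi>" by simp
        then have "1 / ?r \<le> 1" by (simp add: divide_le_eq_1 one_le_power)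
        then have "min t (1 / ?r) \<le> (1 + ?r) powr 1" by (simp add: min_le_iff_disj add_increasing2)
        then show ?thesis using False by (simp add: mult_right_mono)
      qed
      moreover have "(1 + ?r) * (norm (g0 \<xi>))\<^sup>2 \<le> (1 + ?r) powr 2 * (norm (g0 \<xi>))\<^sup>2"
        using powr_mono[of 1 2 "1 + ?r"] by (intro mult_right_mono) auto
      ultimately have "min t (1 / ?r) * (norm (g1 \<xi>))\<^sup>2 + (1 + ?r) * (norm (g0 \<xi>))\<^sup>2 \<le>
          (L1_norm \<psi>1)\<^sup>2 * (min t (1 / ?r) * ?i) + (1 + ?r) powr 1 * (norm (g1 \<xi>))\<^sup>2 + (1 + ?r) powr 2 * (norm (g0 \<xi>))\<^sup>2"
        (is "?a \<le> ?b") by linarith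
      then have "P * \<kappa> * ?a \<le> P * \<kappa> * ?b" using P k by (intro mult_left_mono) auto
      moreover have "(norm (y \<xi>))\<^sup>2 \<le> P * \<kappa> * ?a" using elim(1) by (simp only: y_def P_def mult_ac)
      ultimately have "ennreal ((norm (y \<xi>))\<^sup>2) \<le> ennreal (P * \<kappa> * ?b)" by (intro ennreal_leI) linarith
      also have "\<dots> = ennreal (P * \<kappa>) * (ennreal ((L1_norm \<psi>1)\<^sup>2) * (ennreal (min t (1 / ?r)) * indicator (cball 0 1) \<xi>)
        + ennreal ((1 + ?r) powr 1 * (norm (g1 \<xi>))\<^sup>2) + ennreal ((1 + ?r) powr 2 * (norm (g0 \<xi>))\<^sup>2))"
        using P k t by (simp add: ennreal_mult ennreal_plus split: split_indicator)
      finally show ?case .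
    qed
  qed
  also have "\<dots> = ennreal (P * \<kappa>) * (ennreal ((L1_norm \<psi>1)\<^sup>2) * (\<integral>\<^sup>+\<xi>. ennreal (min t (1 / (norm \<xi>)\<^sup>2)) * indicator (cball 0 1) (\<xi>::'a) \<partial>lborel)
      + (\<integral>\<^sup>+\<xi>. ennreal ((1 + (norm \<xi>)\<^sup>2) powr 1 * (norm (g1 \<xi>))\<^sup>2) \<partial>lborel) + (\<integral>\<^sup>+\<xi>. ennreal ((1 + (norm \<xi>)\<^sup>2) powr 2 * (norm (g0 \<xi>))\<^sup>2) \<partial>lborel))"
  proof -
    have split: "(\<integral>\<^sup>+\<xi>. c * (d * f \<xi> + g \<xi> + h \<xi>) \<partial>lborel)
        = c * (d * (\<integral>\<^sup>+\<xi>. f \<xi> \<partial>lborel) + (\<integral>\<^sup>+\<xi>. g \<xi> \<partial>lborel) + (\<integral>\<^sup>+\<xi>. h \<xi> \<partial>lborel))"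
      if [measurable]: "f \<in> borel_measurable borel" "g \<in> borel_measurable borel" "h \<in> borel_measurable borel"
      for c d and f g h :: "'a \<Rightarrow> ennreal"
      by (simp add: nn_integral_add nn_integral_cmult)
    have [measurable]: "cball (0::'a) 1 \<in> sets borel"
      "(\<lambda>\<xi>. ennreal ((1 + (norm \<xi>)\<^sup>2) powr 1 * (norm (g1 \<xi>))\<^sup>2)) \<in> borel_measurable borel"
      "(\<lambda>\<xi>. ennreal ((1 + (norm \<xi>)\<^sup>2) powr 2 * (norm (g0 \<xi>))\<^sup>2)) \<in> borel_measurable borel"
      by simp_all
    show ?thesis by (rule split) measurable
  qed
  also have "\<dots> \<le> ennreal (P * \<kappa>) * (ennreal ((L1_norm \<psi>1)\<^sup>2) * ennreal (?A * G\<^sup>2)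
      + ennreal (?D * (H_norm 1 \<psi>1)\<^sup>2) + ennreal (?D * (H_norm 2 \<psi>0)\<^sup>2))"
    unfolding bessel_weighted_L2[OF g1 H1] bessel_weighted_L2[OF g0 H0] G_def
    by (intro mult_left_mono add_mono low_frequency_integral_le t order_refl) auto
  also have "\<dots> = ennreal (P * \<kappa> * ((L1_norm \<psi>1)\<^sup>2 * (?A * G\<^sup>2) + ?D * (H_norm 1 \<psi>1)\<^sup>2 + ?D * (H_norm 2 \<psi>0)\<^sup>2))"
    using P k by (simp add: ennreal_mult ennreal_plus)
  also have "\<dots> \<le> ennreal (P * \<kappa> * (M * G\<^sup>2 * S\<^sup>2))"
  proof (intro ennreal_leI mult_left_mono)
    have "(L1_norm \<psi>1)\<^sup>2 \<le> S\<^sup>2" using nn by (intro power_mono) (auto simp: S_def)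
    then have "(L1_norm \<psi>1)\<^sup>2 * (?A * G\<^sup>2) \<le> S\<^sup>2 * (?A * G\<^sup>2)" by (intro mult_right_mono) auto
    moreover have "?D * ((H_norm 1 \<psi>1)\<^sup>2 + (H_norm 2 \<psi>0)\<^sup>2) \<le> ?D * (S\<^sup>2 * G\<^sup>2)"
    proof (rule mult_left_mono)
      have "(H_norm 1 \<psi>1)\<^sup>2 + (H_norm 2 \<psi>0)\<^sup>2 \<le> (H_norm 1 \<psi>1 + H_norm 2 \<psi>0)\<^sup>2"
        using nn by (simp add: power2_sum)
      also have "\<dots> \<le> S\<^sup>2" using nn by (intro power_mono) (auto simp: S_def)
      also have "\<dots> \<le> S\<^sup>2 * G\<^sup>2" using G by (simp add: mult_le_cancel_left1 one_le_power)
      finally show "(H_norm 1 \<psi>1)\<^sup>2 + (H_norm 2 \<psi>0)\<^sup>2 \<le> S\<^sup>2 * G\<^sup>2" .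
    qed simp
    \<comment> \<open>Stated for plain reals, so that the rearrangement does not touch the norms and
      the powers of pi.\<close>
    moreover have "x * (A * g) + D * h1 + D * h0 \<le> (A + D) * g * s"
      if "x * (A * g) \<le> s * (A * g)" "D * (h1 + h0) \<le> D * (s * g)" for x A g D h0 h1 s :: real
      using that by (simp add: algebra_simps)
    ultimately show "(L1_norm \<psi>1)\<^sup>2 * (?A * G\<^sup>2) + ?D * (H_norm 1 \<psi>1)\<^sup>2 + ?D * (H_norm 2 \<psi>0)\<^sup>2 \<le> M * G\<^sup>2 * S\<^sup>2"
      unfolding M_def by blast
  qed (use P k in auto)
  finally have fin: "(\<integral>\<^sup>+\<xi>. ennreal ((norm (y \<xi>))\<^sup>2) \<partial>lborel) \<le> ennreal (P * \<kappa> * (M * G\<^sup>2 * S\<^sup>2))" .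
  have M: "M \<ge> 0" by (simp add: M_def)
  have int: "integrable lborel (\<lambda>\<xi>. (norm (y \<xi>))\<^sup>2)"
    using fin by (intro integrableI_bounded) (auto simp: less_top[symmetric] top_unique)
  then have y: "in_L2 y" by (simp add: in_L2_def)
  have "(LINT \<xi>|lborel. (norm (y \<xi>))\<^sup>2) \<le> P * \<kappa> * (M * G\<^sup>2 * S\<^sup>2)"
    using fin P k M by (simp add: nn_integral_eq_integral[OF int])
  then have "L2_norm y \<le> sqrt (P * \<kappa> * (M * G\<^sup>2 * S\<^sup>2))"
    unfolding L2_norm_def by (rule real_sqrt_le_mono)
  also have "\<dots> = sqrt \<kappa> * sqrt (P * M) * G * S"
    using G S by (simp add: real_sqrt_mult mult_ac)
  finally have y_le: "L2_norm y \<le> \<dots>" .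
  have "L2_norm (\<lambda>x. \<psi> t x - \<psi>v t x) \<le> L2_norm y / sqrt (2 * pi) ^ DIM('a)"
  proof (rule L2_norm_le_fourier_transform[OF in_L2 y])
    fix a :: real and z :: 'a assume a: "a > 0"
    let ?\<phi> = "\<lambda>\<xi>. cis (z \<bullet> \<xi>) * gaussian a \<xi>"
    have s: "schwartz ?\<phi>" by (rule schwartz_gaussian_modulated[OF a])
    have i: "integrable lborel (\<lambda>x. f x * fourier ?\<phi> x)" if "in_L2 f" for f
    proof -
      have "integrable lborel (\<lambda>x. of_real (sqrt (pi / a) ^ DIM('a)) * (f x * gaussian (1 / (4 * a)) (x - z)))"
        using a by (intro integrable_mult_right gaussian_integrable_translate gaussian_integrable_L2 that) simp
      then show ?thesis by (subst fourier_gaussian_modulated[OF a]) (simp add: mult_ac)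
    qed
    \<comment> \<open>Linearity of the pairing needs both integrals to exist; square integrability
      at the fixed time provides this through \<open>i\<close>.\<close>
    have "dist_of (\<lambda>x. \<psi> t x - \<psi>v t x) (fourier ?\<phi>) = dist_of (\<psi> t) (fourier ?\<phi>) - dist_of (\<psi>v t) (fourier ?\<phi>)"
      unfolding dist_of_def left_diff_distrib
      using w[OF t] v[OF t] by (intro Bochner_Integration.integral_diff i) auto
    also have "\<dots> = (LINT \<xi>|lborel. w \<xi> t * ?\<phi> \<xi>) - (LINT \<xi>|lborel. v \<xi> t * ?\<phi> \<xi>)"
      using w[OF t] v[OF t] s unfolding has_fourier_transform_def by simp
    also have "\<dots> = (LINT \<xi>|lborel. y \<xi> * ?\<phi> \<xi>)"
      unfolding y_def left_diff_distrib
      using w[OF t] v[OF t] s unfolding has_fourier_transform_def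
      by (intro Bochner_Integration.integral_diff[symmetric]) blast+
    finally show "dist_of (\<lambda>x. \<psi> t x - \<psi>v t x) (fourier ?\<phi>) = (LINT \<xi>|lborel. y \<xi> * ?\<phi> \<xi>)" .
  qed
  also have "\<dots> \<le> L2_norm y"
  proof -
    \<comment> \<open>The normalising factor of the transform is at most 1 in the final bound and is
      given away.\<close>
    have "1 \<le> sqrt (2 * pi)" using pi_gt3 by simp
    then have "1 \<le> sqrt (2 * pi) ^ DIM('a)" by (rule one_le_power)
    then show ?thesis using divide_left_mono[of 1 "sqrt (2 * pi) ^ DIM('a)" "L2_norm y"] by simp
  qed
  also note y_le
  finally show "L2_norm (\<lambda>x. \<psi> t x - \<psi>v t x) \<le>
      sqrt \<kappa> * sqrt (\<gamma> * (\<gamma> - 1) / 2 * (1 + b * \<nu> + 1 / (b * \<nu>)) * M) * growth_G1 DIM('a) (1 + t) *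
      (H_norm 2 \<psi>0 + H_norm 1 \<psi>1 + L1_norm \<psi>1)"
    by (simp only: P_def G_def S_def)
qed

theorem theorem3p2:
  fixes b \<nu> \<gamma> :: real
  assumes "b > 0" and "\<nu> > 0" and "1 < \<gamma>" and "\<gamma> \<le> 5 / 3"
  shows "\<exists>C>0. \<exists>\<kappa>0>0. \<forall>\<kappa>. 0 < \<kappa> \<and> \<kappa> < \<kappa>0 \<longrightarrow>
    (\<forall>(\<psi>0 :: real ^ 'n \<Rightarrow> complex) (\<psi>1 :: real ^ 'n \<Rightarrow> complex) (\<psi>2 :: (real ^ 'n) distrib)
      (\<psi> :: real \<Rightarrow> real ^ 'n \<Rightarrow> complex) (\<psi>v :: real \<Rightarrow> real ^ 'n \<Rightarrow> complex).
      in_H 2 \<psi>0 \<and> in_L1 \<psi>0 \<and> in_H 1 \<psi>1 \<and> in_L1 \<psi>1 \<and>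
      dist_eq \<psi>2 (\<lambda>\<phi>. of_real (b * \<nu>) * dist_laplacian (dist_of \<psi>1) \<phi>
                      + dist_laplacian (dist_of \<psi>0) \<phi>) \<and>
      \<not> (AE x in lborel. \<psi>0 x = 0) \<and> \<not> (AE x in lborel. \<psi>1 x = 0) \<and>
      \<not> dist_eq \<psi>2 (\<lambda>_. 0) \<and>
      blackstock_solution b \<nu> \<gamma> \<kappa> \<psi>0 \<psi>1 \<psi>2 \<psi> \<and>
      viscoelastic_solution b \<nu> \<psi>0 \<psi>1 \<psi>v
      \<longrightarrow>
      (let u = (\<lambda>t x. \<psi> t x - \<psi>v t x);
           Q = (\<lambda>t. inverse (growth_G1 CARD('n) (1 + t)) * L2_norm (u t))
       in (\<forall>t\<ge>0. in_L2 (u t)) \<and> bdd_above (Q ` {0..}) \<and>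
          (SUP t\<in>{0..}. Q t)
            \<le> sqrt \<kappa> * C * ((H_norm 2 \<psi>0 + L1_norm \<psi>0) + (H_norm 1 \<psi>1 + L1_norm \<psi>1))))"
proof -
  define M where "M = 4 * exp 1 * sqrt pi ^ DIM(real ^ 'n) + (2 * pi) ^ DIM(real ^ 'n)"
  \<comment> \<open>Depends on b, \<nu>, \<gamma> and the dimension only; \<kappa> has been factored
    out of the square root.\<close>
  define C where "C = sqrt (\<gamma> * (\<gamma> - 1) / 2 * (1 + b * \<nu> + 1 / (b * \<nu>)) * M)"
  have B: "b * \<nu> > 0" using assms by simp
  have "M > 0" unfolding M_def by (intro add_pos_pos) auto
  then have C: "C > 0" using assms B by (simp add: C_def add_pos_pos)
  have main: "let u = (\<lambda>t x. \<psi> t x - \<psi>v t x);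
           Q = (\<lambda>t. inverse (growth_G1 CARD('n) (1 + t)) * L2_norm (u t))
       in (\<forall>t\<ge>0. in_L2 (u t)) \<and> bdd_above (Q ` {0..}) \<and>
          (SUP t\<in>{0..}. Q t) \<le> sqrt \<kappa> * C * ((H_norm 2 \<psi>0 + L1_norm \<psi>0) + (H_norm 1 \<psi>1 + L1_norm \<psi>1))"
    if k: "0 < \<kappa>" and H0: "in_H 2 \<psi>0" and H1: "in_H 1 \<psi>1" and L1: "in_L1 \<psi>1"
      and eq: "dist_eq \<psi>2 (\<lambda>\<phi>. of_real (b * \<nu>) * dist_laplacian (dist_of \<psi>1) \<phi> + dist_laplacian (dist_of \<psi>0) \<phi>)"
      and bs: "blackstock_solution b \<nu> \<gamma> \<kappa> \<psi>0 \<psi>1 \<psi>2 \<psi>"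
      and ve: "viscoelastic_solution b \<nu> \<psi>0 \<psi>1 \<psi>v"
    for \<kappa> and \<psi>0 \<psi>1 :: "real ^ 'n \<Rightarrow> complex" and \<psi>2 and \<psi> \<psi>v :: "real \<Rightarrow> real ^ 'n \<Rightarrow> complex"
  proof -
    define u where "u = (\<lambda>t x. \<psi> t x - \<psi>v t x)"
    define Q where "Q = (\<lambda>t. inverse (growth_G1 CARD('n) (1 + t)) * L2_norm (u t))"
    let ?R = "sqrt \<kappa> * C * ((H_norm 2 \<psi>0 + L1_norm \<psi>0) + (H_norm 1 \<psi>1 + L1_norm \<psi>1))"
    note bound = solution_difference_bound[OF B k assms(3) H0 L1 H1 eq bs ve, folded M_def, folded C_def]
    have Q_le: "Q t \<le> ?R" if t: "t \<ge> 0" for t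
    proof -
      have G: "growth_G1 CARD('n) (1 + t) > 0" using growth_G1_ge_1[OF t, of "CARD('n)"] by linarith
      have "L2_norm (u t) \<le> growth_G1 CARD('n) (1 + t) * (sqrt \<kappa> * C * (H_norm 2 \<psi>0 + H_norm 1 \<psi>1 + L1_norm \<psi>1))"
        using bound(2)[OF t] by (simp add: u_def mult_ac)
      then have "Q t \<le> sqrt \<kappa> * C * (H_norm 2 \<psi>0 + H_norm 1 \<psi>1 + L1_norm \<psi>1)"
        using G by (simp add: Q_def field_simps)
      also have "\<dots> \<le> ?R"
        using k C by (intro mult_left_mono) (auto simp: L1_norm_def)
      finally show ?thesis .
    qed
    \<comment> \<open>A supremum of reals carries information only for a set bounded above; one
      uniform bound yields both this and the estimate.\<close>
    have "bdd_above (Q ` {0..})" using Q_le by (intro bdd_aboveI[of _ ?R]) auto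
    moreover have "(SUP t\<in>{0..}. Q t) \<le> ?R" using Q_le by (intro cSUP_least) auto
    moreover have "\<forall>t\<ge>0. in_L2 (u t)" using bound(1) by (simp add: u_def)
    ultimately show ?thesis by (simp add: Let_def u_def Q_def)
  qed
  show ?thesis
  \<comment> \<open>\<open>main\<close> covers every positive \<kappa>, so the threshold 1 is an
    arbitrary choice.\<close>
  proof (intro exI[of _ C] exI[of _ "1::real"] conjI C zero_less_one allI impI, elim conjE)
    fix \<kappa> and \<psi>0 \<psi>1 :: "real ^ 'n \<Rightarrow> complex" and \<psi>2 and \<psi> \<psi>v :: "real \<Rightarrow> real ^ 'n \<Rightarrow> complex"
    assume "0 < \<kappa>" "in_H 2 \<psi>0" "in_H 1 \<psi>1" "in_L1 \<psi>1"
      "dist_eq \<psi>2 (\<lambda>\<phi>. of_real (b * \<nu>) * dist_laplacian (dist_of \<psi>1) \<phi> + dist_laplacian (dist_of \<psi>0) \<phi>)"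
      "blackstock_solution b \<nu> \<gamma> \<kappa> \<psi>0 \<psi>1 \<psi>2 \<psi>" "viscoelastic_solution b \<nu> \<psi>0 \<psi>1 \<psi>v"
    then show "let u = (\<lambda>t x. \<psi> t x - \<psi>v t x);
           Q = (\<lambda>t. inverse (growth_G1 CARD('n) (1 + t)) * L2_norm (u t))
       in (\<forall>t\<ge>0. in_L2 (u t)) \<and> bdd_above (Q ` {0..}) \<and>
          (SUP t\<in>{0..}. Q t) \<le> sqrt \<kappa> * C * ((H_norm 2 \<psi>0 + L1_norm \<psi>0) + (H_norm 1 \<psi>1 + L1_norm \<psi>1))"
      by (rule main)
  qed
qed

end
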